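(* Let $n\geq 2$. For each $j\in\mathbb{N}$ let $(X_j^{(n)},x_j^* )$ be a based compact CW space which is $(n-1)$-connected, locally $(n-1)$-connected and $n$-semilocally simply connected. Let $(Y_i^{(n)},y_i^* )=\bigvee_{j\leq i}(X_j^{(n)},x_j^* )$, and let $(X,* )=\varprojlim (Y_i^{(n)},y_i^* )$ be the inverse limit with respect to the collapsing maps $r_k^i:Y_i^{(n)}\to Y_k^{(n)}$ ($k\leq i$). Then the natural homomorphism $$\beta_n:\pi_n(X,* )\to \varprojlim \pi_n(Y_i^{(n)},y_i^* ),\qquad \beta_n([f])=([R_1\circ f],[R_2\circ f],\dots),$$ is a bijection.
   Context: For $k\leq i$, the collapsing map $r_k^i:Y_i^{(n)}\to Y_k^{(n)}$ is the identity on $Y_k^{(n)}$ and sends each $X_j^{(n)}$ with $k<j\leq i$ to the base point. The inverse limit of the groups $\pi_n(Y_i^{(n)},y_i^* )$ is taken with respect to the induced homomorphisms $(r_k^i)_*$. For each $i$, $R_i:X\to Y_i^{(n)}$ denotes the natural projection of the inverse limit, which fixes $Y_i^{(n)}\subseteq X$ pointwise and collapses the summands $X_j^{(n)}$, $j>i$, to the base point. A space $X$ obtained in this way is called an $n$-Hawaiian like space. *)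

theory Defs
  imports "HOL-Analysis.Analysis"
begin

definition disc_set :: "nat \<Rightarrow> (nat \<Rightarrow> real) set" where
  "disc_set d = {x \<in> topspace (Euclidean_space d). (\<Sum>i<d. x i ^ 2) \<le> 1}"

definition open_disc_set :: "nat \<Rightarrow> (nat \<Rightarrow> real) set" where
  "open_disc_set d = {x \<in> topspace (Euclidean_space d). (\<Sum>i<d. x i ^ 2) < 1}"

definition bdry_disc_set :: "nat \<Rightarrow> (nat \<Rightarrow> real) set" where
  "bdry_disc_set d = {x \<in> topspace (Euclidean_space d). (\<Sum>i<d. x i ^ 2) = 1}"

text \<open>A finite CW complex: a Hausdorff space which is the disjoint union of finitely many
  open cells; each cell comes with a characteristic map from the closed disc of its dimension,
  which restricts to a homeomorphism of the open disc onto the cell and maps the boundary sphere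
  into the union of cells of lower dimension. (For finitely many cells the weak topology
  condition is automatic, and compact CW complexes are exactly the finite ones.)\<close>

definition finite_CW_complex :: "'a topology \<Rightarrow> bool" where
  "finite_CW_complex X \<longleftrightarrow> Hausdorff_space X \<and>
    (\<exists>C :: (nat \<times> ((nat \<Rightarrow> real) \<Rightarrow> 'a)) set. finite C \<and>
      (\<forall>(d, \<phi>) \<in> C.
          continuous_map (subtopology (Euclidean_space d) (disc_set d)) X \<phi> \<and>
          homeomorphic_map (subtopology (Euclidean_space d) (open_disc_set d))
                           (subtopology X (\<phi> ` open_disc_set d)) \<phi> \<and>
          \<phi> ` bdry_disc_set d \<subseteq> \<Union>{\<psi> ` open_disc_set d' | d' \<psi>. (d', \<psi>) \<in> C \<and> d' < d}) \<and>
      (\<forall>c \<in> C. \<forall>c' \<in> C. c \<noteq> c' \<longrightarrow>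
          (snd c ` open_disc_set (fst c)) \<inter> (snd c' ` open_disc_set (fst c')) = {}) \<and>
      topspace X = \<Union>{\<phi> ` open_disc_set d | d \<phi>. (d, \<phi>) \<in> C})"

definition sphere_base :: "nat \<Rightarrow> real" where
  "sphere_base = (\<lambda>i. if i = 0 then 1 else 0)"

definition based_maps :: "nat \<Rightarrow> 'a topology \<Rightarrow> 'a \<Rightarrow> ((nat \<Rightarrow> real) \<Rightarrow> 'a) set" where
  "based_maps n X x = {f. continuous_map (nsphere n) X f \<and> f sphere_base = x}"

definition hclass :: "nat \<Rightarrow> 'a topology \<Rightarrow> 'a \<Rightarrow> ((nat \<Rightarrow> real) \<Rightarrow> 'a)
                       \<Rightarrow> ((nat \<Rightarrow> real) \<Rightarrow> 'a) set" where
  "hclass n X x f = {g \<in> based_maps n X x.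
       homotopic_with (\<lambda>h. h sphere_base = x) (nsphere n) X f g}"

definition homotopy_group :: "nat \<Rightarrow> 'a topology \<Rightarrow> 'a \<Rightarrow> ((nat \<Rightarrow> real) \<Rightarrow> 'a) set set" where
  "homotopy_group n X x = hclass n X x ` based_maps n X x"

definition induced :: "nat \<Rightarrow> 'b topology \<Rightarrow> 'b \<Rightarrow> ('a \<Rightarrow> 'b)
                       \<Rightarrow> ((nat \<Rightarrow> real) \<Rightarrow> 'a) set \<Rightarrow> ((nat \<Rightarrow> real) \<Rightarrow> 'b) set" where
  "induced n Y y \<phi> C = hclass n Y y (\<phi> \<circ> (SOME f. f \<in> C))"

definition connected_upto :: "nat \<Rightarrow> 'a topology \<Rightarrow> bool" where
  "connected_upto m X \<longleftrightarrow> topspace X \<noteq> {} \<and>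
     (\<forall>k \<le> m. \<forall>x \<in> topspace X. is_singleton (homotopy_group k X x))"

definition locally_connected_upto :: "nat \<Rightarrow> 'a topology \<Rightarrow> bool" where
  "locally_connected_upto m X \<longleftrightarrow>
     (\<forall>x \<in> topspace X. \<forall>U. openin X U \<and> x \<in> U \<longrightarrow>
        (\<exists>V. openin X V \<and> x \<in> V \<and> V \<subseteq> U \<and>
           (\<forall>k \<le> m. \<forall>f. continuous_map (nsphere k) (subtopology X V) f \<longrightarrow>
              (\<exists>c. homotopic_with (\<lambda>_. True) (nsphere k) (subtopology X U) f (\<lambda>_. c)))))"

definition semilocally_n_simply_connected :: "nat \<Rightarrow> 'a topology \<Rightarrow> bool" where
  "semilocally_n_simply_connected n X \<longleftrightarrow>
     (\<forall>x \<in> topspace X. \<exists>U. openin X U \<and> x \<in> U \<and>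
        (\<forall>f \<in> based_maps n (subtopology X U) x.
            homotopic_with (\<lambda>h. h sphere_base = x) (nsphere n) X f (\<lambda>_. x)))"

text \<open>Points of wedges are \<open>None\<close> (the common base point) or \<open>Some (j, p)\<close> with
  \<open>p \<in> X\<^sub>j\<close>, \<open>p \<noteq> x\<^sub>j\<^sup>*\<close>.\<close>

definition wedge_incl :: "(nat \<Rightarrow> 'a) \<Rightarrow> nat \<Rightarrow> 'a \<Rightarrow> (nat \<times> 'a) option" where
  "wedge_incl b j p = (if p = b j then None else Some (j, p))"

definition wedge_set :: "(nat \<Rightarrow> 'a topology) \<Rightarrow> (nat \<Rightarrow> 'a) \<Rightarrow> nat \<Rightarrow> (nat \<times> 'a) option set" where
  "wedge_set Xs b i = insert None (\<Union>j\<in>{..i}. wedge_incl b j ` topspace (Xs j))"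

text \<open>\<open>Y\<^sub>i = \<or>\<^sub>j\<^sub>\<le>\<^sub>i X\<^sub>j\<close> with the quotient topology of the disjoint union.\<close>
definition wedge :: "(nat \<Rightarrow> 'a topology) \<Rightarrow> (nat \<Rightarrow> 'a) \<Rightarrow> nat \<Rightarrow> (nat \<times> 'a) option topology" where
  "wedge Xs b i = topology (\<lambda>U. U \<subseteq> wedge_set Xs b i \<and>
      (\<forall>j \<le> i. openin (Xs j) {p \<in> topspace (Xs j). wedge_incl b j p \<in> U}))"

definition collapse :: "nat \<Rightarrow> nat \<Rightarrow> (nat \<times> 'a) option \<Rightarrow> (nat \<times> 'a) option" where
  "collapse k i q = (case q of None \<Rightarrow> None | Some (j, p) \<Rightarrow> if j \<le> k then Some (j, p) else None)"

definition hawaiian_limit :: "(nat \<Rightarrow> 'a topology) \<Rightarrow> (nat \<Rightarrow> 'a)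
                              \<Rightarrow> (nat \<Rightarrow> (nat \<times> 'a) option) topology" where
  "hawaiian_limit Xs b = subtopology (product_topology (wedge Xs b) UNIV)
      {y. \<forall>k i. k \<le> i \<longrightarrow> y k = collapse k i (y i)}"

definition limit_homotopy_groups :: "nat \<Rightarrow> (nat \<Rightarrow> 'a topology) \<Rightarrow> (nat \<Rightarrow> 'a)
      \<Rightarrow> (nat \<Rightarrow> ((nat \<Rightarrow> real) \<Rightarrow> (nat \<times> 'a) option) set) set" where
  "limit_homotopy_groups n Xs b = {c. (\<forall>i. c i \<in> homotopy_group n (wedge Xs b i) None) \<and>
      (\<forall>k i. k \<le> i \<longrightarrow> induced n (wedge Xs b k) None (collapse k i) (c i) = c k)}"

definition beta :: "nat \<Rightarrow> (nat \<Rightarrow> 'a topology) \<Rightarrow> (nat \<Rightarrow> 'a)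
      \<Rightarrow> ((nat \<Rightarrow> real) \<Rightarrow> (nat \<Rightarrow> (nat \<times> 'a) option)) set
      \<Rightarrow> (nat \<Rightarrow> ((nat \<Rightarrow> real) \<Rightarrow> (nat \<times> 'a) option) set)" where
  "beta n Xs b C = (\<lambda>i. induced n (wedge Xs b i) None (\<lambda>y. y i) C)"

end

theory Submission
  imports Defs
begin

text \<open>
  A point of the inverse limit is a family of points of the \<open>X\<^sub>j\<close> of which at most one differs from
  the base point, and continuity into the limit is continuity of all components. So spheroids and
  homotopies in the limit are families of maps with pairwise disjoint supports. The theorem
  reduces to one claim: two such families of cube maps whose members are homotopic one by one are
  homotopic through families with disjoint supports. This yields injectivity; it also yields
  surjectivity, since prescribed classes in the \<open>\<pi>\<^sub>n(X\<^sub>j)\<close> are realised by placing representatives in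
  disjoint slabs of the cube, and a class of \<open>\<pi>\<^sub>n(Y\<^sub>i)\<close> is determined by its projections.

  For the claim, each member is modified inside its own support. As the \<open>X\<^sub>j\<close> are CW complexes, one
  first makes a member trivial near the boundary of its support; as they are \<open>(n-1)\<close>-connected,
  one then makes it trivial on the walls of a fine cubical grid. The supports are now disjoint
  boxes. A linear motion of their first edges makes these edges pairwise disjoint for different
  \<open>j\<close>, and then (this is where \<open>n \<ge> 2\<close> is used) the second edges can be moved freely, so that the
  support of the \<open>j\<close>-th member lies in the \<open>j\<close>-th of a sequence of disjoint slabs. After that the
  given homotopies of the members do not interfere.
\<close>

section \<open>Locally finite assembly, and spheres as collapsed cubes\<close>

text \<open>The obstacle is interference. The homotopies given for single members roam over the
  whole cube, and the supports are arbitrary disjoint open sets that may interlock and accumulate;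
  run at once, the homotopies would make two members nontrivial at one point. So every preparatory
  change has to stay inside the support that a member already has. Composing with a deformation that
  fixes the base point never enlarges a support; a contraction on a grid cell can enlarge it within
  that cell only, and the first step exists to leave a margin of one mesh width. The mesh depends on
  the member, and infinitely many boxes may accumulate; this is harmless because continuity is
  tested in each \<open>X\<^sub>j\<close> separately, where only finitely many boxes occur. The
  second edges cannot be moved at once, since two boxes may be separated in that direction alone.
  The separated family depends on the deformation chosen, so its members are finally deformed back
  inside their slabs. This gives a normal form made of the original members, and two normal forms
  can be compared member by member.\<close>

definition assemble :: "'i set \<Rightarrow> 'a \<Rightarrow> ('i \<Rightarrow> 'w \<Rightarrow> 'a) \<Rightarrow> 'w \<Rightarrow> 'a" where
  "assemble A b F w = (if \<exists>a\<in>A. F a w \<noteq> b then F (SOME a. a \<in> A \<and> F a w \<noteq> b) w else b)"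

lemma assemble_eq:
  assumes "\<And>a c. a \<in> A \<Longrightarrow> c \<in> A \<Longrightarrow> F a w \<noteq> b \<Longrightarrow> F c w \<noteq> b \<Longrightarrow> a = c" "a \<in> A" "F a w \<noteq> b"
  shows "assemble A b F w = F a w"
proof -
  have "(SOME a. a \<in> A \<and> F a w \<noteq> b) = a"
    using assms by (intro some_equality) auto
  then show ?thesis
    using assms unfolding assemble_def by auto
qed

lemma assemble_base: "(\<And>a. a \<in> A \<Longrightarrow> F a w = b) \<Longrightarrow> assemble A b F w = b"
  unfolding assemble_def by auto

lemma assemble_cases:
  "assemble A b F w = b \<and> (\<forall>a\<in>A. F a w = b) \<or> (\<exists>a\<in>A. F a w \<noteq> b \<and> assemble A b F w = F a w)"
proof (cases "\<exists>a\<in>A. F a w \<noteq> b")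
  case True
  then have "\<exists>a. a \<in> A \<and> F a w \<noteq> b" by auto
  from someI_ex[OF this] show ?thesis
    using True by (intro disjI2 bexI[of _ "SOME a. a \<in> A \<and> F a w \<noteq> b"]) (simp_all add: assemble_def)
qed (auto simp: assemble_def)

lemma assemble_neq_base: "a \<in> A \<Longrightarrow> F a w \<noteq> b \<Longrightarrow> assemble A b F w \<noteq> b"
  using assemble_cases[of A b F w] by metis

lemma assemble_cong:
  assumes "\<And>a. a \<in> A \<Longrightarrow> F a w = G a v"
  shows "assemble A b F w = assemble A b G v"
proof -
  have "(\<exists>a\<in>A. F a w \<noteq> b) \<longleftrightarrow> (\<exists>a\<in>A. G a v \<noteq> b)" using assms by simp
  moreover have "(\<lambda>a. a \<in> A \<and> F a w \<noteq> b) = (\<lambda>a. a \<in> A \<and> G a v \<noteq> b)" using assms by auto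
  moreover have "F (SOME a. a \<in> A \<and> G a v \<noteq> b) w = G (SOME a. a \<in> A \<and> G a v \<noteq> b) v" if "\<exists>a\<in>A. G a v \<noteq> b"
    by (rule assms) (use someI_ex[of "\<lambda>a. a \<in> A \<and> G a v \<noteq> b"] that in blast)
  ultimately show ?thesis by (simp add: assemble_def)
qed

text \<open>An open set without \<open>b\<close> has as preimage the union of the preimages under
  the single maps. If it contains \<open>b\<close>, the preimage is locally a finite intersection,
  because near each point only finitely many maps take values other than \<open>b\<close>.\<close>

lemma continuous_map_assemble:
  assumes cont: "\<And>a. a \<in> A \<Longrightarrow> continuous_map W X (F a)" and b: "b \<in> topspace X"
    and disj: "\<And>w a c. w \<in> topspace W \<Longrightarrow> a \<in> A \<Longrightarrow> c \<in> A \<Longrightarrow> F a w \<noteq> b \<Longrightarrow> F c w \<noteq> b \<Longrightarrow> a = c"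
    and locally_finite: "\<And>w. w \<in> topspace W \<Longrightarrow> \<exists>T. openin W T \<and> w \<in> T \<and> finite {a \<in> A. \<exists>v\<in>T. F a v \<noteq> b}"
  shows "continuous_map W X (assemble A b F)"
  unfolding continuous_map_def
proof (intro conjI allI impI funcsetI)
  have val: "F a w \<in> topspace X" if "a \<in> A" "w \<in> topspace W" for a w
    using cont[OF that(1)] that(2) by (auto simp: continuous_map_def)
  show "assemble A b F w \<in> topspace X" if "w \<in> topspace W" for w
    using assemble_cases[of A b F w] that val b by auto
  fix U assume U: "openin X U"
  show "openin W {w \<in> topspace W. assemble A b F w \<in> U}"
  proof (cases "b \<in> U")
    case False
    have "{w \<in> topspace W. assemble A b F w \<in> U} = (\<Union>a\<in>A. {w \<in> topspace W. F a w \<in> U})"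
    proof (intro set_eqI iffI)
      fix w assume "w \<in> {w \<in> topspace W. assemble A b F w \<in> U}"
      then show "w \<in> (\<Union>a\<in>A. {w \<in> topspace W. F a w \<in> U})"
        using assemble_cases[of A b F w] False by fastforce
    next
      fix w assume "w \<in> (\<Union>a\<in>A. {w \<in> topspace W. F a w \<in> U})"
      then obtain a where a: "a \<in> A" "w \<in> topspace W" "F a w \<in> U" by auto
      then have "assemble A b F w = F a w"
        using False disj by (intro assemble_eq) auto
      with a show "w \<in> {w \<in> topspace W. assemble A b F w \<in> U}" by simp
    qed
    moreover have "openin W {w \<in> topspace W. F a w \<in> U}" if "a \<in> A" for a
      using openin_continuous_map_preimage[OF cont[OF that] U] .
    ultimately show ?thesis by (auto intro!: openin_Union)
  next
    case True
    have "\<exists>T. openin W T \<and> w \<in> T \<and> T \<subseteq> {w \<in> topspace W. assemble A b F w \<in> U}"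
      if w: "w \<in> topspace W" "assemble A b F w \<in> U" for w
    proof -
      obtain T where T: "openin W T" "w \<in> T" "finite {a \<in> A. \<exists>v\<in>T. F a v \<noteq> b}" (is "finite ?B")
        using locally_finite[OF w(1)] by auto
      have TW: "T \<subseteq> topspace W" using T(1) by (rule openin_subset)
      define R where "R = T \<inter> (\<Inter>a\<in>?B. {v \<in> topspace W. F a v \<in> U})"
      have "openin W R"
      proof (cases "?B = {}")
        case True
        show ?thesis unfolding R_def True using T(1) by simp
      next
        case False
        show ?thesis unfolding R_def
          by (intro openin_Int T(1) openin_INT2 T(3) False openin_continuous_map_preimage[OF cont U]) auto
      qed
      moreover have "w \<in> R"
      proof -
        have "F a w \<in> U" if "a \<in> A" for a
        proof (cases "F a w = b")
          case False
          have "assemble A b F w = F a w"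
            using that disj w(1) False by (intro assemble_eq) auto
          then show ?thesis using w(2) by simp
        qed (use True in simp)
        then show ?thesis unfolding R_def using w(1) T(2)
          by (intro IntI INT_I CollectI conjI) (simp_all del: bex_simps)
      qed
      moreover have "assemble A b F v \<in> U" if v: "v \<in> R" for v
      proof (cases "\<exists>a\<in>A. F a v \<noteq> b")
        case True
        then obtain a where a: "a \<in> A" "F a v \<noteq> b" "assemble A b F v = F a v"
          using assemble_cases[of A b F v] by blast
        have "v \<in> T" using v unfolding R_def by blast
        with a(1,2) have "a \<in> ?B" by blast
        then show "assemble A b F v \<in> U" using v unfolding R_def a(3) by blast
      qed (use \<open>b \<in> U\<close> in \<open>simp add: assemble_def\<close>)
      moreover have "R \<subseteq> topspace W" using TW Int_lower1 unfolding R_def by (rule order_trans[rotated])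
      ultimately show ?thesis by (intro exI[of _ R]) blast
    qed
    then show ?thesis by (intro iffD2[OF openin_subopen] ballI) simp
  qed
qed

text \<open>Maps on a cube whose directions are indexed by \<open>S\<close> are treated as maps on
  the whole sequence space. \<open>S\<close> is an arbitrary set and not an initial segment because
  slicing a grid removes single coordinates.\<close>

definition dep_on :: "nat set \<Rightarrow> ((nat \<Rightarrow> real) \<Rightarrow> 'a) \<Rightarrow> bool" where
  "dep_on S f \<longleftrightarrow> (\<forall>x y. (\<forall>i\<in>S. x i = y i) \<longrightarrow> f x = f y)"

lemma dep_onD: "dep_on S f \<Longrightarrow> (\<And>i. i \<in> S \<Longrightarrow> x i = y i) \<Longrightarrow> f x = f y"
  by (auto simp: dep_on_def)

text \<open>A spheroid on the cube modulo its boundary, extended by \<open>z\<close> to the whole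
  space so that no subspace topology appears. For n = 0 the boundary condition is vacuous and a cube
  map is just a point.\<close>

definition cube_map :: "nat \<Rightarrow> 'a topology \<Rightarrow> 'a \<Rightarrow> ((nat \<Rightarrow> real) \<Rightarrow> 'a) \<Rightarrow> bool" where
  "cube_map n Z z f \<longleftrightarrow> continuous_map euclidean Z f \<and> dep_on {..<n} f \<and>
     (\<forall>x. (\<exists>i<n. x i \<notin> {0<..<1}) \<longrightarrow> f x = z)"

text \<open>Time ranges over all reals: a homotopy over [0,1] is brought into this form by clamping
  the time, and afterwards reversal and reparametrisation need no side conditions.\<close>

definition cube_homotopy :: "nat \<Rightarrow> 'a topology \<Rightarrow> 'a \<Rightarrow> ((nat \<Rightarrow> real) \<times> real \<Rightarrow> 'a) \<Rightarrow> bool" where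
  "cube_homotopy n Z z \<Phi> \<longleftrightarrow> continuous_map euclidean Z \<Phi> \<and> (\<forall>t. cube_map n Z z (\<lambda>x. \<Phi> (x, t)))"

definition cube_homotopic :: "nat \<Rightarrow> 'a topology \<Rightarrow> 'a \<Rightarrow> ((nat \<Rightarrow> real) \<Rightarrow> 'a) \<Rightarrow> ((nat \<Rightarrow> real) \<Rightarrow> 'a) \<Rightarrow> bool" where
  "cube_homotopic n Z z f g \<longleftrightarrow>
     (\<exists>\<Phi>. cube_homotopy n Z z \<Phi> \<and> (\<forall>x. \<Phi> (x, 0) = f x) \<and> (\<forall>x. \<Phi> (x, 1) = g x))"

lemma continuous_map_euclidean_compose:
  assumes "continuous_map euclidean X f" "continuous_on UNIV g"
  shows "continuous_map euclidean X (\<lambda>x. f (g x))"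
  using continuous_map_compose[of euclidean euclidean g X f] assms by (simp add: o_def)

lemma continuous_on_fst_coordinate [continuous_intros]:
  "continuous_on S (\<lambda>p :: ('i \<Rightarrow> 'b::topological_space) \<times> 'c::topological_space. fst p i)"
  by (rule continuous_on_product_then_coordinatewise) (intro continuous_intros)

lemma continuous_on_UNIV_coordinate [continuous_intros]:
  "continuous_on S (\<lambda>x :: 'i \<Rightarrow> 'b::topological_space. x i)"
  by (rule continuous_on_product_then_coordinatewise) (intro continuous_intros)

lemma continuous_on_fst_UNIV: "continuous_on S fst"
  using continuous_on_fst[OF continuous_on_id] by simp

lemma continuous_on_fun_upd:
  assumes "continuous_on S F" "continuous_on S c"
  shows "continuous_on S (\<lambda>w. (F w)(i := c w))"
proof (rule continuous_on_coordinatewise_then_product)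
  show "continuous_on S (\<lambda>w. ((F w)(i := c w)) k)" for k
    using assms continuous_on_product_then_coordinatewise[OF assms(1), of k] by (cases "k = i") auto
qed

section \<open>The collapse of the cube boundary in coordinates\<close>

fun max_norm :: "nat \<Rightarrow> (nat \<Rightarrow> real) \<Rightarrow> real" where
  "max_norm 0 x = 0"
| "max_norm (Suc m) x = max (max_norm m x) \<bar>x m\<bar>"

lemma max_norm_nonneg: "0 \<le> max_norm m x"
  by (induction m) auto

lemma max_norm_scale: "0 \<le> c \<Longrightarrow> max_norm m (\<lambda>i. c * x i) = c * max_norm m x"
  by (induction m) (auto simp: abs_mult max_mult_distrib_left)

lemma max_norm_less_iff: "0 < r \<Longrightarrow> max_norm m x < r \<longleftrightarrow> (\<forall>i<m. \<bar>x i\<bar> < r)"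
  by (induction m) (auto simp: less_Suc_eq)

lemma max_norm_cong: "(\<And>i. i < m \<Longrightarrow> x i = y i) \<Longrightarrow> max_norm m x = max_norm m y"
  by (induction m) auto

lemma continuous_on_max_norm [continuous_intros]:
  "(\<And>i. continuous_on S (\<lambda>w. f w i)) \<Longrightarrow> continuous_on S (\<lambda>w. max_norm m (f w))"
  by (induction m) (auto intro!: continuous_intros)

definition cube_weight :: "nat \<Rightarrow> (nat \<Rightarrow> real) \<Rightarrow> real" where
  "cube_weight m x = max 0 (1/2 - max_norm m (\<lambda>i. x i - 1/2))"

definition cube_radius2 :: "nat \<Rightarrow> (nat \<Rightarrow> real) \<Rightarrow> real" where
  "cube_radius2 m x = (\<Sum>i<m. (x i - 1/2)\<^sup>2)"

text \<open>Radial blow-up of the open cube to the whole space, \<open>c \<mapsto> c / w\<close> with \<open>c\<close> the offset from the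
  centre and \<open>w\<close> the distance to the boundary, followed by inverse stereographic projection; after
  clearing denominators the formula extends continuously to the complement of the open cube, which
  goes to the pole.\<close>
definition cube_to_sphere :: "nat \<Rightarrow> (nat \<Rightarrow> real) \<Rightarrow> nat \<Rightarrow> real" where
  "cube_to_sphere m x = (\<lambda>k.
     if k = 0 then (cube_radius2 m x - (cube_weight m x)\<^sup>2) / (cube_radius2 m x + (cube_weight m x)\<^sup>2)
     else if k \<le> m then 2 * cube_weight m x * (x (k - 1) - 1/2) / (cube_radius2 m x + (cube_weight m x)\<^sup>2)
     else 0)"

text \<open>With c the offset from the centre, w = 1/2 - |c| and |.| the sup norm, the equation y =
  c / w has the solution c = y / (2 (1 + |y|)). Stereographic projection gives y = u' / (1 - u_0),
  where u' collects the coordinates from 1 on; clearing denominators yields the formula.\<close>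

definition sphere_to_cube :: "nat \<Rightarrow> (nat \<Rightarrow> real) \<Rightarrow> nat \<Rightarrow> real" where
  "sphere_to_cube m u = (\<lambda>i. if i < m
     then 1/2 + u (Suc i) / (2 * (1 - u 0 + max_norm m (\<lambda>i. u (Suc i)))) else 0)"

lemma cube_denominator_pos: "0 < cube_radius2 m x + (cube_weight m x)\<^sup>2"
proof (cases "\<exists>i<m. x i \<noteq> 1/2")
  case True
  then obtain i where i: "i < m" "x i \<noteq> 1/2" by auto
  have "0 < (x i - 1/2)\<^sup>2" using i by simp
  also have "\<dots> \<le> cube_radius2 m x"
    unfolding cube_radius2_def using i by (intro member_le_sum) auto
  finally show ?thesis by (simp add: add_pos_nonneg)
next
  case False
  then have "max_norm m (\<lambda>i. x i - 1/2) = max_norm m (\<lambda>i. 0 * x i)"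
    by (intro max_norm_cong) auto
  also have "\<dots> = 0" by (subst max_norm_scale) auto
  finally have "cube_weight m x = 1/2" by (simp add: cube_weight_def)
  moreover have "0 \<le> cube_radius2 m x" by (simp add: cube_radius2_def sum_nonneg)
  ultimately show ?thesis by (simp add: add_nonneg_pos)
qed

lemma cube_weight_pos_iff: "0 < cube_weight m x \<longleftrightarrow> (\<forall>i<m. x i \<in> {0<..<1})"
proof -
  have half: "\<bar>y - 1/2\<bar> < 1/2 \<longleftrightarrow> y \<in> {0<..<1}" for y :: real
    unfolding greaterThanLessThan_iff by linarith
  have "0 < cube_weight m x \<longleftrightarrow> max_norm m (\<lambda>i. x i - 1/2) < 1/2"
    by (auto simp: cube_weight_def)
  also have "\<dots> \<longleftrightarrow> (\<forall>i<m. x i \<in> {0<..<1})"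
    by (subst max_norm_less_iff) (simp, simp only: half)
  finally show ?thesis .
qed

lemma cube_weight_nonneg: "0 \<le> cube_weight m x"
  by (simp add: cube_weight_def)

lemma cube_to_sphere_outside:
  assumes "i < m" "x i \<notin> {0<..<1}"
  shows "cube_to_sphere m x = sphere_base"
proof -
  have "cube_weight m x = 0"
    using cube_weight_pos_iff[of m x] cube_weight_nonneg[of m x] assms by (auto simp: less_le)
  then show ?thesis
    using cube_denominator_pos[of m x] by (auto simp: cube_to_sphere_def sphere_base_def fun_eq_iff)
qed

lemma dep_on_cube_to_sphere: "dep_on {..<m} (cube_to_sphere m)"
proof -
  have "cube_to_sphere m x = cube_to_sphere m y" if "\<forall>i\<in>{..<m}. x i = y i" for x y
  proof -
    have "cube_weight m x = cube_weight m y" "cube_radius2 m x = cube_radius2 m y"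
      unfolding cube_weight_def cube_radius2_def using that
      by (auto intro!: sum.cong arg_cong[where f = "max 0"] max_norm_cong)
    then show ?thesis unfolding cube_to_sphere_def using that by (auto simp: fun_eq_iff)
  qed
  then show ?thesis by (auto simp: dep_on_def)
qed

lemma topspace_nsphere: "topspace (nsphere m) = {x. (\<Sum>i\<le>m. (x i)\<^sup>2) = 1 \<and> (\<forall>i>m. x i = 0)}"
  by (auto simp: nsphere)

lemma nsphere_eq_top_of_set: "nsphere m = top_of_set (topspace (nsphere m))"
  by (simp add: nsphere euclidean_product_topology)

lemma sphere_base_in_nsphere: "sphere_base \<in> topspace (nsphere m)"
  using in_topspace_nsphere by (simp add: sphere_base_def)

lemma nsphere_square_sum:
  assumes "u \<in> topspace (nsphere m)"
  shows "(\<Sum>i<m. (u (Suc i))\<^sup>2) = 1 - (u 0)\<^sup>2"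
proof -
  have "1 = (\<Sum>i\<le>m. (u i)\<^sup>2)" using assms by (simp add: topspace_nsphere)
  also have "\<dots> = (u 0)\<^sup>2 + (\<Sum>i<m. (u (Suc i))\<^sup>2)"
    by (simp add: sum.atMost_shift)
  finally show ?thesis by simp
qed

lemma nsphere_less_one:
  assumes "u \<in> topspace (nsphere m)" "u \<noteq> sphere_base"
  shows "u 0 < 1"
proof (rule ccontr)
  assume "\<not> u 0 < 1"
  then have u0: "1 \<le> u 0" by simp
  then have "1 \<le> (u 0)\<^sup>2" by simp
  moreover have nn: "0 \<le> (\<Sum>i<m. (u (Suc i))\<^sup>2)" by (simp add: sum_nonneg)
  ultimately have 0: "(\<Sum>i<m. (u (Suc i))\<^sup>2) = 0" "(u 0)\<^sup>2 = 1"
    using nsphere_square_sum[OF assms(1)] by linarith+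
  have "u 0 = 1" using 0(2) u0 by (simp add: power2_eq_1_iff)
  moreover have "u (Suc i) = 0" if "i < m" for i
    using 0(1) that by (simp add: sum_nonneg_eq_0_iff)
  moreover have "u i = 0" if "i > m" for i using assms(1) that by (simp add: topspace_nsphere)
  ultimately have "u = sphere_base"
    unfolding sphere_base_def fun_eq_iff by (metis Suc_pred not_less_eq not_gr_zero)
  with assms show False by simp
qed

lemma cube_to_sphere_in_nsphere: "cube_to_sphere m x \<in> topspace (nsphere m)"
proof -
  define q w where "q = cube_radius2 m x" and "w = cube_weight m x"
  have pos: "q + w\<^sup>2 > 0" using cube_denominator_pos by (simp add: q_def w_def)
  have "(\<Sum>i\<le>m. (cube_to_sphere m x i)\<^sup>2) = ((q - w\<^sup>2) / (q + w\<^sup>2))\<^sup>2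
      + (\<Sum>i<m. (2 * w * (x i - 1/2) / (q + w\<^sup>2))\<^sup>2)"
    by (simp add: sum.atMost_shift cube_to_sphere_def flip: q_def w_def)
  also have "(\<Sum>i<m. (2 * w * (x i - 1/2) / (q + w\<^sup>2))\<^sup>2) = (2 * w / (q + w\<^sup>2))\<^sup>2 * q"
    unfolding q_def cube_radius2_def
    by (subst sum_distrib_left) (auto intro!: sum.cong simp: power_mult_distrib power_divide)
  also have "((q - w\<^sup>2) / (q + w\<^sup>2))\<^sup>2 + (2 * w / (q + w\<^sup>2))\<^sup>2 * q = ((q - w\<^sup>2)\<^sup>2 + 4 * w\<^sup>2 * q) / (q + w\<^sup>2)\<^sup>2"
    by (simp add: power_divide power_mult_distrib add_divide_distrib)
  also have "(q - w\<^sup>2)\<^sup>2 + 4 * w\<^sup>2 * q = (q + w\<^sup>2)\<^sup>2" by (simp add: power2_eq_square algebra_simps)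
  finally show ?thesis using pos by (simp add: topspace_nsphere) (simp add: cube_to_sphere_def)
qed

lemma continuous_on_cube_to_sphere: "continuous_on UNIV (cube_to_sphere m)"
proof (rule continuous_on_coordinatewise_then_product)
  have w: "continuous_on UNIV (\<lambda>x. cube_weight m x)"
    unfolding cube_weight_def by (intro continuous_intros)
  have q: "continuous_on UNIV (\<lambda>x. cube_radius2 m x)"
    unfolding cube_radius2_def by (intro continuous_intros)
  have nz: "cube_radius2 m x + (cube_weight m x)\<^sup>2 \<noteq> 0" for x
    using cube_denominator_pos[of m x] by simp
  show "continuous_on UNIV (\<lambda>x. cube_to_sphere m x k)" for k
  proof -
    have "continuous_on UNIV (\<lambda>x. (cube_radius2 m x - (cube_weight m x)\<^sup>2) / (cube_radius2 m x + (cube_weight m x)\<^sup>2))"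
      "continuous_on UNIV (\<lambda>x. 2 * cube_weight m x * (x (k - 1) - 1/2) / (cube_radius2 m x + (cube_weight m x)\<^sup>2))"
      by (intro continuous_intros w q ballI nz)+
    then show ?thesis by (cases "k = 0"; cases "k \<le> m") (simp_all add: cube_to_sphere_def)
  qed
qed

lemma continuous_map_cube_to_sphere: "continuous_map euclidean (nsphere m) (cube_to_sphere m)"
  by (subst nsphere_eq_top_of_set)
     (auto simp: continuous_map_in_subtopology continuous_on_cube_to_sphere cube_to_sphere_in_nsphere)

lemma sphere_to_cube_inverse:
  assumes "\<And>i. i < m \<Longrightarrow> x i \<in> {0<..<1}" "i < m"
  shows "sphere_to_cube m (cube_to_sphere m x) i = x i"
proof -
  define q w where "q = cube_radius2 m x" and "w = cube_weight m x"
  have pos: "q + w\<^sup>2 > 0" using cube_denominator_pos by (simp add: q_def w_def)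
  have w: "w > 0" using cube_weight_pos_iff assms by (simp add: w_def)
  define r where "r = max_norm m (\<lambda>i. x i - 1/2)"
  \<comment> \<open>Inside the open cube the clipping in \<open>cube_weight\<close> is inactive, so
    the weight and the sup norm of the offset add up to half the edge.\<close>
  have wr: "w + r = 1/2" using w by (auto simp: w_def cube_weight_def r_def max_def split: if_splits)
  have "max_norm m (\<lambda>i. cube_to_sphere m x (Suc i)) = max_norm m (\<lambda>i. (2 * w / (q + w\<^sup>2)) * (x i - 1/2))"
    by (intro max_norm_cong) (auto simp: cube_to_sphere_def q_def w_def)
  also have "\<dots> = 2 * w / (q + w\<^sup>2) * r" unfolding r_def
    using w pos by (intro max_norm_scale) auto
  finally have "1 - cube_to_sphere m x 0 + max_norm m (\<lambda>i. cube_to_sphere m x (Suc i))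
      = 1 - (q - w\<^sup>2) / (q + w\<^sup>2) + 2 * w / (q + w\<^sup>2) * r"
    by (simp add: cube_to_sphere_def q_def w_def)
  also have "\<dots> = 2 * w * (w + r) / (q + w\<^sup>2)"
  proof -
    have "1 - (q - w\<^sup>2) / (q + w\<^sup>2) = 2 * w * w / (q + w\<^sup>2)"
      using pos by (simp add: field_simps power2_eq_square)
    then show ?thesis by (simp add: add_divide_distrib [symmetric] distrib_left)
  qed
  finally have "1 - cube_to_sphere m x 0 + max_norm m (\<lambda>i. cube_to_sphere m x (Suc i)) = w / (q + w\<^sup>2)"
    by (simp add: wr)
  then show ?thesis
    using assms(2) pos w by (simp add: sphere_to_cube_def) (simp add: cube_to_sphere_def flip: q_def w_def)
qed

lemma sphere_to_cube_in_cube: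
  assumes "u \<in> topspace (nsphere m)" "u \<noteq> sphere_base" "i < m"
  shows "sphere_to_cube m u i \<in> {0<..<1}"
proof -
  define r where "r = max_norm m (\<lambda>i. u (Suc i))"
  have u0: "1 - u 0 > 0" using nsphere_less_one[OF assms(1,2)] by simp
  have r0: "0 \<le> r" by (simp add: r_def max_norm_nonneg)
  have "r < 1 - u 0 + r" using u0 by simp
  then have "\<bar>u (Suc i)\<bar> < 1 - u 0 + r"
    using max_norm_less_iff[of "1 - u 0 + r" m "\<lambda>i. u (Suc i)"] u0 r0 assms(3) unfolding r_def by simp
  define v where "v = u (Suc i) / (2 * (1 - u 0 + r))"
  have "\<bar>v\<bar> = \<bar>u (Suc i)\<bar> / (2 * (1 - u 0 + r))" using u0 r0 by (simp add: v_def abs_divide)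
  also have "\<dots> < 1/2" using u0 r0 \<open>\<bar>u (Suc i)\<bar> < _\<close> by (simp add: field_simps)
  finally have "1/2 + v \<in> {0<..<1}" unfolding greaterThanLessThan_iff by linarith
  then show ?thesis using assms(3) by (simp add: sphere_to_cube_def v_def r_def)
qed

lemma cube_to_sphere_inverse:
  assumes "u \<in> topspace (nsphere m)" "u \<noteq> sphere_base"
  shows "cube_to_sphere m (sphere_to_cube m u) = u"
proof -
  define D where "D = 1 - u 0 + max_norm m (\<lambda>i. u (Suc i))"
  have u0: "1 - u 0 > 0" using nsphere_less_one[OF assms] by simp
  have D: "D > 0" using u0 by (simp add: D_def add_pos_nonneg max_norm_nonneg)
  have c: "sphere_to_cube m u i - 1/2 = (1 / (2 * D)) * u (Suc i)" if "i < m" for i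
    using that by (simp add: sphere_to_cube_def D_def)
  have "max_norm m (\<lambda>i. sphere_to_cube m u i - 1/2) = max_norm m (\<lambda>i. (1 / (2 * D)) * u (Suc i))"
    using c by (intro max_norm_cong) auto
  also have "\<dots> = (1 / (2 * D)) * max_norm m (\<lambda>i. u (Suc i))" using D by (intro max_norm_scale) auto
  finally have "1/2 - max_norm m (\<lambda>i. sphere_to_cube m u i - 1/2) = 1/2 - (D - (1 - u 0)) / (2 * D)"
    by (simp add: D_def)
  also have "\<dots> = (1 - u 0) / (2 * D)" using D by (simp add: field_simps)
  finally have w: "cube_weight m (sphere_to_cube m u) = (1 - u 0) / (2 * D)"
    using u0 D by (simp add: cube_weight_def)
  have "cube_radius2 m (sphere_to_cube m u) = (\<Sum>i<m. (1 / (2 * D))\<^sup>2 * (u (Suc i))\<^sup>2)"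
    unfolding cube_radius2_def using c by (auto intro!: sum.cong simp: power_divide)
  also have "\<dots> = (1 / (2 * D))\<^sup>2 * (1 - (u 0)\<^sup>2)"
    using nsphere_square_sum[OF assms(1)] by (simp flip: sum_distrib_left)
  finally have q: "cube_radius2 m (sphere_to_cube m u) = (1 - (u 0)\<^sup>2) / (4 * D\<^sup>2)"
    by (simp add: power_divide power_mult_distrib)
  have sum: "(1 - (u 0)\<^sup>2) / (4 * D\<^sup>2) + ((1 - u 0) / (2 * D))\<^sup>2 = 2 * (1 - u 0) / (4 * D\<^sup>2)"
    using D by (simp add: power2_eq_square field_simps)
  have diff: "(1 - (u 0)\<^sup>2) / (4 * D\<^sup>2) - ((1 - u 0) / (2 * D))\<^sup>2 = 2 * (1 - u 0) * u 0 / (4 * D\<^sup>2)"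
    using D by (simp add: power2_eq_square field_simps)
  show ?thesis
  proof
    fix k
    consider "k = 0" | i where "k = Suc i" "i < m" | "k > m"
      by (metis Suc_le_eq not0_implies_Suc not_less)
    then show "cube_to_sphere m (sphere_to_cube m u) k = u k"
    proof cases
      case 1
      then show ?thesis using u0 D by (simp add: cube_to_sphere_def w q sum diff)
    next
      case 2
      have "cube_to_sphere m (sphere_to_cube m u) k
          = 2 * ((1 - u 0) / (2 * D)) * (sphere_to_cube m u i - 1/2) / (2 * (1 - u 0) / (4 * D\<^sup>2))"
        using 2 by (simp add: cube_to_sphere_def w q sum)
      also have "\<dots> = u (Suc i)" unfolding c[OF 2(2)] using u0 D by (simp add: field_simps power2_eq_square)
      finally show ?thesis using 2 by simp
    next
      case 3
      then show ?thesis using assms(1) by (simp add: cube_to_sphere_def topspace_nsphere)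
    qed
  qed
qed

section \<open>Spheroids and cube maps\<close>

lemma compact_box: "compact {x :: nat \<Rightarrow> real. (\<forall>i<n. x i \<in> {a..c}) \<and> (\<forall>i\<ge>n. x i = 0)}"
proof -
  have "{x :: nat \<Rightarrow> real. (\<forall>i<n. x i \<in> {a..c}) \<and> (\<forall>i\<ge>n. x i = 0)} = PiE UNIV (\<lambda>i. if i < n then {a..c} else {0})"
    by (rule set_eqI) (simp add: PiE_iff if_split [of "\<lambda>A. _ \<in> A"] all_conj_distrib not_less)
  moreover have "compactin (product_topology (\<lambda>i. euclidean) UNIV) (PiE UNIV (\<lambda>i::nat. if i < n then {a..c} else {0}))"
    unfolding compactin_PiE by (intro disjI2 ballI) simp
  ultimately show ?thesis by (simp add: euclidean_product_topology)
qed

text \<open>The coordinates from \<open>n\<close> on are frozen at 0, since a cylinder over the cube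
  would not be compact in the sequence space.\<close>

definition closed_cube :: "nat \<Rightarrow> (nat \<Rightarrow> real) set" where
  "closed_cube n = {x. (\<forall>i<n. x i \<in> {0..1}) \<and> (\<forall>i\<ge>n. x i = 0)}"

lemma compact_closed_cube: "compact (closed_cube n)"
  unfolding closed_cube_def by (rule compact_box)

definition sphere_homotopy :: "nat \<Rightarrow> 'a \<Rightarrow> ((nat \<Rightarrow> real) \<times> real \<Rightarrow> 'a) \<Rightarrow> real \<times> (nat \<Rightarrow> real) \<Rightarrow> 'a" where
  "sphere_homotopy n z \<Phi> = (\<lambda>(t, u). if u = sphere_base then z else \<Phi> (sphere_to_cube n u, t))"

lemma sphere_homotopy_cube_to_sphere:
  assumes "cube_map n Z z (\<lambda>x. \<Phi> (x, t))"
  shows "sphere_homotopy n z \<Phi> (t, cube_to_sphere n x) = \<Phi> (x, t)"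
proof (cases "\<forall>i<n. x i \<in> {0<..<1}")
  case True
  then have "cube_to_sphere n x 0 < 1"
    using cube_weight_pos_iff[of n x] cube_denominator_pos[of n x]
    by (auto simp: cube_to_sphere_def divide_less_eq)
  then have "cube_to_sphere n x \<noteq> sphere_base" by (auto simp: sphere_base_def)
  moreover have "\<Phi> (sphere_to_cube n (cube_to_sphere n x), t) = \<Phi> (x, t)"
    using assms True by (auto simp: cube_map_def sphere_to_cube_inverse elim!: dep_onD)
  ultimately show ?thesis by (simp add: sphere_homotopy_def)
next
  case False
  then obtain i where i: "i < n" "x i \<notin> {0<..<1}" by auto
  have "\<Phi> (x, t) = z" using assms i unfolding cube_map_def by blast
  then show ?thesis using cube_to_sphere_outside[of i n x] i by (auto simp: sphere_homotopy_def)
qed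

text \<open>A continuous map from a compact space to a Hausdorff space is closed, hence a quotient
  map onto its image. Concretely, the preimage of a closed set is the image of a compact set
  \<open>K\<close> under the collapse, together with the base line when \<open>z\<close> belongs to
  the closed set.\<close>

lemma continuous_map_sphere_homotopy:
  assumes \<Phi>: "cube_homotopy n Z z \<Phi>" and z: "z \<in> topspace Z"
  shows "continuous_map (prod_topology (top_of_set {0..1}) (nsphere n)) Z (sphere_homotopy n z \<Phi>)"
proof -
  have cont: "continuous_map euclidean Z \<Phi>" and cm: "\<And>t. cube_map n Z z (\<lambda>x. \<Phi> (x, t))"
    using \<Phi> by (auto simp: cube_homotopy_def)
  define P where "P = {0..1::real} \<times> topspace (nsphere n)"
  have P: "prod_topology (top_of_set {0..1}) (nsphere n) = top_of_set P"
    by (subst nsphere_eq_top_of_set) (simp add: P_def prod_topology_subtopology_eu)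
  show ?thesis unfolding P continuous_map_closedin
  proof (intro conjI allI impI funcsetI)
    show "sphere_homotopy n z \<Phi> p \<in> topspace Z" for p
      using cont z by (auto simp: sphere_homotopy_def continuous_map_def split: prod.split)
    fix T assume T: "closedin Z T"
    define K where "K = {p \<in> closed_cube n \<times> {0..1}. \<Phi> p \<in> T}"
    have "closedin euclidean {p \<in> topspace euclidean. \<Phi> p \<in> T}"
      using cont T by (rule closedin_continuous_map_preimage)
    then have "closed {p. \<Phi> p \<in> T}" by simp
    then have "compact ((closed_cube n \<times> {0..1}) \<inter> {p. \<Phi> p \<in> T})"
      by (intro compact_Int_closed compact_Times compact_closed_cube) auto
    moreover have "(closed_cube n \<times> {0..1}) \<inter> {p. \<Phi> p \<in> T} = K" by (auto simp: K_def)
    ultimately have "compact K" by simp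
    define s where "s = (\<lambda>(x, t::real). (t, cube_to_sphere n x))"
    have "continuous_on UNIV s" unfolding s_def case_prod_unfold
      by (intro continuous_intros continuous_on_compose2[OF continuous_on_cube_to_sphere]) auto
    then have "compact (s ` K)"
      using \<open>compact K\<close> continuous_on_subset by (blast intro: compact_continuous_image)
    then have clK: "closed (s ` K)" by (rule compact_imp_closed)
    \<comment> \<open>The base line is added by hand: for n = 0 the cube is a point that goes to the
      other point of the sphere, and the base point is not hit at all.\<close>
    define B where "B = (if z \<in> T then {0..1::real} \<times> {sphere_base} else {})"
    have clB: "closed B" by (auto simp: B_def closed_Times)
    have "{p \<in> P. sphere_homotopy n z \<Phi> p \<in> T} = s ` K \<union> B"
    proof (intro set_eqI iffI)
      fix p assume p: "p \<in> {p \<in> P. sphere_homotopy n z \<Phi> p \<in> T}"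
      obtain t u where tu: "p = (t, u)" by (cases p)
      show "p \<in> s ` K \<union> B"
      proof (cases "u = sphere_base")
        case True
        then show ?thesis using p by (auto simp: tu B_def P_def sphere_homotopy_def)
      next
        case False
        have u: "u \<in> topspace (nsphere n)" using p tu by (simp add: P_def)
        have "sphere_to_cube n u \<in> closed_cube n"
          using sphere_to_cube_in_cube[OF u False]
          by (auto simp: closed_cube_def less_imp_le) (auto simp: sphere_to_cube_def)
        then have "(sphere_to_cube n u, t) \<in> K"
          using p False by (auto simp: K_def tu sphere_homotopy_def P_def)
        moreover have "p = s (sphere_to_cube n u, t)"
          using cube_to_sphere_inverse[OF u False] by (simp add: s_def tu)
        ultimately show ?thesis by auto
      qed
    next
      fix p assume "p \<in> s ` K \<union> B"
      then show "p \<in> {p \<in> P. sphere_homotopy n z \<Phi> p \<in> T}"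
      proof
        assume "p \<in> s ` K"
        then obtain x t where xt: "(x, t) \<in> K" "p = s (x, t)" by auto
        then show ?thesis
          using sphere_homotopy_cube_to_sphere[OF cm]
          by (auto simp: P_def s_def K_def cube_to_sphere_in_nsphere)
      next
        assume "p \<in> B"
        then show ?thesis
          by (auto simp: B_def P_def sphere_homotopy_def sphere_base_in_nsphere split: if_splits)
      qed
    qed
    moreover have "closedin (top_of_set P) (s ` K \<union> B)"
    proof -
      have "s ` K \<union> B \<subseteq> P" using calculation by auto
      then show ?thesis using clK clB by (auto intro!: closed_subset)
    qed
    ultimately show "closedin (top_of_set P) {p \<in> topspace (top_of_set P). sphere_homotopy n z \<Phi> p \<in> T}"
      by simp
  qed
qed

lemma cube_map_based_map:
  assumes "f \<in> based_maps n Z z"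
  shows "cube_map n Z z (\<lambda>x. f (cube_to_sphere n x))"
  unfolding cube_map_def
proof (intro conjI allI impI)
  show "continuous_map euclidean Z (\<lambda>x. f (cube_to_sphere n x))"
    using assms continuous_map_compose[OF continuous_map_cube_to_sphere, of n Z f]
    by (simp add: based_maps_def o_def)
  show "dep_on {..<n} (\<lambda>x. f (cube_to_sphere n x))"
    unfolding dep_on_def using dep_onD[OF dep_on_cube_to_sphere[of n]] by (metis (no_types))
  show "f (cube_to_sphere n x) = z" if "\<exists>i<n. x i \<notin> {0<..<1}" for x
    using that cube_to_sphere_outside[of _ n x] assms by (auto simp: based_maps_def simp del: greaterThanLessThan_iff)
qed

lemma cube_map_imp_based_map:
  assumes g: "cube_map n Z z g" and z: "z \<in> topspace Z"
  obtains f where "f \<in> based_maps n Z z" "\<And>x. f (cube_to_sphere n x) = g x"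
proof -
  \<comment> \<open>The map is viewed as a constant homotopy, so that its descent to the sphere is a
    case of the statement for homotopies.\<close>
  define \<Phi> where "\<Phi> = (\<lambda>p :: (nat \<Rightarrow> real) \<times> real. g (fst p))"
  have "continuous_map euclidean Z \<Phi>" unfolding \<Phi>_def
    using g continuous_map_euclidean_compose[of Z g fst] continuous_on_fst_UNIV by (auto simp: cube_map_def)
  then have \<Phi>: "cube_homotopy n Z z \<Phi>" using g by (simp add: cube_homotopy_def \<Phi>_def)
  have "continuous_map (nsphere n) (prod_topology (top_of_set {0..1}) (nsphere n)) (\<lambda>u. (0::real, u))"
    by (simp add: continuous_map_pairwise o_def)
  from continuous_map_compose[OF this continuous_map_sphere_homotopy[OF \<Phi> z]]
  have "(\<lambda>u. sphere_homotopy n z \<Phi> (0, u)) \<in> based_maps n Z z"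
    by (simp add: based_maps_def o_def) (simp add: sphere_homotopy_def)
  moreover have "sphere_homotopy n z \<Phi> (0, cube_to_sphere n x) = g x" for x
    using sphere_homotopy_cube_to_sphere[of n Z z \<Phi> 0 x] g by (simp add: \<Phi>_def)
  ultimately show ?thesis by (rule that)
qed

lemma homotopic_with_base_iff:
  "homotopic_with (\<lambda>h. h sphere_base = z) (nsphere n) Z f g \<longleftrightarrow>
    (\<exists>h. continuous_map (prod_topology (top_of_set {0..1::real}) (nsphere n)) Z h \<and>
       (\<forall>x\<in>topspace (nsphere n). h (0, x) = f x) \<and> (\<forall>x\<in>topspace (nsphere n). h (1, x) = g x) \<and>
       (\<forall>t\<in>{0..1}. h (t, sphere_base) = z))"
  using sphere_base_in_nsphere by (intro homotopic_with) auto

lemma homotopic_imp_cube_homotopic: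
  assumes "homotopic_with (\<lambda>h. h sphere_base = z) (nsphere n) Z f g"
  shows "cube_homotopic n Z z (\<lambda>x. f (cube_to_sphere n x)) (\<lambda>x. g (cube_to_sphere n x))"
proof -
  obtain h where h: "continuous_map (prod_topology (top_of_set {0..1::real}) (nsphere n)) Z h"
    "\<And>x. x\<in>topspace (nsphere n) \<Longrightarrow> h (0, x) = f x" "\<And>x. x\<in>topspace (nsphere n) \<Longrightarrow> h (1, x) = g x"
    "\<And>t. t\<in>{0..1} \<Longrightarrow> h (t, sphere_base) = z"
    using assms unfolding homotopic_with_base_iff by auto
  define \<Phi> where "\<Phi> = (\<lambda>(x, t). h (max 0 (min 1 t), cube_to_sphere n x))"
  have "continuous_map euclidean (prod_topology (top_of_set {0..1}) (nsphere n))
      (\<lambda>p :: (nat \<Rightarrow> real) \<times> real. (max 0 (min 1 (snd p)), cube_to_sphere n (fst p)))"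
    unfolding continuous_map_pairwise
  proof
    show "continuous_map euclidean (top_of_set {0..1})
        (fst \<circ> (\<lambda>p :: (nat \<Rightarrow> real) \<times> real. (max 0 (min 1 (snd p)), cube_to_sphere n (fst p))))"
    proof -
      have "continuous_on UNIV (\<lambda>p :: (nat \<Rightarrow> real) \<times> real. max 0 (min 1 (snd p)))"
        by (intro continuous_intros)
      then show ?thesis by (simp add: continuous_map_in_subtopology o_def image_subset_iff)
    qed
    show "continuous_map euclidean (nsphere n)
        (snd \<circ> (\<lambda>p :: (nat \<Rightarrow> real) \<times> real. (max 0 (min 1 (snd p)), cube_to_sphere n (fst p))))"
      using continuous_map_euclidean_compose[OF continuous_map_cube_to_sphere continuous_on_fst_UNIV]
      by (simp add: o_def)
  qed
  from continuous_map_compose[OF this h(1)]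
  have cont: "continuous_map euclidean Z \<Phi>"
    by (simp add: \<Phi>_def o_def case_prod_unfold)
  have "cube_map n Z z (\<lambda>x. \<Phi> (x, t))" for t
    unfolding cube_map_def
  proof (intro conjI allI impI)
    show "continuous_map euclidean Z (\<lambda>x. \<Phi> (x, t))"
      by (intro continuous_map_euclidean_compose[OF cont] continuous_intros)
    show "dep_on {..<n} (\<lambda>x. \<Phi> (x, t))"
      using dep_onD[OF dep_on_cube_to_sphere[of n]] unfolding \<Phi>_def dep_on_def split by (metis (no_types))
    show "\<Phi> (x, t) = z" if "\<exists>i<n. x i \<notin> {0<..<1}" for x
      using that cube_to_sphere_outside[of _ n x] h(4) by (auto simp: \<Phi>_def simp del: greaterThanLessThan_iff)
  qed
  with cont show ?thesis unfolding cube_homotopic_def cube_homotopy_def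
    by (intro exI[of _ \<Phi>]) (simp add: \<Phi>_def h cube_to_sphere_in_nsphere)
qed

lemma cube_homotopic_imp_homotopic:
  assumes "cube_homotopic n Z z (\<lambda>x. f (cube_to_sphere n x)) (\<lambda>x. g (cube_to_sphere n x))"
    and fg: "f sphere_base = z" "g sphere_base = z" and z: "z \<in> topspace Z"
  shows "homotopic_with (\<lambda>h. h sphere_base = z) (nsphere n) Z f g"
proof -
  obtain \<Phi> where \<Phi>: "cube_homotopy n Z z \<Phi>" "\<And>x. \<Phi> (x, 0) = f (cube_to_sphere n x)"
    "\<And>x. \<Phi> (x, 1) = g (cube_to_sphere n x)"
    using assms unfolding cube_homotopic_def by auto
  show ?thesis unfolding homotopic_with_base_iff
  proof (intro exI[of _ "sphere_homotopy n z \<Phi>"] conjI continuous_map_sphere_homotopy \<Phi> z ballI)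
    show "sphere_homotopy n z \<Phi> (0, u) = f u" if "u \<in> topspace (nsphere n)" for u
      using cube_to_sphere_inverse[OF that] \<Phi>(2) fg by (auto simp: sphere_homotopy_def)
    show "sphere_homotopy n z \<Phi> (1, u) = g u" if "u \<in> topspace (nsphere n)" for u
      using cube_to_sphere_inverse[OF that] \<Phi>(3) fg by (auto simp: sphere_homotopy_def)
    show "sphere_homotopy n z \<Phi> (t, sphere_base) = z" for t by (simp add: sphere_homotopy_def)
  qed
qed

section \<open>Base points of finite CW complexes\<close>

lemma disc_set_eq: "disc_set d = {x. (\<forall>i\<ge>d. x i = 0) \<and> (\<Sum>i<d. (x i)\<^sup>2) \<le> 1}"
  by (auto simp: disc_set_def topspace_Euclidean_space)

lemma open_disc_set_eq: "open_disc_set d = {x. (\<forall>i\<ge>d. x i = 0) \<and> (\<Sum>i<d. (x i)\<^sup>2) < 1}"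
  by (auto simp: open_disc_set_def topspace_Euclidean_space)

lemma bdry_disc_set_eq: "bdry_disc_set d = {x. (\<forall>i\<ge>d. x i = 0) \<and> (\<Sum>i<d. (x i)\<^sup>2) = 1}"
  by (auto simp: bdry_disc_set_def topspace_Euclidean_space)

lemma disc_set_split: "disc_set d = open_disc_set d \<union> bdry_disc_set d"
  by (auto simp: disc_set_eq open_disc_set_eq bdry_disc_set_eq)

lemma subtopology_Euclidean_space_disc: "subtopology (Euclidean_space d) (disc_set d) = top_of_set (disc_set d)"
proof -
  have "{x. \<forall>i\<ge>d. x i = 0} \<inter> disc_set d = disc_set d" by (auto simp: disc_set_eq)
  then show ?thesis
    by (simp add: Euclidean_space_def subtopology_subtopology euclidean_product_topology)
qed

lemma compact_disc_set: "compact (disc_set d)"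
proof -
  have "closed {x :: nat \<Rightarrow> real. (\<Sum>i<d. (x i)\<^sup>2) \<le> 1}"
    by (intro closed_Collect_le continuous_intros)
  from compact_Int_closed[OF compact_box[of d "-1" 1] this]
  have "compact ({x :: nat \<Rightarrow> real. (\<forall>i<d. x i \<in> {-1..1}) \<and> (\<forall>i\<ge>d. x i = 0)} \<inter> {x. (\<Sum>i<d. (x i)\<^sup>2) \<le> 1})" .
  moreover have "{x :: nat \<Rightarrow> real. (\<forall>i<d. x i \<in> {-1..1}) \<and> (\<forall>i\<ge>d. x i = 0)} \<inter> {x. (\<Sum>i<d. (x i)\<^sup>2) \<le> 1} = disc_set d"
  proof -
    have "x i \<in> {-1..1}" if "(\<Sum>i<d. (x i)\<^sup>2) \<le> 1" "i < d" for x :: "nat \<Rightarrow> real" and i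
    proof -
      have "(x i)\<^sup>2 \<le> (\<Sum>i<d. (x i)\<^sup>2)" using that by (intro member_le_sum) auto
      then have "(x i)\<^sup>2 \<le> 1" using that(1) by linarith
      then have "\<bar>x i\<bar> \<le> 1" by (simp add: abs_square_le_1)
      then show ?thesis by auto
    qed
    then show ?thesis unfolding disc_set_eq by blast
  qed
  ultimately show ?thesis by simp
qed

lemma subtopology_top_of_set_subset: "T \<subseteq> S \<Longrightarrow> subtopology (top_of_set S) T = top_of_set T"
  by (simp add: subtopology_subtopology Int_absorb1)

text \<open>As long as \<open>b\<close> has not been reached, the deformation is stationary; so on the cell whose interior
  contains \<open>b\<close> it may be taken constant on the boundary.\<close>
definition local_contraction ::
  "'a topology \<Rightarrow> 'a \<Rightarrow> 'a set \<Rightarrow> ('a \<times> real \<Rightarrow> 'a) \<Rightarrow> 'a set \<Rightarrow> bool" where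
  "local_contraction X b A G V \<longleftrightarrow>
     continuous_map (prod_topology (subtopology X A) (top_of_set {0..1})) X G \<and>
     (\<forall>x\<in>A. G (x, 0) = x) \<and> (b \<in> A \<longrightarrow> (\<forall>t\<in>{0..1}. G (b, t) = b)) \<and>
     (b \<notin> A \<longrightarrow> (\<forall>x\<in>A. \<forall>t\<in>{0..1}. G (x, t) = x)) \<and>
     openin X V \<and> b \<in> V \<and> (\<forall>x\<in>A \<inter> V. G (x, 1) = b)"

definition speed_up :: "('a \<times> real \<Rightarrow> 'a) \<Rightarrow> 'a \<times> real \<Rightarrow> 'a" where
  "speed_up G = (\<lambda>(y, s). G (y, min 1 (2 * s)))"

text \<open>What has to be provided on a closed cell in order to extend \<open>speed_up G\<close> over it. The
  doubled speed leaves room for a neighbourhood of the boundary to be swept into \<open>b\<close> at time 1.\<close>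
definition cell_extension ::
  "'a topology \<Rightarrow> 'a \<Rightarrow> ('a \<times> real \<Rightarrow> 'a) \<Rightarrow> nat \<Rightarrow> ((nat \<Rightarrow> real) \<Rightarrow> 'a) \<Rightarrow>
    ((nat \<Rightarrow> real) \<times> real \<Rightarrow> 'a) \<Rightarrow> (nat \<Rightarrow> real) set \<Rightarrow> bool" where
  "cell_extension X b G d \<phi> H Q \<longleftrightarrow>
     continuous_map (top_of_set (disc_set d \<times> {0..1})) X H \<and>
     (\<forall>x\<in>disc_set d. H (x, 0) = \<phi> x) \<and>
     (\<forall>x\<in>bdry_disc_set d. \<forall>t\<in>{0..1}. H (x, t) = speed_up G (\<phi> x, t)) \<and>
     (\<forall>x\<in>disc_set d. \<phi> x = b \<longrightarrow> x \<in> Q \<and> (\<forall>t\<in>{0..1}. H (x, t) = b)) \<and>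
     open Q \<and> (\<forall>x\<in>disc_set d \<inter> Q. H (x, 1) = b)"

lemma continuous_map_speed_up:
  assumes "continuous_map (prod_topology Y (top_of_set {0..1})) X G"
  shows "continuous_map (prod_topology Y (top_of_set {0..1})) X (speed_up G)"
proof -
  let ?P = "prod_topology Y (top_of_set {0..1::real})"
  have m: "continuous_map ?P euclideanreal (\<lambda>p. min 1 (2 * snd p))"
  proof (intro continuous_intros)
    show "continuous_map ?P euclideanreal snd"
      using continuous_map_snd[of Y "top_of_set {0..1::real}"] by (simp add: continuous_map_in_subtopology)
  qed auto
  have "continuous_map ?P ?P (\<lambda>p. (fst p, min 1 (2 * snd p)))"
    unfolding continuous_map_pairwise
    by (auto simp: o_def continuous_map_fst continuous_map_in_subtopology m)
  from continuous_map_compose[OF this assms] show ?thesis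
    by (simp add: speed_up_def o_def case_prod_unfold)
qed

text \<open>When \<open>b\<close> is the image of an interior point \<open>p\<close>, the disc is
  contracted linearly towards \<open>p\<close>, damped so that the boundary does not move. This fits
  with \<open>G\<close>, which is assumed stationary on the boundary.\<close>

lemma cell_extension_interior:
  assumes \<phi>: "continuous_map (top_of_set (disc_set d)) X \<phi>" and p: "p \<in> open_disc_set d"
    and inj: "\<And>x. x \<in> disc_set d \<Longrightarrow> \<phi> x = \<phi> p \<Longrightarrow> x = p"
    and G: "\<And>x t. x \<in> bdry_disc_set d \<Longrightarrow> t \<in> {0..1} \<Longrightarrow> G (\<phi> x, t) = \<phi> x"
  shows "\<exists>H Q. cell_extension X (\<phi> p) G d \<phi> H Q"
proof -
  define N where "N x = (\<Sum>i<d. (x i)\<^sup>2)" for x :: "nat \<Rightarrow> real"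
  \<comment> \<open>The damping factor is 0 for N x = 1 and reaches 1 exactly for N x \<le> (1 + N
    p) / 2, the midpoint between \<open>N p\<close> and 1; the open set \<open>Q\<close> below is
    chosen accordingly.\<close>
  define m where "m x = max 0 (min 1 (2 * (1 - N x) / (1 - N p)))" for x
  define k where "k = (\<lambda>(x, t). (\<lambda>i. p i + (1 - t * m x) * (x i - p i)))"
  have Np: "N p < 1" using p by (simp add: N_def open_disc_set_eq)
  have m01: "m x \<in> {0..1}" for x by (simp add: m_def)
  have contN: "continuous_on UNIV N" unfolding N_def by (intro continuous_intros)
  then have contm: "continuous_on UNIV m" using Np
    unfolding m_def by (intro continuous_intros) auto
  have "continuous_on UNIV k"
    unfolding k_def case_prod_unfold
    by (intro continuous_on_coordinatewise_then_product continuous_intros continuous_on_compose2[OF contm]) auto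
  moreover have kd: "k (x, t) \<in> disc_set d" if x: "x \<in> disc_set d" and t: "t \<in> {0..1}" for x t
  proof -
    define c where "c = 1 - t * m x"
    have c: "c \<in> {0..1}" using m01[of x] t by (auto simp: c_def mult_le_one)
    \<comment> \<open>Convexity of the square, with the defect written out; it keeps the contraction
      inside the disc.\<close>
    have "(p i + c * (x i - p i))\<^sup>2 \<le> (1 - c) * (p i)\<^sup>2 + c * (x i)\<^sup>2" for i
    proof -
      have "(1 - c) * (p i)\<^sup>2 + c * (x i)\<^sup>2 - (p i + c * (x i - p i))\<^sup>2 = c * (1 - c) * (x i - p i)\<^sup>2"
        by (simp add: power2_eq_square algebra_simps)
      also have "\<dots> \<ge> 0" using c by simp
      finally show ?thesis by simp
    qed
    then have "(\<Sum>i<d. (p i + c * (x i - p i))\<^sup>2) \<le> (\<Sum>i<d. (1 - c) * (p i)\<^sup>2 + c * (x i)\<^sup>2)"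
      by (intro sum_mono) auto
    also have "\<dots> = (1 - c) * N p + c * N x"
      by (simp add: N_def sum.distrib sum_distrib_left)
    also have "\<dots> \<le> (1 - c) * 1 + c * 1"
      using c Np x by (intro add_mono mult_left_mono) (auto simp: N_def disc_set_eq)
    finally show ?thesis using x p by (simp add: k_def c_def disc_set_eq open_disc_set_eq)
  qed
  ultimately have "continuous_map (top_of_set (disc_set d \<times> {0..1})) (top_of_set (disc_set d)) k"
    by (auto simp: continuous_map_in_subtopology intro: continuous_on_subset)
  from continuous_map_compose[OF this \<phi>]
  have cont: "continuous_map (top_of_set (disc_set d \<times> {0..1})) X (\<lambda>q. \<phi> (k q))" by (simp add: o_def)
  define Q where "Q = {x. N x < (1 + N p) / 2}"
  have "open Q" unfolding Q_def by (intro open_Collect_less contN continuous_intros)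
  have mQ: "m x = 1" if "x \<in> Q" for x
  proof -
    have "1 \<le> 2 * (1 - N x) / (1 - N p)" using that Np by (simp add: Q_def field_simps)
    then show ?thesis by (simp add: m_def)
  qed
  have kp: "k (p, t) = p" for t by (auto simp: k_def)
  have "cell_extension X (\<phi> p) G d \<phi> (\<lambda>q. \<phi> (k q)) Q"
    unfolding cell_extension_def
  proof (intro conjI ballI impI cont \<open>open Q\<close>)
    show "\<phi> (k (x, 0)) = \<phi> x" for x by (simp add: k_def)
    show "\<phi> (k (x, t)) = speed_up G (\<phi> x, t)" if x: "x \<in> bdry_disc_set d" "t \<in> {0..1}" for x t
    proof -
      have "m x = 0" using x by (simp add: m_def bdry_disc_set_eq N_def)
      then have "k (x, t) = x" by (simp add: k_def)
      moreover have "speed_up G (\<phi> x, t) = \<phi> x" using G[OF x(1)] x(2) by (simp add: speed_up_def)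
      ultimately show ?thesis by simp
    qed
    show "x \<in> Q" if "x \<in> disc_set d" "\<phi> x = \<phi> p" for x
      using inj[OF that] Np by (simp add: Q_def)
    show "\<phi> (k (x, t)) = \<phi> p" if "x \<in> disc_set d" "\<phi> x = \<phi> p" for x t
      using inj[OF that] by (simp add: kp)
    show "\<phi> (k (x, 1)) = \<phi> p" if "x \<in> disc_set d \<inter> Q" for x
      using mQ[of x] that by (simp add: k_def)
  qed
  then show ?thesis by blast
qed

text \<open>A point moves outward along its ray until it meets the boundary sphere, and from then on
  it is carried along by \<open>speed_up G\<close> there. Points close to the boundary arrive early
  enough to be swept all the way into \<open>b\<close>.\<close>

lemma cell_extension_boundary:
  assumes \<phi>: "continuous_map (top_of_set (disc_set d)) X \<phi>"
    and G: "local_contraction X b A G V"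
    and bdry: "\<And>x. x \<in> bdry_disc_set d \<Longrightarrow> \<phi> x \<in> A"
    and b: "\<And>x. x \<in> open_disc_set d \<Longrightarrow> \<phi> x \<noteq> b"
    and A: "A \<subseteq> topspace X"
  shows "\<exists>H Q. cell_extension X b G d \<phi> H Q"
proof -
  define r where "r x = sqrt (\<Sum>i<d. (x i)\<^sup>2)" for x :: "nat \<Rightarrow> real"
  have contr: "continuous_on UNIV r" unfolding r_def by (intro continuous_intros)
  have r0: "0 \<le> r x" for x by (simp add: r_def sum_nonneg)
  have r1: "r x \<le> 1" if "x \<in> disc_set d" for x using that by (simp add: r_def disc_set_eq)
  have rsc: "(\<Sum>i<d. (c * x i)\<^sup>2) = (c * r x)\<^sup>2" for c x
    by (simp add: r_def power_mult_distrib sum_distrib_left sum_nonneg)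
  have bdry_iff: "x \<in> bdry_disc_set d \<longleftrightarrow> x \<in> disc_set d \<and> r x = 1" for x
    by (auto simp: r_def disc_set_eq bdry_disc_set_eq)
  define dir where "dir x = (\<lambda>i. (1 / r x) * x i)" for x
  have dir_bdry: "dir x \<in> bdry_disc_set d" if "x \<in> disc_set d" "r x > 0" for x
    using that rsc[of "1 / r x" x] by (simp add: bdry_disc_set_eq dir_def disc_set_eq)
  let ?I = "top_of_set {0..1::real}"
  let ?P = "top_of_set (disc_set d \<times> {0..1::real})"
  have contG: "continuous_map (prod_topology (subtopology X A) ?I) X (speed_up G)"
    using G by (intro continuous_map_speed_up) (simp add: local_contraction_def)
  \<comment> \<open>The radius that the point would have without the boundary, growing by the factor
    1 + s. Up to 1 the motion is radial; beyond 1 the excess is the time handed to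
    \<open>speed_up G\<close>. On the boundary sphere itself the excess equals the time.\<close>
  define p where "p = (\<lambda>q :: (nat \<Rightarrow> real) \<times> real. r (fst q) * (1 + snd q))"
  have contp: "continuous_on S p" for S unfolding p_def
    by (intro continuous_intros continuous_on_compose2[OF contr]) auto
  define f1 where "f1 = (\<lambda>q :: (nat \<Rightarrow> real) \<times> real. \<phi> (\<lambda>i. (1 + snd q) * fst q i))"
  define f2 where "f2 = (\<lambda>q :: (nat \<Rightarrow> real) \<times> real. speed_up G (\<phi> (dir (fst q)), p q - 1))"
  define H where "H = (\<lambda>q. if p q \<le> 1 then f1 q else f2 q)"
  have "continuous_map ?P X H"
    unfolding H_def
  proof (rule continuous_map_cases_le)
    show "continuous_map ?P euclideanreal p" by (simp add: contp)
    show "continuous_map ?P euclideanreal (\<lambda>q. 1)" by simp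
    let ?D1 = "{x \<in> topspace ?P. p x \<le> 1}"
    have D1: "subtopology ?P ?D1 = top_of_set ?D1"
      by (rule subtopology_top_of_set_subset) auto
    have "continuous_map (top_of_set ?D1) (top_of_set (disc_set d)) (\<lambda>q i. (1 + snd q) * fst q i)"
      unfolding continuous_map_in_subtopology
    proof (intro conjI funcsetI)
      have "continuous_on UNIV (\<lambda>q :: (nat \<Rightarrow> real) \<times> real. \<lambda>i. (1 + snd q) * fst q i)"
        by (intro continuous_on_coordinatewise_then_product continuous_intros)
      then show "continuous_map (top_of_set ?D1) euclidean (\<lambda>q i. (1 + snd q) * fst q i)"
        unfolding continuous_map_iff_continuous by (rule continuous_on_subset) simp
      fix q assume "q \<in> topspace (top_of_set ?D1)"
      then have q: "fst q \<in> disc_set d" "0 \<le> snd q" "p q \<le> 1" by (simp_all add: mem_Times_iff)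
      have "((1 + snd q) * r (fst q))\<^sup>2 \<le> 1" using q r0[of "fst q"]
        by (intro power_le_one) (auto simp: p_def mult.commute)
      then show "(\<lambda>i. (1 + snd q) * fst q i) \<in> disc_set d"
        using q by (simp add: disc_set_eq rsc)
    qed
    from continuous_map_compose[OF this \<phi>]
    show "continuous_map (subtopology ?P ?D1) X f1"
      unfolding D1 by (simp add: f1_def o_def)
    let ?D2 = "{x \<in> topspace ?P. 1 \<le> p x}"
    have D2: "subtopology ?P ?D2 = top_of_set ?D2"
      by (rule subtopology_top_of_set_subset) auto
    have rpos: "r (fst q) > 0" if "q \<in> ?D2" for q
    proof (rule ccontr)
      assume "\<not> 0 < r (fst q)"
      then have "r (fst q) = 0" using r0[of "fst q"] by simp
      then show False using that by (simp add: p_def)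
    qed
    have "continuous_map (top_of_set ?D2) (top_of_set (disc_set d)) (\<lambda>q. dir (fst q))"
      unfolding continuous_map_in_subtopology
    proof (intro conjI funcsetI)
      have "continuous_on ?D2 (\<lambda>q. dir (fst q) i)" for i
        unfolding dir_def
        by (intro continuous_intros continuous_on_compose2[OF contr]) (use rpos in \<open>force+\<close>)
      then show "continuous_map (top_of_set ?D2) euclidean (\<lambda>q. dir (fst q))"
        unfolding continuous_map_iff_continuous by (rule continuous_on_coordinatewise_then_product)
      fix q assume q: "q \<in> topspace (top_of_set ?D2)"
      then have "fst q \<in> disc_set d" "r (fst q) > 0" using rpos[of q] by (simp_all add: mem_Times_iff)
      then show "dir (fst q) \<in> disc_set d" using dir_bdry disc_set_split by blast
    qed
    from continuous_map_compose[OF this \<phi>]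
    have c1: "continuous_map (top_of_set ?D2) X (\<lambda>q. \<phi> (dir (fst q)))" by (simp add: o_def)
    have c2: "continuous_map (top_of_set ?D2) (subtopology X A) (\<lambda>q. \<phi> (dir (fst q)))"
      unfolding continuous_map_in_subtopology
    proof (intro conjI c1 funcsetI)
      fix q assume q: "q \<in> topspace (top_of_set ?D2)"
      then have "fst q \<in> disc_set d" "r (fst q) > 0" using rpos[of q] by (simp_all add: mem_Times_iff)
      then show "\<phi> (dir (fst q)) \<in> A" using dir_bdry bdry by blast
    qed
    have c3: "continuous_map (top_of_set ?D2) ?I (\<lambda>q. p q - 1)"
      unfolding continuous_map_in_subtopology
    proof (intro conjI funcsetI)
      show "continuous_map (top_of_set ?D2) euclidean (\<lambda>q. p q - 1)"
        unfolding continuous_map_iff_continuous by (intro continuous_intros contp)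
      fix q assume q: "q \<in> topspace (top_of_set ?D2)"
      then have "r (fst q) \<le> 1" "0 \<le> snd q" "snd q \<le> 1" "1 \<le> p q" using r1 by (simp_all add: mem_Times_iff)
      then have "p q \<le> 1 * (1 + 1)" unfolding p_def by (intro mult_mono) auto
      then show "p q - 1 \<in> {0..1}" using \<open>1 \<le> p q\<close> by simp
    qed
    have "continuous_map (top_of_set ?D2) (prod_topology (subtopology X A) ?I) (\<lambda>q. (\<phi> (dir (fst q)), p q - 1))"
      unfolding continuous_map_pairwise using c2 c3 by (simp add: o_def)
    from continuous_map_compose[OF this contG]
    show "continuous_map (subtopology ?P ?D2) X f2"
      unfolding D2 by (simp add: f2_def o_def)
    fix q assume q: "q \<in> topspace ?P" "p q = 1"
    then have q2: "q \<in> ?D2" by simp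
    have rp: "r (fst q) > 0" using rpos[OF q2] .
    have "1 / r (fst q) = 1 + snd q" using q(2) rp by (simp add: p_def field_simps)
    then have "dir (fst q) = (\<lambda>i. (1 + snd q) * fst q i)" by (simp add: dir_def)
    moreover have "\<phi> (dir (fst q)) \<in> A" using q dir_bdry[of "fst q"] rp bdry by auto
    ultimately show "f1 q = f2 q"
      using G q by (simp add: f1_def f2_def speed_up_def local_contraction_def)
  qed
  moreover have Hbdry: "H (x, t) = speed_up G (\<phi> x, t)" if x: "x \<in> bdry_disc_set d" "t \<in> {0..1}" for x t
  proof -
    have rx: "r x = 1" using x bdry_iff by blast
    then have d: "dir x = x" by (simp add: dir_def)
    show ?thesis
    proof (cases "t = 0")
      case True
      then show ?thesis using G bdry[OF x(1)] rx
        by (simp add: H_def p_def f1_def speed_up_def local_contraction_def)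
    next
      case False
      then show ?thesis using rx d x by (simp add: H_def p_def f2_def)
    qed
  qed
  moreover have "H (x, 0) = \<phi> x" if "x \<in> disc_set d" for x
    using r1[OF that] by (simp add: H_def p_def f1_def)
  \<comment> \<open>At the end the excess is 2 r - 1, and \<open>speed_up G\<close> has finished
    once its time is at least 1/2; this means r \<ge> 3/4.\<close>
  moreover have "open {x. r x > 3/4}" by (intro open_Collect_less contr continuous_intros)
  obtain Q0 where Q0: "open Q0" "\<And>x. x \<in> disc_set d \<Longrightarrow> r x > 3/4 \<Longrightarrow> x \<in> Q0 \<longleftrightarrow> \<phi> (dir x) \<in> V"
  proof -
    let ?D = "{x \<in> disc_set d. r x > 3/4}"
    have "continuous_map (top_of_set ?D) (top_of_set (disc_set d)) dir"
      unfolding continuous_map_in_subtopology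
    proof (intro conjI funcsetI)
      have "continuous_on ?D (\<lambda>x. dir x i)" for i
        unfolding dir_def
        by (intro continuous_intros continuous_on_subset[OF contr]) auto
      then show "continuous_map (top_of_set ?D) euclidean dir"
        unfolding continuous_map_iff_continuous by (rule continuous_on_coordinatewise_then_product)
      fix x assume "x \<in> topspace (top_of_set ?D)"
      then have "x \<in> disc_set d" "r x > 0" by auto
      then show "dir x \<in> disc_set d" using dir_bdry disc_set_split by blast
    qed
    from continuous_map_compose[OF this \<phi>]
    have "continuous_map (top_of_set ?D) X (\<lambda>x. \<phi> (dir x))" by (simp add: o_def)
    moreover have "openin X V" using G by (simp add: local_contraction_def)
    ultimately have "openin (top_of_set ?D) {x \<in> topspace (top_of_set ?D). \<phi> (dir x) \<in> V}"
      by (rule openin_continuous_map_preimage)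
    then obtain Q0 where "open Q0" "{x \<in> topspace (top_of_set ?D). \<phi> (dir x) \<in> V} = ?D \<inter> Q0"
      unfolding openin_open by blast
    moreover from this have "x \<in> Q0 \<longleftrightarrow> \<phi> (dir x) \<in> V" if "x \<in> disc_set d" "r x > 3/4" for x
      using that by auto
    ultimately show ?thesis using that by blast
  qed
  define Q where "Q = Q0 \<inter> {x. r x > 3/4}"
  have "open Q" unfolding Q_def using Q0(1) \<open>open {x. r x > 3/4}\<close> by auto
  have inbdry: "x \<in> bdry_disc_set d" if "x \<in> disc_set d" "\<phi> x = b" for x
    using that b disc_set_split by blast
  have V: "b \<in> V" "\<And>x. x \<in> A \<Longrightarrow> x \<in> V \<Longrightarrow> G (x, 1) = b"
    "b \<in> A \<Longrightarrow> \<forall>t\<in>{0..1}. G (b, t) = b" using G by (auto simp: local_contraction_def)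
  have "x \<in> Q" if x: "x \<in> disc_set d" "\<phi> x = b" for x
  proof -
    have "r x = 1" using inbdry[OF x] bdry_iff by blast
    then have "dir x = x" by (simp add: dir_def)
    then show ?thesis using Q0(2)[OF x(1)] \<open>r x = 1\<close> x V(1) by (simp add: Q_def)
  qed
  moreover have "H (x, t) = b" if x: "x \<in> disc_set d" "\<phi> x = b" "t \<in> {0..1}" for x t
    using Hbdry[OF inbdry[OF x(1,2)] x(3)] V(3) bdry[OF inbdry[OF x(1,2)]] x by (simp add: speed_up_def)
  moreover have "H (x, 1) = b" if x: "x \<in> disc_set d \<inter> Q" for x
  proof -
    have rx: "r x > 3/4" "x \<in> disc_set d" "x \<in> Q0" using x by (auto simp: Q_def)
    then have "\<phi> (dir x) \<in> V" using Q0(2) by blast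
    moreover have "\<phi> (dir x) \<in> A" using dir_bdry[of x] rx bdry by auto
    ultimately have "G (\<phi> (dir x), 1) = b" using V(2) by blast
    then show ?thesis using rx by (simp add: H_def p_def f2_def speed_up_def)
  qed
  ultimately have "cell_extension X b G d \<phi> H Q"
    using \<open>open Q\<close> unfolding cell_extension_def by blast
  then show ?thesis by blast
qed

section \<open>Induction over the skeleta\<close>

locale finite_cells =
  fixes X :: "'a topology" and C :: "(nat \<times> ((nat \<Rightarrow> real) \<Rightarrow> 'a)) set" and b :: 'a
  assumes Hausdorff: "Hausdorff_space X" and finite: "finite C" and base: "b \<in> topspace X"
    and cont: "\<And>d \<phi>. (d, \<phi>) \<in> C \<Longrightarrow> continuous_map (top_of_set (disc_set d)) X \<phi>"
    and inj: "\<And>d \<phi>. (d, \<phi>) \<in> C \<Longrightarrow> inj_on \<phi> (open_disc_set d)"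
    and bdry: "\<And>d \<phi>. (d, \<phi>) \<in> C \<Longrightarrow>
      \<phi> ` bdry_disc_set d \<subseteq> \<Union>{\<psi> ` open_disc_set e | e \<psi>. (e, \<psi>) \<in> C \<and> e < d}"
    and disj: "\<And>d \<phi> e \<psi>. (d, \<phi>) \<in> C \<Longrightarrow> (e, \<psi>) \<in> C \<Longrightarrow> (d, \<phi>) \<noteq> (e, \<psi>) \<Longrightarrow>
      \<phi> ` open_disc_set d \<inter> \<psi> ` open_disc_set e = {}"
    and cover: "topspace X = \<Union>{\<phi> ` open_disc_set d | d \<phi>. (d, \<phi>) \<in> C}"
begin

text \<open>The inequality is strict, so \<open>skel d\<close> is the (d-1)-skeleton. The induction
  can start with the empty set, and boundaries of d-cells lie in \<open>skel d\<close>.\<close>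

definition skel :: "nat \<Rightarrow> 'a set" where
  "skel d = \<Union>{\<phi> ` open_disc_set e | e \<phi>. (e, \<phi>) \<in> C \<and> e < d}"

lemma skel_bdry: "(d, \<phi>) \<in> C \<Longrightarrow> x \<in> bdry_disc_set d \<Longrightarrow> \<phi> x \<in> skel d"
  using bdry unfolding skel_def by blast

lemma skel_mono: "d \<le> e \<Longrightarrow> skel d \<subseteq> skel e"
  unfolding skel_def by (blast intro: less_le_trans)

lemma skel_subset: "skel d \<subseteq> topspace X"
  unfolding skel_def cover by blast

lemma skel_openI: "(e, \<phi>) \<in> C \<Longrightarrow> e < d \<Longrightarrow> x \<in> open_disc_set e \<Longrightarrow> \<phi> x \<in> skel d"
  unfolding skel_def by blast

lemma skel_discI: "(e, \<phi>) \<in> C \<Longrightarrow> e < d \<Longrightarrow> x \<in> disc_set e \<Longrightarrow> \<phi> x \<in> skel d"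
  using skel_openI skel_bdry skel_mono[of e d] unfolding disc_set_split by (meson UnE less_imp_le subsetD)

lemma skel_cases:
  assumes "y \<in> skel d"
  obtains e \<phi> x where "(e, \<phi>) \<in> C" "e < d" "x \<in> open_disc_set e" "y = \<phi> x"
  using assms unfolding skel_def by blast

lemma open_cell_not_in_skel: "(d, \<phi>) \<in> C \<Longrightarrow> x \<in> open_disc_set d \<Longrightarrow> \<phi> x \<notin> skel d"
proof
  assume *: "(d, \<phi>) \<in> C" "x \<in> open_disc_set d" "\<phi> x \<in> skel d"
  from *(3) obtain e \<psi> y where e: "(e, \<psi>) \<in> C" "e < d" "y \<in> open_disc_set e" "\<phi> x = \<psi> y"
    by (rule skel_cases)
  then have "\<phi> ` open_disc_set d \<inter> \<psi> ` open_disc_set e = {}"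
    using *(1) by (intro disj) auto
  then show False using * e by blast
qed

text \<open>Replacing open discs by closed ones exhibits the skeleton as a finite union of compact
  images, from which closedness follows.\<close>

lemma skel_eq_discs: "skel d = (\<Union>(e, \<phi>)\<in>{c \<in> C. fst c < d}. \<phi> ` disc_set e)"
proof
  show "skel d \<subseteq> (\<Union>(e, \<phi>)\<in>{c \<in> C. fst c < d}. \<phi> ` disc_set e)"
    unfolding skel_def disc_set_split by force
  show "(\<Union>(e, \<phi>)\<in>{c \<in> C. fst c < d}. \<phi> ` disc_set e) \<subseteq> skel d"
    using skel_discI by force
qed

lemma closedin_image_compact:
  assumes "(e, \<phi>) \<in> C" "compact K" "K \<subseteq> disc_set e"
  shows "closedin X (\<phi> ` K)"
proof -
  have "compactin (top_of_set (disc_set e)) K" using assms by (simp add: compactin_subtopology)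
  then have "compactin X (\<phi> ` K)" by (rule image_compactin) (rule cont[OF assms(1)])
  then show ?thesis using Hausdorff by (simp add: compactin_imp_closedin)
qed

lemma closedin_skel: "closedin X (skel d)"
  unfolding skel_eq_discs
  by (intro closedin_Union) (auto simp: finite intro!: closedin_image_compact compact_disc_set)

lemma skel_Suc_cases:
  assumes "y \<in> skel (Suc d)"
  obtains "y \<in> skel d" | \<phi> x where "(d, \<phi>) \<in> C" "x \<in> open_disc_set d" "y = \<phi> x" "y \<notin> skel d"
proof -
  obtain e \<phi> x where e: "(e, \<phi>) \<in> C" "e < Suc d" "x \<in> open_disc_set e" "y = \<phi> x"
    using assms by (rule skel_cases)
  show ?thesis
  proof (cases "e = d")
    case True
    then show ?thesis using that(2)[of \<phi> x] e open_cell_not_in_skel by blast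
  next
    case False
    then show ?thesis using that(1) e skel_openI[of e \<phi> d x] by simp
  qed
qed

lemma skel_all: "\<exists>d. skel d = topspace X"
proof -
  obtain d where "\<And>e. e \<in> fst ` C \<Longrightarrow> e < d"
    using finite finite_nat_set_iff_bounded[of "fst ` C"] by auto
  then have *: "e < d" if "(e, \<phi>) \<in> C" for e \<phi> using that by (metis fst_conv imageI)
  have "topspace X \<subseteq> skel d"
  proof
    fix y assume "y \<in> topspace X"
    then obtain e \<phi> x where "(e, \<phi>) \<in> C" "x \<in> open_disc_set e" "y = \<phi> x"
      unfolding cover by blast
    then show "y \<in> skel d" using * skel_openI by blast
  qed
  then show ?thesis using skel_subset by blast
qed

text \<open>If \<open>b\<close> lies in the open cell, it is outside \<open>skel d\<close>, and
  there \<open>G\<close> is stationary by the convention in \<open>local_contraction\<close>.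
  Otherwise \<open>b\<close> can be met on the boundary of the disc only.\<close>

lemma cell_extension_exists:
  assumes G: "local_contraction X b (skel d) G V" and c: "(d, \<phi>) \<in> C"
  shows "\<exists>H Q. cell_extension X b G d \<phi> H Q"
proof (cases "b \<in> \<phi> ` open_disc_set d")
  case True
  then obtain p where p: "p \<in> open_disc_set d" "b = \<phi> p" by blast
  then have b: "b \<notin> skel d" using open_cell_not_in_skel[OF c] by simp
  have "\<exists>H Q. cell_extension X (\<phi> p) G d \<phi> H Q"
  proof (rule cell_extension_interior[OF cont[OF c] p(1)])
    fix x assume x: "x \<in> disc_set d" "\<phi> x = \<phi> p"
    have "x \<notin> bdry_disc_set d" using skel_bdry[OF c, of x] b p(2) x(2) by metis
    with x(1) have "x \<in> open_disc_set d" unfolding disc_set_split by simp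
    then show "x = p" using inj[OF c] x p by (auto dest: inj_onD)
  next
    fix x t assume "x \<in> bdry_disc_set d" "t \<in> {0..1::real}"
    then show "G (\<phi> x, t) = \<phi> x" using G b skel_bdry[OF c] by (auto simp: local_contraction_def)
  qed
  then show ?thesis using p by simp
next
  case False
  then show ?thesis
    by (intro cell_extension_boundary[OF cont[OF c] G] skel_bdry[OF c] skel_subset) auto
qed

text \<open>The deformation is glued from \<open>speed_up G\<close> on the old skeleton and an
  extension on each closed d-cell. Continuity is tested on closed sets: each preimage is a finite
  union of a closed set and images of compact sets in a Hausdorff space.\<close>

lemma local_contraction_Suc:
  assumes G: "local_contraction X b (skel d) G V"
  shows "\<exists>G V. local_contraction X b (skel (Suc d)) G V"
proof (cases "b \<in> skel (Suc d)")
  case False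
  \<comment> \<open>The projection \<open>fst\<close> is the stationary deformation. The
    neighbourhood is the complement of the skeleton, so nothing has to be carried to
    \<open>b\<close>.\<close>
  have "local_contraction X b (skel (Suc d)) fst (topspace X - skel (Suc d))"
    unfolding local_contraction_def
    using False base closedin_skel continuous_map_fst[of "subtopology X (skel (Suc d))" "top_of_set {0..1::real}"]
    by (auto simp: continuous_map_in_subtopology closedin_def)
  then show ?thesis by blast
next
  case True
  let ?I = "top_of_set {0..1::real}"
  let ?G2 = "speed_up G"
  have "\<forall>\<phi>. \<exists>H Q. (d, \<phi>) \<in> C \<longrightarrow> cell_extension X b G d \<phi> H Q"
    using cell_extension_exists[OF G] by blast
  then obtain H Q where HQ: "\<And>\<phi>. (d, \<phi>) \<in> C \<Longrightarrow> cell_extension X b G d \<phi> (H \<phi>) (Q \<phi>)"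
    by metis
  have contG2: "continuous_map (prod_topology (subtopology X (skel d)) ?I) X ?G2"
    using G by (intro continuous_map_speed_up) (simp add: local_contraction_def)
  \<comment> \<open>Characteristic map and disc coordinates of a point in an open d-cell; they are
    unique because the open cells are disjoint and the characteristic maps injective on
    them.\<close>
  define sel where "sel y = (SOME c. (d, fst c) \<in> C \<and> snd c \<in> open_disc_set d \<and> fst c (snd c) = y)" for y
  have sel: "sel (\<phi> x) = (\<phi>, x)" if c: "(d, \<phi>) \<in> C" "x \<in> open_disc_set d" for \<phi> x
    unfolding sel_def
  proof (rule some_equality)
    fix c assume c2: "(d, fst c) \<in> C \<and> snd c \<in> open_disc_set d \<and> fst c (snd c) = \<phi> x"
    have "fst c = \<phi>"
    proof (rule ccontr)
      assume "fst c \<noteq> \<phi>"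
      then have "fst c ` open_disc_set d \<inter> \<phi> ` open_disc_set d = {}" using c c2 by (intro disj) auto
      then show False using c c2 by (metis disjoint_iff imageI)
    qed
    moreover from this have "snd c = x" using inj[OF c(1)] c c2 by (auto dest: inj_onD)
    ultimately show "c = (\<phi>, x)" by (simp add: prod_eq_iff)
  qed (use c in simp)
  define G' where "G' q = (if fst q \<in> skel d then ?G2 q else H (fst (sel (fst q))) (snd (sel (fst q)), snd q))" for q
  have G'_skel: "G' (y, t) = ?G2 (y, t)" if "y \<in> skel d" for y t using that by (simp add: G'_def)
  have G'_cell: "G' (\<phi> x, t) = H \<phi> (x, t)" if c: "(d, \<phi>) \<in> C" "x \<in> disc_set d" "t \<in> {0..1}" for \<phi> x t
  proof (cases "x \<in> open_disc_set d")
    case True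
    then show ?thesis using open_cell_not_in_skel[OF c(1) True] sel[OF c(1) True] by (simp add: G'_def)
  next
    case False
    then have "x \<in> bdry_disc_set d" using c disc_set_split by auto
    then show ?thesis using skel_bdry[OF c(1)] HQ[OF c(1)] c(3) by (simp add: G'_def cell_extension_def)
  qed
  let ?P = "prod_topology X ?I"
  have "continuous_map (prod_topology (subtopology X (skel (Suc d))) ?I) X G'"
    unfolding continuous_map_closedin
  proof (intro conjI allI impI funcsetI)
    have val: "H \<phi> (x, t) \<in> topspace X" if "(d, \<phi>) \<in> C" "x \<in> disc_set d" "t \<in> {0..1}" for \<phi> x t
      using HQ[OF that(1)] that by (auto simp: cell_extension_def continuous_map_def)
    have val2: "?G2 (y, t) \<in> topspace X" if "y \<in> skel d" "t \<in> {0..1}" for y t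
      using contG2 that skel_subset[of d] unfolding continuous_map_def by auto
    have topI: "topspace ?I = {0..1}" by simp
    show "G' q \<in> topspace X" if q: "q \<in> topspace (prod_topology (subtopology X (skel (Suc d))) ?I)" for q
    proof -
      obtain y t where yt: "q = (y, t)" by (cases q)
      then have y: "y \<in> skel (Suc d)" "t \<in> {0..1}" using q by auto
      from y(1) show ?thesis
      proof (cases rule: skel_Suc_cases)
        case 1 then show ?thesis using val2 y by (simp add: yt G'_skel)
      next
        case (2 \<phi> x) then show ?thesis using val[of \<phi> x t] y G'_cell[of \<phi> x t] disc_set_split[of d] by (simp add: yt)
      qed
    qed
    fix T assume T: "closedin X T"
    define B where "B = {q \<in> skel d \<times> {0..1}. ?G2 q \<in> T}"
    define K where "K \<phi> = {q \<in> disc_set d \<times> {0..1}. H \<phi> q \<in> T}" for \<phi>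
    define f where "f = (\<lambda>\<phi> (q :: (nat \<Rightarrow> real) \<times> real). (\<phi> (fst q) :: 'a, snd q))"
    have "closedin (prod_topology (subtopology X (skel d)) ?I)
        {q \<in> topspace (prod_topology (subtopology X (skel d)) ?I). ?G2 q \<in> T}"
      using contG2 T by (rule closedin_continuous_map_preimage)
    moreover have "{q \<in> topspace (prod_topology (subtopology X (skel d)) ?I). ?G2 q \<in> T} = B"
      using skel_subset[of d] by (auto simp: B_def)
    ultimately have "closedin (subtopology ?P (skel d \<times> {0..1})) B"
      by (simp add: prod_topology_subtopology(1))
    moreover have "closedin ?P (skel d \<times> {0..1})"
      unfolding closedin_prod_Times_iff using closedin_skel closedin_topspace[of ?I] by simp
    ultimately have clB: "closedin ?P B" by (rule closedin_trans_full)
    have clK: "closedin ?P (f \<phi> ` K \<phi>)" if c: "(d, \<phi>) \<in> C" for \<phi>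
    proof -
      have cH: "continuous_map (top_of_set (disc_set d \<times> {0..1})) X (H \<phi>)"
        using HQ[OF c] by (simp add: cell_extension_def)
      have "closedin (top_of_set (disc_set d \<times> {0..1})) {q \<in> topspace (top_of_set (disc_set d \<times> {0..1})). H \<phi> q \<in> T}"
        using cH T by (rule closedin_continuous_map_preimage)
      then have "closedin (top_of_set (disc_set d \<times> {0..1})) (K \<phi>)" by (simp add: K_def)
      then have "compactin (top_of_set (disc_set d \<times> {0..1})) (K \<phi>)"
        by (intro closedin_compact_space) (auto simp: compact_space_subtopology compact_Times compact_disc_set)
      moreover have "continuous_map (prod_topology (top_of_set (disc_set d)) ?I) ?P (f \<phi>)"
        unfolding continuous_map_pairwise
        using continuous_map_compose[OF continuous_map_fst cont[OF c], of ?I]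
          continuous_map_snd[of "top_of_set (disc_set d)" ?I]
        by (simp add: f_def o_def)
      then have "continuous_map (top_of_set (disc_set d \<times> {0..1})) ?P (f \<phi>)" by simp
      ultimately have "compactin ?P (f \<phi> ` K \<phi>)" by (rule image_compactin)
      moreover have "Hausdorff_space ?P"
        using Hausdorff by (simp add: Hausdorff_space_prod_topology Hausdorff_space_subtopology)
      ultimately show ?thesis by (simp add: compactin_imp_closedin)
    qed
    have "finite {\<phi>. (d, \<phi>) \<in> C}"
    proof (rule finite_subset)
      show "{\<phi>. (d, \<phi>) \<in> C} \<subseteq> snd ` C" by force
    qed (use finite in simp)
    then have cl: "closedin ?P (B \<union> (\<Union>\<phi>\<in>{\<phi>. (d, \<phi>) \<in> C}. f \<phi> ` K \<phi>))"
      using clB clK by (intro closedin_Un closedin_Union) auto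
    have eq: "{q \<in> skel (Suc d) \<times> {0..1}. G' q \<in> T} = B \<union> (\<Union>\<phi>\<in>{\<phi>. (d, \<phi>) \<in> C}. f \<phi> ` K \<phi>)"
    proof (intro set_eqI iffI)
      fix q assume q: "q \<in> {q \<in> skel (Suc d) \<times> {0..1}. G' q \<in> T}"
      obtain y t where yt: "q = (y, t)" by (cases q)
      have y: "y \<in> skel (Suc d)" and t: "t \<in> {0..1}" and T: "G' (y, t) \<in> T" using q yt by auto
      from y show "q \<in> B \<union> (\<Union>\<phi>\<in>{\<phi>. (d, \<phi>) \<in> C}. f \<phi> ` K \<phi>)"
      proof (cases rule: skel_Suc_cases)
        case 1 then show ?thesis using t T by (simp add: yt B_def G'_skel)
      next
        case (2 \<phi> x)
        then have x: "x \<in> disc_set d" using disc_set_split by blast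
        then have "(x, t) \<in> K \<phi>" using 2 t T G'_cell[OF 2(1) x t] by (simp add: K_def)
        moreover have "q = f \<phi> (x, t)" using 2 by (simp add: f_def yt)
        ultimately show ?thesis using 2(1) by blast
      qed
    next
      fix q assume "q \<in> B \<union> (\<Union>\<phi>\<in>{\<phi>. (d, \<phi>) \<in> C}. f \<phi> ` K \<phi>)"
      then show "q \<in> {q \<in> skel (Suc d) \<times> {0..1}. G' q \<in> T}"
      proof
        assume "q \<in> B"
        then show ?thesis using skel_mono[of d "Suc d"] by (auto simp: B_def G'_skel)
      next
        assume "q \<in> (\<Union>\<phi>\<in>{\<phi>. (d, \<phi>) \<in> C}. f \<phi> ` K \<phi>)"
        then obtain \<phi> x t where c: "(d, \<phi>) \<in> C" "(x, t) \<in> K \<phi>" "q = f \<phi> (x, t)" by auto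
        then have x: "x \<in> disc_set d" "t \<in> {0..1}" "H \<phi> (x, t) \<in> T" by (auto simp: K_def)
        then show ?thesis using c skel_discI[OF c(1), of "Suc d" x] G'_cell[OF c(1) x(1,2)] by (simp add: f_def)
      qed
    qed
    have eq2: "{q \<in> topspace (prod_topology (subtopology X (skel (Suc d))) ?I). G' q \<in> T}
        = {q \<in> skel (Suc d) \<times> {0..1}. G' q \<in> T}"
      using skel_subset[of "Suc d"] by auto
    show "closedin (prod_topology (subtopology X (skel (Suc d))) ?I)
        {q \<in> topspace (prod_topology (subtopology X (skel (Suc d))) ?I). G' q \<in> T}"
      unfolding eq2 eq unfolding prod_topology_subtopology(1) topI
      using eq by (intro closedin_subset_topspace cl) blast
  qed
  moreover have "G' (y, 0) = y" if y: "y \<in> skel (Suc d)" for y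
    using y
  proof (cases rule: skel_Suc_cases)
    case 1 then show ?thesis using G by (simp add: G'_skel speed_up_def local_contraction_def)
  next
    case (2 \<phi> x)
    then have "x \<in> disc_set d" using disc_set_split by blast
    then show ?thesis using 2 G'_cell[of \<phi> x 0] HQ[OF 2(1)] by (simp add: cell_extension_def)
  qed
  moreover have "G' (b, t) = b" if t: "t \<in> {0..1}" for t
    using True
  proof (cases rule: skel_Suc_cases)
    case 1 then show ?thesis using G t by (simp add: G'_skel speed_up_def local_contraction_def)
  next
    case (2 \<phi> x)
    then have "x \<in> disc_set d" using disc_set_split by blast
    then show ?thesis using 2 G'_cell[of \<phi> x t] HQ[OF 2(1)] t by (simp add: cell_extension_def)
  qed
  moreover
  \<comment> \<open>All points not known to end in \<open>b\<close> are removed: on the old skeleton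
    those outside \<open>V\<close>, on each closed cell the images of those outside
    \<open>Q\<close>. The removed set is a finite union of closed sets.\<close>
  define V' where "V' = topspace X - ((skel d - V) \<union> (\<Union>\<phi>\<in>{\<phi>. (d, \<phi>) \<in> C}. \<phi> ` (disc_set d - Q \<phi>)))"
  have "openin X V'"
  proof -
    have "finite {\<phi>. (d, \<phi>) \<in> C}"
    proof (rule finite_subset)
      show "{\<phi>. (d, \<phi>) \<in> C} \<subseteq> snd ` C" by force
    qed (use finite in simp)
    moreover have "closedin X (\<phi> ` (disc_set d - Q \<phi>))" if "(d, \<phi>) \<in> C" for \<phi>
      using HQ[OF that] by (intro closedin_image_compact[OF that]) (auto simp: cell_extension_def compact_diff compact_disc_set)
    ultimately have "closedin X (\<Union>\<phi>\<in>{\<phi>. (d, \<phi>) \<in> C}. \<phi> ` (disc_set d - Q \<phi>))"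
      by (intro closedin_Union) auto
    moreover have "closedin X (skel d - V)"
      using G closedin_skel by (auto simp: local_contraction_def intro: closedin_diff)
    ultimately show ?thesis unfolding V'_def by (intro openin_diff closedin_Un) auto
  qed
  moreover have "b \<in> V'"
  proof -
    have "b \<in> V" using G by (simp add: local_contraction_def)
    moreover have "b \<notin> \<phi> ` (disc_set d - Q \<phi>)" if "(d, \<phi>) \<in> C" for \<phi>
      using HQ[OF that] by (auto simp: cell_extension_def)
    ultimately show ?thesis using base by (simp add: V'_def)
  qed
  moreover have "G' (y, 1) = b" if y: "y \<in> skel (Suc d) \<inter> V'" for y
  proof -
    from y have "y \<in> skel (Suc d)" by simp
    then show ?thesis
    proof (cases rule: skel_Suc_cases)
      case 1
      then have "y \<in> V" using y by (auto simp: V'_def)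
      then show ?thesis using 1 G by (simp add: G'_skel speed_up_def local_contraction_def)
    next
      case (2 \<phi> x)
      then have x: "x \<in> disc_set d" using disc_set_split by blast
      then have "x \<in> Q \<phi>" using y 2 by (auto simp: V'_def)
      then show ?thesis using 2 x G'_cell[of \<phi> x 1] HQ[OF 2(1)] by (simp add: cell_extension_def)
    qed
  qed
  ultimately have "local_contraction X b (skel (Suc d)) G' V'"
    using True unfolding local_contraction_def by simp
  then show ?thesis by blast
qed

lemma local_contraction_skel: "\<exists>G V. local_contraction X b (skel d) G V"
proof (induction d)
  case 0
  have "skel 0 = {}" by (simp add: skel_def)
  moreover have "local_contraction X b {} fst (topspace X)"
    unfolding local_contraction_def using base by (auto simp: continuous_map_def)
  ultimately show ?case by metis
next
  case (Suc d)
  then show ?case using local_contraction_Suc by blast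
qed

end

text \<open>This is the well-pointedness that is used later. The deformation is defined on all of
  \<open>X\<close>, so it can be composed with any map into \<open>X\<close>; points of
  \<open>V\<close> may leave \<open>V\<close> on their way to \<open>b\<close>.\<close>

lemma finite_CW_local_contraction:
  assumes X: "finite_CW_complex X" and b: "b \<in> topspace X"
  obtains D V where "continuous_map (prod_topology X euclideanreal) X D"
    "\<And>x. x \<in> topspace X \<Longrightarrow> D (x, 0) = x" "\<And>t. D (b, t) = b"
    "openin X V" "b \<in> V" "\<And>x. x \<in> V \<Longrightarrow> D (x, 1) = b"
proof -
  obtain C where "Hausdorff_space X" and fin: "finite C" and
    C: "\<forall>(d, \<phi>) \<in> C.
          continuous_map (subtopology (Euclidean_space d) (disc_set d)) X \<phi> \<and>
          homeomorphic_map (subtopology (Euclidean_space d) (open_disc_set d))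
                           (subtopology X (\<phi> ` open_disc_set d)) \<phi> \<and>
          \<phi> ` bdry_disc_set d \<subseteq> \<Union>{\<psi> ` open_disc_set d' | d' \<psi>. (d', \<psi>) \<in> C \<and> d' < d}"
    and disj: "\<forall>c \<in> C. \<forall>c' \<in> C. c \<noteq> c' \<longrightarrow>
          (snd c ` open_disc_set (fst c)) \<inter> (snd c' ` open_disc_set (fst c')) = {}"
    and cover: "topspace X = \<Union>{\<phi> ` open_disc_set d | d \<phi>. (d, \<phi>) \<in> C}"
    using X unfolding finite_CW_complex_def by (elim conjE exE) (rule that)
  have C: "continuous_map (subtopology (Euclidean_space d) (disc_set d)) X \<phi>"
    "homeomorphic_map (subtopology (Euclidean_space d) (open_disc_set d)) (subtopology X (\<phi> ` open_disc_set d)) \<phi>"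
    "\<phi> ` bdry_disc_set d \<subseteq> \<Union>{\<psi> ` open_disc_set d' | d' \<psi>. (d', \<psi>) \<in> C \<and> d' < d}"
    if "(d, \<phi>) \<in> C" for d \<phi>
    using bspec[OF C that] by simp_all
  have "inj_on \<phi> (open_disc_set d)" if "(d, \<phi>) \<in> C" for d \<phi>
  proof -
    have "inj_on \<phi> (topspace (subtopology (Euclidean_space d) (open_disc_set d)))"
      using C(2)[OF that] by (rule homeomorphic_imp_injective_map)
    moreover have "open_disc_set d \<subseteq> topspace (Euclidean_space d)" by (auto simp: open_disc_set_def)
    ultimately show ?thesis by (simp add: Int_absorb1)
  qed
  moreover have "continuous_map (top_of_set (disc_set d)) X \<phi>" if "(d, \<phi>) \<in> C" for d \<phi>
    using C(1)[OF that] by (simp add: subtopology_Euclidean_space_disc)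
  moreover have "\<phi> ` bdry_disc_set d \<subseteq> \<Union>{\<psi> ` open_disc_set e | e \<psi>. (e, \<psi>) \<in> C \<and> e < d}"
    if "(d, \<phi>) \<in> C" for d \<phi> using C(3)[OF that] .
  moreover have "\<phi> ` open_disc_set d \<inter> \<psi> ` open_disc_set e = {}"
    if "(d, \<phi>) \<in> C" "(e, \<psi>) \<in> C" "(d, \<phi>) \<noteq> (e, \<psi>)" for d \<phi> e \<psi>
    using bspec[OF bspec[OF disj that(1)] that(2)] that(3) by simp
  ultimately interpret finite_cells X C b
    using \<open>Hausdorff_space X\<close> fin b cover by unfold_locales
  obtain d where d: "skel d = topspace X" using skel_all by blast
  obtain G V where "local_contraction X b (skel d) G V" using local_contraction_skel by blast
  then have G: "continuous_map (prod_topology X (top_of_set {0..1})) X G"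
    "\<And>x. x \<in> topspace X \<Longrightarrow> G (x, 0) = x" "\<And>t. t \<in> {0..1} \<Longrightarrow> G (b, t) = b"
    "openin X V" "b \<in> V" "\<And>x. x \<in> topspace X \<Longrightarrow> x \<in> V \<Longrightarrow> G (x, 1) = b"
    using b unfolding local_contraction_def d by auto
  define D where "D = (\<lambda>(x, t). G (x, max 0 (min 1 t)))"
  have "continuous_map (prod_topology X euclideanreal) (top_of_set {0..1}) (\<lambda>p. max 0 (min 1 (snd p)))"
    unfolding continuous_map_in_subtopology
    by (auto intro!: continuous_intros continuous_map_snd)
  then have "continuous_map (prod_topology X euclideanreal) (prod_topology X (top_of_set {0..1}))
      (\<lambda>p. (fst p, max 0 (min 1 (snd p))))"
    by (simp add: continuous_map_pairwise o_def continuous_map_fst)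
  from continuous_map_compose[OF this G(1)]
  have "continuous_map (prod_topology X euclideanreal) X D"
    by (simp add: D_def o_def case_prod_unfold)
  then show ?thesis
    using G openin_subset[OF G(4)] by (intro that[of D V]) (auto simp: D_def)
qed

section \<open>Pushing maps off the walls of a cubical grid\<close>

text \<open>The smallest closed face of the integer grid that contains \<open>x\<close>. A grid homotopy is stationary
  on faces that already go to \<open>b\<close>, so it does not enlarge a support that is a union of open cells.\<close>
definition carrier_cell :: "nat set \<Rightarrow> (nat \<Rightarrow> real) \<Rightarrow> (nat \<Rightarrow> real) set" where
  "carrier_cell S x = {y. \<forall>i\<in>S. of_int \<lfloor>x i\<rfloor> \<le> y i \<and> y i \<le> of_int \<lceil>x i\<rceil>}"

definition grid_homotopy :: "'a topology \<Rightarrow> 'a \<Rightarrow> nat set \<Rightarrow> ((nat \<Rightarrow> real) \<times> real \<Rightarrow> 'a) \<Rightarrow> bool" where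
  "grid_homotopy X b S \<Phi> \<longleftrightarrow> continuous_map euclidean X \<Phi> \<and> (\<forall>t. dep_on S (\<lambda>x. \<Phi> (x, t))) \<and>
     (\<forall>x. (\<forall>y\<in>carrier_cell S x. \<Phi> (y, 0) = b) \<longrightarrow> (\<forall>t. \<Phi> (x, t) = b))"

definition grid_homotopic ::
  "'a topology \<Rightarrow> 'a \<Rightarrow> nat set \<Rightarrow> ((nat \<Rightarrow> real) \<Rightarrow> 'a) \<Rightarrow> ((nat \<Rightarrow> real) \<Rightarrow> 'a) \<Rightarrow> bool" where
  "grid_homotopic X b S f g \<longleftrightarrow>
     (\<exists>\<Phi>. grid_homotopy X b S \<Phi> \<and> (\<forall>x. \<Phi> (x, 0) = f x) \<and> (\<forall>x. \<Phi> (x, 1) = g x))"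

lemma carrier_cell_self: "x \<in> carrier_cell S x"
  by (simp add: carrier_cell_def)

lemma carrier_cell_mono: "y \<in> carrier_cell S x \<Longrightarrow> carrier_cell S y \<subseteq> carrier_cell S x"
proof
  fix z assume y: "y \<in> carrier_cell S x" and z: "z \<in> carrier_cell S y"
  have "of_int \<lfloor>x i\<rfloor> \<le> z i \<and> z i \<le> of_int \<lceil>x i\<rceil>" if i: "i \<in> S" for i
  proof -
    have yi: "of_int \<lfloor>x i\<rfloor> \<le> y i" "y i \<le> of_int \<lceil>x i\<rceil>" and zi: "of_int \<lfloor>y i\<rfloor> \<le> z i" "z i \<le> of_int \<lceil>y i\<rceil>"
      using y z i by (auto simp: carrier_cell_def)
    have "\<lfloor>x i\<rfloor> \<le> \<lfloor>y i\<rfloor>" using yi(1) by (simp add: le_floor_iff)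
    moreover have "\<lceil>y i\<rceil> \<le> \<lceil>x i\<rceil>" using yi(2) by (simp add: ceiling_le_iff)
    ultimately show ?thesis using zi by (meson of_int_le_iff order_trans)
  qed
  then show "z \<in> carrier_cell S x" by (simp add: carrier_cell_def)
qed

lemma continuous_map_slice:
  assumes "continuous_map euclidean X (\<Phi> :: (nat \<Rightarrow> real) \<times> real \<Rightarrow> 'a)"
  shows "continuous_map euclidean X (\<lambda>x. \<Phi> (x, t))"
  by (intro continuous_map_euclidean_compose[OF assms] continuous_intros)

lemma grid_homotopic_target:
  assumes "grid_homotopic X b S f g"
  shows "continuous_map euclidean X g" "dep_on S g"
proof -
  obtain \<Phi> where \<Phi>: "grid_homotopy X b S \<Phi>" "\<And>x. \<Phi> (x, 1) = g x"
    using assms by (auto simp: grid_homotopic_def)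
  then have "g = (\<lambda>x. \<Phi> (x, 1))" by auto
  then show "continuous_map euclidean X g" "dep_on S g"
    using \<Phi>(1) continuous_map_slice by (auto simp: grid_homotopy_def)
qed

lemma grid_homotopic_static:
  assumes "grid_homotopic X b S f g" "\<And>y. y \<in> carrier_cell S x \<Longrightarrow> f y = b"
  shows "g x = b"
  using assms unfolding grid_homotopic_def grid_homotopy_def by metis

lemma grid_homotopic_refl:
  assumes "continuous_map euclidean X f" "dep_on S f"
  shows "grid_homotopic X b S f f"
proof -
  have "continuous_map euclidean X (\<lambda>p :: (nat \<Rightarrow> real) \<times> real. f (fst p))"
    by (rule continuous_map_euclidean_compose[OF assms(1) continuous_on_fst_UNIV])
  then have "grid_homotopy X b S (\<lambda>p. f (fst p))"
    using assms(2) carrier_cell_self by (auto simp: grid_homotopy_def)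
  then show ?thesis unfolding grid_homotopic_def by (intro exI[of _ "\<lambda>p. f (fst p)"]) simp
qed

lemma continuous_map_concat:
  fixes \<Phi> \<Psi> :: "'w::topological_space \<times> real \<Rightarrow> 'a"
  assumes "continuous_map euclidean X \<Phi>" "continuous_map euclidean X \<Psi>" "\<And>x. \<Phi> (x, 1) = \<Psi> (x, 0)"
  shows "continuous_map euclidean X (\<lambda>p. if snd p \<le> 1/2 then \<Phi> (fst p, 2 * snd p) else \<Psi> (fst p, 2 * snd p - 1))"
proof (rule continuous_map_cases_le)
  have s: "continuous_on UNIV (snd :: 'w \<times> real \<Rightarrow> real)" using continuous_on_snd[OF continuous_on_id] by simp
  then show "continuous_map euclidean euclideanreal (snd :: 'w \<times> real \<Rightarrow> real)" by simp
  show "continuous_map euclidean euclideanreal (\<lambda>p :: 'w \<times> real. 1/2)" by simp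
  have "continuous_map euclidean X (\<lambda>p. \<Phi> (fst p, 2 * snd p))"
    by (intro continuous_map_euclidean_compose[OF assms(1)] continuous_intros)
  then show "continuous_map (subtopology euclidean {x \<in> topspace euclidean. snd x \<le> 1 / 2}) X (\<lambda>p. \<Phi> (fst p, 2 * snd p))"
    by (rule continuous_map_from_subtopology)
  have "continuous_map euclidean X (\<lambda>p. \<Psi> (fst p, 2 * snd p - 1))"
    by (intro continuous_map_euclidean_compose[OF assms(2)] continuous_intros)
  then show "continuous_map (subtopology euclidean {x \<in> topspace euclidean. 1 / 2 \<le> snd x}) X (\<lambda>p. \<Psi> (fst p, 2 * snd p - 1))"
    by (rule continuous_map_from_subtopology)
  show "\<Phi> (fst p, 2 * snd p) = \<Psi> (fst p, 2 * snd p - 1)" if "snd p = 1/2" for p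
  proof -
    have "2 * snd p = 1" "2 * snd p - 1 = 0" using that by simp_all
    then show ?thesis using assms(3) by (simp only:)
  qed
qed

text \<open>Stationarity survives concatenation: each point of the carrier of \<open>x\<close> has
  its own carrier inside it, so if \<open>f\<close> is trivial on the carrier of \<open>x\<close>,
  the intermediate map is trivial there too, and the second homotopy is stationary as well.\<close>

lemma grid_homotopic_trans:
  assumes "grid_homotopic X b S f g" "grid_homotopic X b S g h"
  shows "grid_homotopic X b S f h"
proof -
  obtain \<Phi> where \<Phi>: "grid_homotopy X b S \<Phi>" "\<And>x. \<Phi> (x, 0) = f x" "\<And>x. \<Phi> (x, 1) = g x"
    using assms(1) by (auto simp: grid_homotopic_def)
  obtain \<Psi> where \<Psi>: "grid_homotopy X b S \<Psi>" "\<And>x. \<Psi> (x, 0) = g x" "\<And>x. \<Psi> (x, 1) = h x"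
    using assms(2) by (auto simp: grid_homotopic_def)
  define \<Theta> where "\<Theta> = (\<lambda>p. if snd p \<le> 1/2 then \<Phi> (fst p, 2 * snd p) else \<Psi> (fst p, 2 * snd p - 1))"
  have "continuous_map euclidean X \<Theta>" unfolding \<Theta>_def
    using \<Phi> \<Psi> by (intro continuous_map_concat) (auto simp: grid_homotopy_def)
  moreover have "dep_on S (\<lambda>x. \<Theta> (x, t))" for t
    using \<Phi>(1) \<Psi>(1) by (cases "t \<le> 1/2") (simp_all add: \<Theta>_def grid_homotopy_def)
  moreover have "\<Theta> (x, t) = b" if *: "\<forall>y\<in>carrier_cell S x. \<Theta> (y, 0) = b" for x t
  proof -
    have f: "f y = b" if "y \<in> carrier_cell S x" for y using * that \<Phi>(2) by (simp add: \<Theta>_def)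
    have "\<Phi> (x, t) = b" for t using f \<Phi> by (simp add: grid_homotopy_def)
    moreover have "g y = b" if "y \<in> carrier_cell S x" for y
      using f carrier_cell_mono[OF that] by (intro grid_homotopic_static[OF assms(1)]) auto
    then have "\<Psi> (x, t) = b" for t using \<Psi> by (simp add: grid_homotopy_def)
    ultimately show ?thesis by (simp add: \<Theta>_def)
  qed
  ultimately have "grid_homotopy X b S \<Theta>" by (simp add: grid_homotopy_def)
  then show ?thesis unfolding grid_homotopic_def
    using \<Phi> \<Psi> by (intro exI[of _ \<Theta>]) (simp add: \<Theta>_def)
qed

text \<open>Pasting over an open cover, with local pieces that are globally defined continuous maps.
  The explicit formulas around a grid slice are of this kind, and no restriction to subspaces is
  involved.\<close>

lemma continuous_map_locally:
  assumes "\<And>w. w \<in> topspace W \<Longrightarrow> \<exists>T L. openin W T \<and> w \<in> T \<and> continuous_map W X L \<and> (\<forall>v\<in>T. f v = L v)"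
  shows "continuous_map W X f"
  unfolding continuous_map_def
proof (intro conjI allI impI funcsetI)
  show "f w \<in> topspace X" if w: "w \<in> topspace W" for w
  proof -
    obtain T L where "w \<in> T" "continuous_map W X L" "\<forall>v\<in>T. f v = L v" using assms[OF w] by blast
    then show ?thesis using w by (auto simp: continuous_map_def)
  qed
  fix U assume U: "openin X U"
  show "openin W {w \<in> topspace W. f w \<in> U}"
  proof (intro iffD2[OF openin_subopen] ballI)
    fix w assume w: "w \<in> {w \<in> topspace W. f w \<in> U}"
    then obtain T L where T: "openin W T" "w \<in> T" and L: "continuous_map W X L" "\<forall>v\<in>T. f v = L v"
      using assms[of w] by blast
    have "openin W (T \<inter> {w \<in> topspace W. L w \<in> U})"
      by (intro openin_Int T openin_continuous_map_preimage[OF L(1) U])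
    moreover have "T \<inter> {w \<in> topspace W. L w \<in> U} \<subseteq> {w \<in> topspace W. f w \<in> U}" using L(2) by auto
    moreover have "w \<in> T \<inter> {w \<in> topspace W. L w \<in> U}" using L(2) T(2) w by auto
    ultimately show "\<exists>T. openin W T \<and> w \<in> T \<and> T \<subseteq> {w \<in> topspace W. f w \<in> U}" by blast
  qed
qed

text \<open>For t \<ge> 0 this is the shrinkage operator: it collapses [-t, t] to 0 and shifts both
  outer rays inward by t. It closes the gap opened by the fillings.\<close>

definition soft_threshold :: "real \<Rightarrow> real \<Rightarrow> real" where
  "soft_threshold z t = max (z - t) 0 + min (z + t) 0"

text \<open>Each slice \<open>x\<^sub>i = q\<close> is null homotopic. At time \<open>t\<close> the slab between two slices is stretched by the
  factor \<open>1 + 2t\<close>, and the two ends that stick out by \<open>t\<close> are filled with the null homotopies.\<close>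
lemma grid_homotopic_hyperplanes:
  assumes i: "i \<in> S" and f: "continuous_map euclidean X f" "dep_on S f"
    and slices: "\<And>h. continuous_map euclidean X h \<Longrightarrow> dep_on (S - {i}) h \<Longrightarrow> grid_homotopic X b (S - {i}) h (\<lambda>_. b)"
  shows "\<exists>g. grid_homotopic X b S f g \<and> (\<forall>x. x i \<in> \<int> \<longrightarrow> g x = b)"
proof -
  define fs where "fs q = (\<lambda>x. f (x(i := of_int q)))" for q :: int
  have "grid_homotopic X b (S - {i}) (fs q) (\<lambda>_. b)" for q
  proof (rule slices)
    show "continuous_map euclidean X (fs q)"
      unfolding fs_def by (intro continuous_map_euclidean_compose[OF f(1)] continuous_on_fun_upd continuous_intros)
    show "dep_on (S - {i}) (fs q)"
      using f(2) unfolding dep_on_def fs_def by (metis DiffI empty_iff fun_upd_apply insert_iff)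
  qed
  then obtain \<Psi> where \<Psi>: "\<And>q. grid_homotopy X b (S - {i}) (\<Psi> q)" "\<And>q x. \<Psi> q (x, 0) = fs q x" "\<And>q x. \<Psi> q (x, 1) = b"
    unfolding grid_homotopic_def by metis
  define cl where "cl t = max 0 (min 1 t)" for t :: real
  have cl: "0 \<le> cl t" "cl t \<le> 1" for t by (auto simp: cl_def)
  \<comment> \<open>The formula centred at the slice with \<open>x i = q\<close>. Where the
    stretched offset is at most the time c, the null homotopy is shown at time c minus that offset,
    so it starts with \<open>f\<close> at the outer end and has reached time c on the slice.\<close>
  define L where "L q = (\<lambda>(x, t). if (1 + 2 * cl t) * \<bar>x i - of_int q\<bar> \<le> cl t
      then \<Psi> q (x, cl t - (1 + 2 * cl t) * \<bar>x i - of_int q\<bar>)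
      else f (x(i := of_int q + soft_threshold ((1 + 2 * cl t) * (x i - of_int q)) (cl t))))" for q :: int
  define \<Phi> where "\<Phi> = (\<lambda>(x, t). L (round (x i)) (x, t))"
  have contL: "continuous_map euclidean X (L q)" for q
  proof -
    have ccl: "continuous_on UNIV (\<lambda>p :: (nat \<Rightarrow> real) \<times> real. cl (snd p))"
      unfolding cl_def by (intro continuous_intros)
    let ?m = "\<lambda>p :: (nat \<Rightarrow> real) \<times> real. (1 + 2 * cl (snd p)) * \<bar>fst p i - of_int q\<bar>"
    have "continuous_map euclidean X (\<lambda>p. if ?m p \<le> cl (snd p) then \<Psi> q (fst p, cl (snd p) - ?m p)
        else f ((fst p)(i := of_int q + soft_threshold ((1 + 2 * cl (snd p)) * (fst p i - of_int q)) (cl (snd p)))))"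
    proof (rule continuous_map_cases_le)
      have "continuous_on UNIV ?m" by (intro continuous_intros ccl)
      then show "continuous_map euclidean euclideanreal ?m" by simp
      show "continuous_map euclidean euclideanreal (\<lambda>p :: (nat \<Rightarrow> real) \<times> real. cl (snd p))" using ccl by simp
      have "continuous_map euclidean X (\<Psi> q)" using \<Psi>(1) by (simp add: grid_homotopy_def)
      then have "continuous_map euclidean X (\<lambda>p. \<Psi> q (fst p, cl (snd p) - ?m p))"
        by (rule continuous_map_euclidean_compose) (intro continuous_intros ccl continuous_on_fst_UNIV)
      then show "continuous_map (subtopology euclidean {x \<in> topspace euclidean. ?m x \<le> cl (snd x)}) X
          (\<lambda>p. \<Psi> q (fst p, cl (snd p) - ?m p))" by (rule continuous_map_from_subtopology)
      have "continuous_map euclidean X (\<lambda>p. f ((fst p)(i := of_int q +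
          soft_threshold ((1 + 2 * cl (snd p)) * (fst p i - of_int q)) (cl (snd p)))))"
        unfolding soft_threshold_def
        by (intro continuous_map_euclidean_compose[OF f(1)] continuous_on_fun_upd continuous_on_fst_UNIV continuous_intros ccl)
      then show "continuous_map (subtopology euclidean {x \<in> topspace euclidean. cl (snd x) \<le> ?m x}) X
          (\<lambda>p. f ((fst p)(i := of_int q + soft_threshold ((1 + 2 * cl (snd p)) * (fst p i - of_int q)) (cl (snd p)))))"
        by (rule continuous_map_from_subtopology)
      fix p :: "(nat \<Rightarrow> real) \<times> real" assume p: "?m p = cl (snd p)"
      define z where "z = (1 + 2 * cl (snd p)) * (fst p i - of_int q)"
      have "\<bar>z\<bar> = cl (snd p)" using p cl(1)[of "snd p"] by (simp add: z_def abs_mult)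
      then have "soft_threshold z (cl (snd p)) = 0" by (auto simp: soft_threshold_def max_def min_def)
      then show "\<Psi> q (fst p, cl (snd p) - ?m p) =
          f ((fst p)(i := of_int q + soft_threshold ((1 + 2 * cl (snd p)) * (fst p i - of_int q)) (cl (snd p))))"
        using p \<Psi>(2) by (simp add: fs_def z_def)
    qed
    then show ?thesis by (simp add: L_def case_prod_unfold)
  qed
  \<comment> \<open>At time c the filling reaches out to c / (1 + 2 c), which is at most 1/3. On the
    middle third both formulas therefore reduce to \<open>f\<close> at the same shifted
    position.\<close>
  have L_agree: "L q (x, t) = L (q + 1) (x, t)"
    if u: "1/3 < x i - of_int q" "x i - of_int q < 2/3" for q x t
  proof -
    define u c where "u = x i - of_int q" and "c = cl t"
    have c: "0 \<le> c" "c \<le> 1" using cl by (auto simp: c_def)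
    have 1: "(1 + 2 * c) * u > c"
    proof -
      have "c \<le> (1 + 2 * c) * (1/3)" using c by simp
      also have "\<dots> < (1 + 2 * c) * u" using u c by (intro mult_strict_left_mono) (auto simp: u_def)
      finally show ?thesis .
    qed
    have 2: "(1 + 2 * c) * (1 - u) > c"
    proof -
      have "c \<le> (1 + 2 * c) * (1/3)" using c by simp
      also have "\<dots> < (1 + 2 * c) * (1 - u)" using u c by (intro mult_strict_left_mono) (auto simp: u_def)
      finally show ?thesis .
    qed
    have q1: "x i - of_int (q + 1) = - (1 - u)" by (simp add: u_def)
    have "L q (x, t) = f (x(i := of_int q + ((1 + 2 * c) * u - c)))"
      using 1 u c by (simp add: L_def soft_threshold_def flip: u_def c_def)
    moreover have "L (q + 1) (x, t) = f (x(i := of_int (q + 1) + (c - (1 + 2 * c) * (1 - u))))"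
    proof -
      have "\<not> (1 + 2 * c) * \<bar>- (1 - u)\<bar> \<le> c" using 2 u by (simp add: u_def)
      moreover have "soft_threshold ((1 + 2 * c) * (- (1 - u))) c = c - (1 + 2 * c) * (1 - u)"
      proof -
        have m: "(1 + 2 * c) * (- (1 - u)) = - ((1 + 2 * c) * (1 - u))" by (rule mult_minus_right)
        show ?thesis unfolding m soft_threshold_def using 2 c by linarith
      qed
      ultimately show ?thesis unfolding L_def split c_def[symmetric] q1 by simp
    qed
    moreover have "of_int (q + 1) + (c - (1 + 2 * c) * (1 - u)) = of_int q + ((1 + 2 * c) * u - c)"
      by (simp add: algebra_simps)
    ultimately show ?thesis by (simp only:)
  qed
  \<comment> \<open>Rounding leaves an error of at most 1/2, so two admissible centres differ by at
    most 1, and when they differ the point lies in the middle third. The bound 2/3 makes the domains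
    of the formulas open and overlapping.\<close>
  have \<Phi>_local: "\<Phi> (x, t) = L q (x, t)" if q: "\<bar>x i - of_int q\<bar> < 2/3" for q x t
  proof -
    define r where "r = round (x i)"
    have r: "\<bar>x i - of_int r\<bar> \<le> 1/2" using of_int_round_abs_le[of "x i"] by (simp add: r_def abs_minus_commute)
    have "\<bar>of_int q - of_int r :: real\<bar> < 2" using q r by linarith
    then have "\<bar>q - r\<bar> < 2" by linarith
    then consider "q = r" | "r = q + 1" | "q = r + 1" by linarith
    then have "L r (x, t) = L q (x, t)"
    proof cases
      case 2
      then show ?thesis using L_agree[of x q t] q r by simp
    next
      case 3
      then show ?thesis using L_agree[of x r t] q r by simp
    qed simp
    then show ?thesis by (simp add: \<Phi>_def r_def)
  qed
  have "continuous_map euclidean X \<Phi>"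
  proof (rule continuous_map_locally)
    fix p :: "(nat \<Rightarrow> real) \<times> real"
    define T where "T = {v :: (nat \<Rightarrow> real) \<times> real. \<bar>fst v i - of_int (round (fst p i))\<bar> < 2/3}"
    have "open T" unfolding T_def by (intro open_Collect_less continuous_intros)
    moreover have "p \<in> T"
      using of_int_round_abs_le[of "fst p i"] by (simp add: T_def abs_minus_commute)
    ultimately show "\<exists>T L. openin euclidean T \<and> p \<in> T \<and> continuous_map euclidean X L \<and> (\<forall>v\<in>T. \<Phi> v = L v)"
      using contL \<Phi>_local by (intro exI[of _ T] exI[of _ "L (round (fst p i))"]) (auto simp: T_def)
  qed
  moreover have "dep_on S (\<lambda>x. \<Phi> (x, t))" for t
    unfolding dep_on_def
  proof (intro allI impI)
    fix x y :: "nat \<Rightarrow> real" assume xy: "\<forall>k\<in>S. x k = y k"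
    have "x i = y i" using xy i by simp
    moreover have "\<Psi> q (x, s) = \<Psi> q (y, s)" for q s
      using \<Psi>(1)[of q] xy by (auto simp: grid_homotopy_def dep_on_def)
    moreover have "f (x(i := s)) = f (y(i := s))" for s using f(2) xy by (auto elim!: dep_onD)
    ultimately show "\<Phi> (x, t) = \<Phi> (y, t)" by (simp add: \<Phi>_def L_def)
  qed
  moreover have \<Phi>0: "\<Phi> (x, 0) = f x" for x
  proof -
    have cl0: "cl 0 = 0" by (simp add: cl_def)
    have "soft_threshold z 0 = z" for z by (simp add: soft_threshold_def)
    moreover have "x(i := x i) = x" by simp
    moreover have "fs (round (x i)) x = f x" if "x i = of_int (round (x i))"
      using that \<open>x(i := x i) = x\<close> by (metis fs_def)
    ultimately show ?thesis using \<Psi>(2) by (simp add: \<Phi>_def L_def cl0)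
  qed
  moreover have "\<Phi> (x, t) = b" if fb: "\<forall>y\<in>carrier_cell S x. \<Phi> (y, 0) = b" for x t
  proof -
    have fb: "f y = b" if "y \<in> carrier_cell S x" for y using fb that \<Phi>0 by simp
    have inside: "y(i := s) \<in> carrier_cell S x"
      if "y \<in> carrier_cell (S - {i}) x" "of_int \<lfloor>x i\<rfloor> \<le> s" "s \<le> of_int \<lceil>x i\<rceil>" for y s
      using that by (auto simp: carrier_cell_def)
    define r where "r = round (x i)"
    have r: "\<lfloor>x i\<rfloor> \<le> r" "r \<le> \<lceil>x i\<rceil>" by (simp_all add: r_def floor_le_round ceiling_ge_round)
    have r2: "\<bar>x i - of_int r\<bar> \<le> 1/2" using of_int_round_abs_le[of "x i"] by (simp add: r_def abs_minus_commute)
    define c u where "c = cl t" and "u = x i - of_int r"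
    have c: "0 \<le> c" "c \<le> 1" using cl by (auto simp: c_def)
    have u: "u \<le> 1/2" "- 1/2 \<le> u" using r2 unfolding u_def by linarith+
    show ?thesis
    proof (cases "(1 + 2 * c) * \<bar>u\<bar> \<le> c")
      case True
      have "\<forall>y\<in>carrier_cell (S - {i}) x. \<Psi> r (y, 0) = b"
        using \<Psi>(2) fb inside r by (simp add: fs_def)
      then have "\<Psi> r (x, s) = b" for s using \<Psi>(1)[of r] unfolding grid_homotopy_def by blast
      then show ?thesis using True by (simp add: \<Phi>_def L_def r_def c_def u_def)
    next
      case False
      \<comment> \<open>The shifted position stays in the unit interval of the grid around
        \<open>x i\<close>; hence \<open>f\<close> is evaluated inside the carrier of
        \<open>x\<close>.\<close>
      define v where "v = of_int r + soft_threshold ((1 + 2 * c) * u) c"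
      have "of_int \<lfloor>x i\<rfloor> \<le> v \<and> v \<le> of_int \<lceil>x i\<rceil>"
      proof (cases "u > 0")
        case True
        have *: "c < (1 + 2 * c) * u" using False True by simp
        have "(1 + 2 * c) * u \<le> (1 + 2 * c) * (1/2)" using u c by (intro mult_left_mono) auto
        also have "\<dots> = 1/2 + c" by simp
        finally have "(1 + 2 * c) * u - c \<le> 1" by linarith
        moreover have "v = of_int r + ((1 + 2 * c) * u - c)" unfolding v_def soft_threshold_def using * c by linarith
        moreover have "\<lceil>x i\<rceil> = r + 1" using True u by (intro ceiling_unique) (auto simp: u_def)
        moreover have "\<lfloor>x i\<rfloor> = r" using True u by (intro floor_unique) (auto simp: u_def)
        ultimately show ?thesis using * by (simp del: ring_distribs)
      next
        case nu: False
        have "u \<noteq> 0" using False c by auto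
        then have neg: "u < 0" using nu by simp
        have *: "(1 + 2 * c) * u < - c" using False neg by simp
        have "- 1/2 - c = (1 + 2 * c) * (- 1/2)" by (simp add: field_simps)
        also have "\<dots> \<le> (1 + 2 * c) * u" using u c by (intro mult_left_mono) auto
        finally have "- 1 \<le> (1 + 2 * c) * u + c" by linarith
        moreover have "v = of_int r + ((1 + 2 * c) * u + c)" unfolding v_def soft_threshold_def using * c by linarith
        moreover have "\<lceil>x i\<rceil> = r" using neg u by (intro ceiling_unique) (auto simp: u_def)
        moreover have "\<lfloor>x i\<rfloor> = r - 1" using neg u by (intro floor_unique) (auto simp: u_def)
        ultimately show ?thesis using * by (simp del: ring_distribs)
      qed
      then have "x(i := v) \<in> carrier_cell S x" by (intro inside carrier_cell_self) auto
      then show ?thesis using False fb by (simp add: \<Phi>_def L_def r_def c_def u_def v_def)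
    qed
  qed
  ultimately have "grid_homotopy X b S \<Phi>" unfolding grid_homotopy_def by blast
  moreover have "\<Phi> (x, 1) = b" if "x i \<in> \<int>" for x
  proof -
    obtain m where "x i = of_int m" using \<open>x i \<in> \<int>\<close> by (auto elim: Ints_cases)
    then show ?thesis using \<Psi>(3) by (simp add: \<Phi>_def L_def cl_def)
  qed
  ultimately show ?thesis using \<Phi>0 unfolding grid_homotopic_def
    by (intro exI[of _ "\<lambda>x. \<Phi> (x, 1)"]) blast
qed

text \<open>Directions are cleared one at a time. A wall cleared earlier is not spoilt, because the
  carrier of a point on it lies in that wall and a grid homotopy is stationary where the map is
  trivial on the carrier.\<close>

lemma grid_homotopic_skeleton:
  assumes S: "finite S" and f: "continuous_map euclidean X f" "dep_on S f"
    and slices: "\<And>i h. i \<in> S \<Longrightarrow> continuous_map euclidean X h \<Longrightarrow> dep_on (S - {i}) h \<Longrightarrow>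
      grid_homotopic X b (S - {i}) h (\<lambda>_. b)"
  shows "\<exists>g. grid_homotopic X b S f g \<and> (\<forall>x. (\<exists>i\<in>S. x i \<in> \<int>) \<longrightarrow> g x = b)"
proof -
  have "\<exists>g. grid_homotopic X b S f g \<and> (\<forall>x. (\<exists>i\<in>T. x i \<in> \<int>) \<longrightarrow> g x = b)" if "finite T" "T \<subseteq> S" for T
    using that
  proof (induction T)
    case empty
    then show ?case using grid_homotopic_refl[OF f] by blast
  next
    case (insert i T)
    then have i: "i \<in> S" and "T \<subseteq> S" by auto
    from insert.IH[OF this(2)]
    obtain g where g: "grid_homotopic X b S f g" "\<forall>x. (\<exists>k\<in>T. x k \<in> \<int>) \<longrightarrow> g x = b" by blast
    obtain h where h: "grid_homotopic X b S g h" "\<forall>x. x i \<in> \<int> \<longrightarrow> h x = b"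
      using grid_homotopic_hyperplanes[OF i grid_homotopic_target[OF g(1)] slices[OF i]] by blast
    have "h x = b" if k: "k \<in> T" "x k \<in> \<int>" for x k
    proof (rule grid_homotopic_static[OF h(1)])
      fix y assume y: "y \<in> carrier_cell S x"
      have "k \<in> S" using k \<open>T \<subseteq> S\<close> by blast
      obtain m where "x k = of_int m" using k(2) by (auto elim: Ints_cases)
      moreover have "of_int \<lfloor>x k\<rfloor> \<le> y k" "y k \<le> of_int \<lceil>x k\<rceil>"
        using y \<open>k \<in> S\<close> unfolding carrier_cell_def by blast+
      ultimately have "y k = x k" by simp
      then have "y k \<in> \<int>" using k(2) by simp
      then show "g y = b" using g(2) k(1) by blast
    qed
    then have "\<forall>x. (\<exists>k\<in>insert i T. x k \<in> \<int>) \<longrightarrow> h x = b" using h(2) by blast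
    then show ?case using grid_homotopic_trans[OF g(1) h(1)] by blast
  qed
  then show ?thesis using S by blast
qed

section \<open>Contracting grid cells by vanishing homotopy groups\<close>

lemma is_singleton_homotopy_group_cube_homotopic:
  assumes "is_singleton (homotopy_group m X b)" "b \<in> topspace X" "cube_map m X b f" "cube_map m X b g"
  shows "cube_homotopic m X b f g"
proof -
  obtain f' where f': "f' \<in> based_maps m X b" "\<And>x. f' (cube_to_sphere m x) = f x"
    using cube_map_imp_based_map[OF assms(3,2)] by blast
  obtain g' where g': "g' \<in> based_maps m X b" "\<And>x. g' (cube_to_sphere m x) = g x"
    using cube_map_imp_based_map[OF assms(4,2)] by blast
  have "hclass m X b f' \<in> homotopy_group m X b" "hclass m X b g' \<in> homotopy_group m X b"
    using f' g' by (auto simp: homotopy_group_def)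
  then have "hclass m X b f' = hclass m X b g'" using assms(1) by (auto elim!: is_singletonE)
  moreover have "g' \<in> hclass m X b g'" using g'(1) by (auto simp: hclass_def based_maps_def)
  ultimately have "g' \<in> hclass m X b f'" by simp
  then have "homotopic_with (\<lambda>h. h sphere_base = b) (nsphere m) X f' g'" by (simp add: hclass_def)
  from homotopic_imp_cube_homotopic[OF this] show ?thesis using f' g' by simp
qed

text \<open>An enumeration of \<open>S\<close> and the translation by \<open>z\<close> identify the
  cell with the standard cube of dimension \<open>card S\<close>, where the triviality of the
  homotopy group applies.\<close>

lemma null_homotopy_on_cell:
  assumes X: "is_singleton (homotopy_group (card S) X b)" "b \<in> topspace X" and S: "finite S"
    and g: "continuous_map euclidean X g" "dep_on S g"
    and supp: "\<And>x i. i \<in> S \<Longrightarrow> x i \<notin> {z i<..<z i + 1} \<Longrightarrow> g x = b"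
  shows "\<exists>H. continuous_map euclidean X H \<and> (\<forall>t. dep_on S (\<lambda>x. H (x, t))) \<and> (\<forall>x. H (x, 0 :: real) = g x) \<and>
    (\<forall>x. H (x, 1) = b) \<and> (\<forall>x t. (\<exists>i\<in>S. x i \<notin> {z i<..<z i + 1}) \<longrightarrow> H (x, t) = b)"
proof -
  define m where "m = card S"
  obtain e where e: "bij_betw e {..<m} S" using ex_bij_betw_nat_finite[OF S] by (auto simp: m_def atLeast0LessThan)
  define e' where "e' = inv_into {..<m} e"
  have e': "e' i < m" "e (e' i) = i" if "i \<in> S" for i
    using bij_betw_inv_into_right[OF e that] bij_betwE[OF bij_betw_inv_into[OF e]] that by (auto simp: e'_def)
  have eS: "e k \<in> S" "e' (e k) = k" if "k < m" for k
    using bij_betwE[OF e] bij_betw_inv_into_left[OF e] that by (auto simp: e'_def)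
  define \<alpha> where "\<alpha> y = (\<lambda>i. if i \<in> S then z i + y (e' i) else 0)" for y :: "nat \<Rightarrow> real"
  define \<beta> where "\<beta> x = (\<lambda>k. if k < m then x (e k) - z (e k) else 0)" for x :: "nat \<Rightarrow> real"
  have c\<alpha>: "continuous_on UNIV \<alpha>"
  proof (rule continuous_on_coordinatewise_then_product)
    show "continuous_on UNIV (\<lambda>y. \<alpha> y i)" for i
      by (cases "i \<in> S") (auto simp: \<alpha>_def intro!: continuous_intros)
  qed
  have c\<beta>: "continuous_on UNIV \<beta>"
  proof (rule continuous_on_coordinatewise_then_product)
    show "continuous_on UNIV (\<lambda>x. \<beta> x k)" for k
      by (cases "k < m") (auto simp: \<beta>_def intro!: continuous_intros)
  qed
  have "cube_map m X b (\<lambda>y. g (\<alpha> y))"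
    unfolding cube_map_def
  proof (intro conjI allI impI continuous_map_euclidean_compose[OF g(1) c\<alpha>])
    show "dep_on {..<m} (\<lambda>y. g (\<alpha> y))"
      unfolding dep_on_def by (auto intro!: dep_onD[OF g(2)] simp: \<alpha>_def e')
    show "g (\<alpha> y) = b" if ex: "\<exists>k<m. y k \<notin> {0<..<1}" for y
    proof -
      obtain k where k: "k < m" "y k \<notin> {0<..<1}" using ex by blast
      then have "\<alpha> y (e k) \<notin> {z (e k)<..<z (e k) + 1}" using eS[OF k(1)] by (simp add: \<alpha>_def)
      then show ?thesis using supp eS[OF k(1)] by blast
    qed
  qed
  moreover have "cube_map m X b (\<lambda>_. b)" using X(2) by (simp add: cube_map_def dep_on_def)
  ultimately have "cube_homotopic m X b (\<lambda>y. g (\<alpha> y)) (\<lambda>_. b)"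
    using X by (intro is_singleton_homotopy_group_cube_homotopic) (simp_all add: m_def)
  then obtain \<Phi> where \<Phi>: "cube_homotopy m X b \<Phi>" "\<And>y. \<Phi> (y, 0) = g (\<alpha> y)" "\<And>y. \<Phi> (y, 1) = b"
    unfolding cube_homotopic_def by blast
  then have \<Phi>2: "continuous_map euclidean X \<Phi>" "\<And>t. dep_on {..<m} (\<lambda>x. \<Phi> (x, t))"
    "\<And>x t k. k < m \<Longrightarrow> x k \<notin> {0<..<1} \<Longrightarrow> \<Phi> (x, t) = b"
    unfolding cube_homotopy_def cube_map_def by blast+
  show ?thesis
  proof (intro exI[of _ "\<lambda>p. \<Phi> (\<beta> (fst p), snd p)"] conjI allI impI)
    show "continuous_map euclidean X (\<lambda>p. \<Phi> (\<beta> (fst p), snd p))"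
      by (intro continuous_map_euclidean_compose[OF \<Phi>2(1)] continuous_intros
          continuous_on_compose2[OF c\<beta> continuous_on_fst_UNIV]) auto
    show "dep_on S (\<lambda>x. \<Phi> (\<beta> (fst (x, t)), snd (x, t)))" for t
      unfolding dep_on_def by (auto intro!: dep_onD[OF \<Phi>2(2)] simp: \<beta>_def eS)
    show "\<Phi> (\<beta> (fst (x, 0)), snd (x, 0 :: real)) = g x" for x
    proof -
      have "g (\<alpha> (\<beta> x)) = g x" by (rule dep_onD[OF g(2)]) (simp add: \<alpha>_def \<beta>_def e')
      then show ?thesis using \<Phi>(2) by simp
    qed
    show "\<Phi> (\<beta> (fst (x, 1)), snd (x, 1 :: real)) = b" for x using \<Phi>(3) by simp
    show "\<Phi> (\<beta> (fst (x, t)), snd (x, t)) = b" if ex: "\<exists>i\<in>S. x i \<notin> {z i<..<z i + 1}" for x t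
    proof -
      obtain i where i: "i \<in> S" "x i \<notin> {z i<..<z i + 1}" using ex by blast
      then have "\<beta> x (e' i) \<notin> {0<..<1}" using e'[OF i(1)] by (auto simp: \<beta>_def)
      then show ?thesis using \<Phi>2(3) e'(1)[OF i(1)] by simp
    qed
  qed
qed

text \<open>Triviality on the walls splits \<open>f\<close> into cube maps on the unit cells. These
  contract independently, and the contractions never meet, each being supported in its own open
  cell.\<close>

lemma grid_homotopic_cells:
  assumes X: "is_singleton (homotopy_group (card S) X b)" "b \<in> topspace X" and S: "finite S"
    and f: "continuous_map euclidean X f" "dep_on S f" and skel: "\<And>x i. i \<in> S \<Longrightarrow> x i \<in> \<int> \<Longrightarrow> f x = b"
  shows "grid_homotopic X b S f (\<lambda>_. b)"
proof -
  \<comment> \<open>The nearest point retraction onto the closed cell \<open>z\<close>. Points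
    outside the open cell land on a wall, so composition with it is the restriction of
    \<open>f\<close> to the cell, extended by \<open>b\<close>.\<close>
  define cl where "cl z x = (\<lambda>i. if i \<in> S then max (of_int (z i)) (min (of_int (z i) + 1) (x i)) else x i)"
    for z :: "nat \<Rightarrow> int" and x :: "nat \<Rightarrow> real"
  have ccl: "continuous_on UNIV (cl z)" for z
  proof (rule continuous_on_coordinatewise_then_product)
    show "continuous_on UNIV (\<lambda>y. cl z y i)" for i
      by (cases "i \<in> S") (auto simp: cl_def intro!: continuous_intros)
  qed
  define fz where "fz z x = f (cl z x)" for z x
  have fz_inside: "fz z x = f x" if "\<And>i. i \<in> S \<Longrightarrow> x i \<in> {of_int (z i)<..<of_int (z i) + 1}" for z x
    unfolding fz_def by (rule dep_onD[OF f(2)]) (use that in \<open>force simp: cl_def\<close>)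
  have fz_outside: "fz z x = b" if "i \<in> S" "x i \<notin> {of_int (z i)<..<of_int (z i) + 1}" for z x i
  proof -
    have "cl z x i = of_int (z i) \<or> cl z x i = of_int (z i + 1)" using that by (auto simp: cl_def)
    then have "cl z x i \<in> \<int>" by (metis Ints_of_int)
    then show ?thesis using skel that(1) by (simp add: fz_def)
  qed
  \<comment> \<open>The last clause prescribes the constant homotopy on cells where \<open>f\<close>
    is already trivial; another contraction of the constant map could enlarge the support.\<close>
  define good where "good z H \<longleftrightarrow> continuous_map euclidean X H \<and> (\<forall>t. dep_on S (\<lambda>x. H (x, t))) \<and>
    (\<forall>x. H (x, 0 :: real) = fz z x) \<and> (\<forall>x. H (x, 1) = b) \<and>
    (\<forall>x t. (\<exists>i\<in>S. x i \<notin> {real_of_int (z i)<..<of_int (z i) + 1}) \<longrightarrow> H (x, t) = b) \<and>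
    ((\<forall>x. fz z x = b) \<longrightarrow> (\<forall>x t. H (x, t) = b))" for z H
  have "\<exists>H. good z H" for z
  proof (cases "\<forall>x. fz z x = b")
    case True
    then show ?thesis using X(2) unfolding good_def by (intro exI[of _ "\<lambda>_. b"]) (simp add: dep_on_def)
  next
    case False
    have "continuous_map euclidean X (fz z)" "dep_on S (fz z)"
      unfolding fz_def by (rule continuous_map_euclidean_compose[OF f(1) ccl])
        (auto simp: dep_on_def cl_def intro!: dep_onD[OF f(2)])
    then have "\<exists>H. continuous_map euclidean X H \<and> (\<forall>t. dep_on S (\<lambda>x. H (x, t))) \<and> (\<forall>x. H (x, 0 :: real) = fz z x) \<and>
      (\<forall>x. H (x, 1) = b) \<and> (\<forall>x t. (\<exists>i\<in>S. x i \<notin> {real_of_int (z i)<..<of_int (z i) + 1}) \<longrightarrow> H (x, t) = b)"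
      by (intro null_homotopy_on_cell X S fz_outside)
    with False show ?thesis unfolding good_def by blast
  qed
  then obtain H where "\<And>z. good z (H z)" by metis
  then have H: "\<And>z. continuous_map euclidean X (H z)" "\<And>z t. dep_on S (\<lambda>x. H z (x, t))"
    "\<And>z x. H z (x, 0) = fz z x" "\<And>z x. H z (x, 1) = b"
    "\<And>z x t. (\<exists>i\<in>S. x i \<notin> {real_of_int (z i)<..<of_int (z i) + 1}) \<Longrightarrow> H z (x, t) = b"
    "\<And>z x t. (\<forall>x. fz z x = b) \<Longrightarrow> H z (x, t) = b"
    unfolding good_def by blast+
  have Hin: "x i \<in> {real_of_int (z i)<..<of_int (z i) + 1}" if "H z (x, t) \<noteq> b" "i \<in> S" for z x t i
    using H(5)[of x z t] that by blast
  have Hfl: "z i = \<lfloor>x i\<rfloor>" if "H z (x, t) \<noteq> b" "i \<in> S" for z x t i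
    using Hin[OF that] by (intro floor_unique[symmetric]) auto
  \<comment> \<open>Entries outside \<open>S\<close> are normalised to 0, so that every cell has
    exactly one index.\<close>
  define A where "A = {z :: nat \<Rightarrow> int. \<forall>i. i \<notin> S \<longrightarrow> z i = 0}"
  have disj: "z = z'" if "z \<in> A" "z' \<in> A" "H z w \<noteq> b" "H z' w \<noteq> b" for z z' w
  proof
    fix i show "z i = z' i"
      using that Hfl[of z "fst w" "snd w" i] Hfl[of z' "fst w" "snd w" i] by (cases "i \<in> S") (auto simp: A_def)
  qed
  define \<Phi> where "\<Phi> = assemble A b H"
  have "continuous_map euclidean X \<Phi>"
    unfolding \<Phi>_def
  proof (rule continuous_map_assemble)
    fix w :: "(nat \<Rightarrow> real) \<times> real"
    define T where "T = (\<Inter>i\<in>S. {v :: (nat \<Rightarrow> real) \<times> real. \<bar>fst v i - fst w i\<bar> < 1})"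
    have "open T" unfolding T_def
      using S by (intro open_INT ballI open_Collect_less continuous_intros)
    moreover have "w \<in> T" by (simp add: T_def)
    moreover have "finite {z \<in> A. \<exists>v\<in>T. H z v \<noteq> b}"
    proof (rule finite_subset)
      define B where "B = (\<Union>i\<in>S. {\<lfloor>fst w i\<rfloor> - 1..\<lfloor>fst w i\<rfloor> + 1})"
      show "finite {z. \<forall>i. (i \<in> S \<longrightarrow> z i \<in> B) \<and> (i \<notin> S \<longrightarrow> z i = 0)}"
        using S by (intro finite_set_of_finite_funs) (auto simp: B_def)
      show "{z \<in> A. \<exists>v\<in>T. H z v \<noteq> b} \<subseteq> {z. \<forall>i. (i \<in> S \<longrightarrow> z i \<in> B) \<and> (i \<notin> S \<longrightarrow> z i = 0)}"
      proof (intro subsetI CollectI allI conjI impI)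
        fix z i assume z: "z \<in> {z \<in> A. \<exists>v\<in>T. H z v \<noteq> b}"
        then obtain v where v: "v \<in> T" "H z v \<noteq> b" by blast
        show "z i = 0" if "i \<notin> S" using z that by (simp add: A_def)
        show "z i \<in> B" if i: "i \<in> S"
        proof -
          have "z i = \<lfloor>fst v i\<rfloor>" using Hfl[of z "fst v" "snd v" i] v i by simp
          moreover have "\<bar>fst v i - fst w i\<bar> < 1" using v(1) i by (auto simp: T_def)
          then have "\<lfloor>fst v i\<rfloor> \<in> {\<lfloor>fst w i\<rfloor> - 1..\<lfloor>fst w i\<rfloor> + 1}"
            unfolding atLeastAtMost_iff by linarith
          ultimately show ?thesis using i by (auto simp: B_def)
        qed
      qed
    qed
    ultimately show "\<exists>T. openin euclidean T \<and> w \<in> T \<and> finite {z \<in> A. \<exists>v\<in>T. H z v \<noteq> b}" by auto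
  qed (use H(1) X(2) disj in auto)
  moreover have "dep_on S (\<lambda>x. \<Phi> (x, t))" for t
    unfolding dep_on_def \<Phi>_def using H(2)[unfolded dep_on_def] by (intro allI impI assemble_cong) blast
  moreover have \<Phi>0: "\<Phi> (x, 0) = f x" for x
  proof (cases "\<exists>z\<in>A. H z (x, 0) \<noteq> b")
    case True
    then obtain z where z: "z \<in> A" "H z (x, 0) \<noteq> b" by blast
    then have "\<Phi> (x, 0) = H z (x, 0)" unfolding \<Phi>_def using disj by (intro assemble_eq) auto
    also have "\<dots> = f x" unfolding H(3) by (rule fz_inside) (rule Hin[OF z(2)])
    finally show ?thesis .
  next
    case False
    then have "\<Phi> (x, 0) = b" unfolding \<Phi>_def by (intro assemble_base) auto
    also have "b = f x"
    proof (cases "\<exists>i\<in>S. x i \<in> \<int>")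
      case True then show ?thesis using skel by metis
    next
      case nint: False
      define z where "z i = (if i \<in> S then \<lfloor>x i\<rfloor> else 0)" for i
      have "x i \<in> {of_int (z i)<..<of_int (z i) + 1}" if "i \<in> S" for i
      proof -
        have "x i \<noteq> of_int \<lfloor>x i\<rfloor>" using nint that by (metis Ints_of_int)
        moreover have "of_int \<lfloor>x i\<rfloor> \<le> x i" "x i < of_int \<lfloor>x i\<rfloor> + 1" by linarith+
        ultimately have "of_int \<lfloor>x i\<rfloor> < x i" by linarith
        then show ?thesis using that \<open>x i < of_int \<lfloor>x i\<rfloor> + 1\<close> by (simp add: z_def)
      qed
      then have "fz z x = f x" by (rule fz_inside)
      moreover have "z \<in> A" by (simp add: A_def z_def)
      ultimately show ?thesis using False H(3) by metis
    qed
    finally show ?thesis .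
  qed
  moreover have "\<Phi> (x, t) = b" if fb: "\<forall>y\<in>carrier_cell S x. \<Phi> (y, 0) = b" for x t
    unfolding \<Phi>_def
  proof (rule assemble_base, rule ccontr)
    fix z assume z: "z \<in> A" "H z (x, t) \<noteq> b"
    then obtain y where y: "fz z y \<noteq> b" using H(6) by blast
    have "cl z y \<in> carrier_cell S x"
    proof -
      have "of_int \<lfloor>x i\<rfloor> \<le> cl z y i \<and> cl z y i \<le> of_int \<lceil>x i\<rceil>" if i: "i \<in> S" for i
      proof -
        have "\<lfloor>x i\<rfloor> = z i" using Hfl[OF z(2) i] by simp
        moreover have "\<lceil>x i\<rceil> = z i + 1" using Hin[OF z(2) i] by (intro ceiling_unique) auto
        ultimately show ?thesis using i by (simp add: cl_def)
      qed
      then show ?thesis by (simp add: carrier_cell_def)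
    qed
    then show False using fb \<Phi>0 y by (simp add: fz_def)
  qed
  ultimately have "grid_homotopy X b S \<Phi>" unfolding grid_homotopy_def by blast
  moreover have "\<Phi> (x, 1) = b" for x unfolding \<Phi>_def using H(4) by (intro assemble_base)
  ultimately show ?thesis using \<Phi>0 unfolding grid_homotopic_def by blast
qed

text \<open>Induction over the dimension: slices have one coordinate less and contract by induction,
  so the walls can be cleared, and then the cells contract. With no coordinates left, degree 0
  supplies a path to \<open>b\<close>.\<close>

lemma grid_homotopic_const:
  assumes X: "\<And>k. k < n \<Longrightarrow> is_singleton (homotopy_group k X b)" "b \<in> topspace X"
    and S: "finite S" "card S < n" and f: "continuous_map euclidean X f" "dep_on S f"
  shows "grid_homotopic X b S f (\<lambda>_. b)"
  using S f
proof (induction S arbitrary: f rule: finite_psubset_induct)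
  case (psubset S)
  have "\<exists>g. grid_homotopic X b S f g \<and> (\<forall>x. (\<exists>i\<in>S. x i \<in> \<int>) \<longrightarrow> g x = b)"
  proof (rule grid_homotopic_skeleton[OF psubset.hyps psubset.prems(2,3)])
    fix i h assume i: "i \<in> S" and h: "continuous_map euclidean X h" "dep_on (S - {i}) h"
    have "card (S - {i}) \<le> card S" using psubset.hyps by (intro card_mono) auto
    then have "card (S - {i}) < n" using psubset.prems(1) by simp
    then show "grid_homotopic X b (S - {i}) h (\<lambda>_. b)" using i h by (intro psubset.IH) auto
  qed
  then obtain g where g: "grid_homotopic X b S f g" "\<And>x i. i \<in> S \<Longrightarrow> x i \<in> \<int> \<Longrightarrow> g x = b" by blast
  have "grid_homotopic X b S g (\<lambda>_. b)"
    by (rule grid_homotopic_cells[OF X(1)[OF psubset.prems(1)] X(2) psubset.hyps grid_homotopic_target[OF g(1)] g(2)])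
  then show ?case by (rule grid_homotopic_trans[OF g(1)])
qed

text \<open>In dimension \<open>n\<close> the cells themselves may carry nontrivial classes, so the
  process stops at the walls. The slices have \<open>n - 1\<close> coordinates and still
  contract.\<close>

lemma grid_homotopic_full_skeleton:
  assumes X: "\<And>k. k < n \<Longrightarrow> is_singleton (homotopy_group k X b)" "b \<in> topspace X"
    and f: "continuous_map euclidean X f" "dep_on {..<n} f"
  obtains g where "grid_homotopic X b {..<n} f g" "\<forall>x. \<forall>i<n. x i \<in> \<int> \<longrightarrow> g x = b"
proof -
  have "\<exists>g. grid_homotopic X b {..<n} f g \<and> (\<forall>x. (\<exists>i\<in>{..<n}. x i \<in> \<int>) \<longrightarrow> g x = b)"
  proof (rule grid_homotopic_skeleton[OF _ f])
    fix i h assume i: "i \<in> {..<n}" and h: "continuous_map euclidean X h" "dep_on ({..<n} - {i}) h"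
    have "card ({..<n} - {i}) < n" using i by (simp add: card_Diff_singleton_if)
    then show "grid_homotopic X b ({..<n} - {i}) h (\<lambda>_. b)"
      using h by (intro grid_homotopic_const[OF X]) auto
  qed simp
  then show ?thesis using that by blast
qed

section \<open>Making one cube map cellular inside its support\<close>

lemma cube_mapD:
  assumes "cube_map n Z z f"
  shows "continuous_map euclidean Z f" "dep_on {..<n} f" "f x \<noteq> z \<Longrightarrow> i < n \<Longrightarrow> x i \<in> {0<..<1}"
  using assms unfolding cube_map_def by blast+

text \<open>The closed sets on which \<open>g\<close> is outside \<open>V\<close> and on which
  \<open>g\<close> equals \<open>b\<close> are disjoint, so within a compact box their sup-norm
  distance is positive.\<close>

lemma cube_map_mesh:
  assumes X: "Hausdorff_space X" and g: "cube_map n X b g" and V: "openin X V" "b \<in> V"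
  obtains N :: nat where "N > 0"
    "\<forall>x y. g x \<notin> V \<longrightarrow> (\<forall>i<n. \<bar>x i - y i\<bar> \<le> 1 / real N) \<longrightarrow> g y \<noteq> b"
proof -
  \<comment> \<open>The set where \<open>g\<close> equals \<open>b\<close> is unbounded. As
    \<open>g\<close> is trivial off the unit cube and 1 / N \<le> 1, only points with coordinates in
    [-1, 2] can come close enough to matter.\<close>
  define Q where "Q = {x :: nat \<Rightarrow> real. (\<forall>i<n. x i \<in> {-1..2}) \<and> (\<forall>i\<ge>n. x i = 0)}"
  have Q: "compact Q" unfolding Q_def by (rule compact_box)
  have bX: "b \<in> topspace X" using V openin_subset by blast
  have gX: "g x \<in> topspace X" for x using cube_mapD(1)[OF g] by (auto simp: continuous_map_def)
  have "closedin euclidean {x \<in> topspace euclidean. g x \<in> topspace X - V}"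
    by (rule closedin_continuous_map_preimage[OF cube_mapD(1)[OF g]]) (use V in auto)
  then have c1: "closed {x. g x \<notin> V}" using gX by simp
  have "closedin euclidean {x \<in> topspace euclidean. g x \<in> {b}}"
    by (rule closedin_continuous_map_preimage[OF cube_mapD(1)[OF g]])
      (use X bX in \<open>simp add: closedin_Hausdorff_singleton\<close>)
  then have c2: "closed {x. g x = b}" by simp
  define P where "P = (Q \<inter> {x. g x \<notin> V}) \<times> (Q \<inter> {x. g x = b})"
  have P: "compact P" unfolding P_def using Q c1 c2 by (intro compact_Times compact_Int_closed)
  define d where "d p = max_norm n (\<lambda>i. fst p i - snd p i)" for p :: "(nat \<Rightarrow> real) \<times> (nat \<Rightarrow> real)"
  have csnd: "continuous_on UNIV (\<lambda>p :: (nat \<Rightarrow> real) \<times> (nat \<Rightarrow> real). snd p i)" for i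
    by (rule continuous_on_product_then_coordinatewise) (rule continuous_on_snd[OF continuous_on_id, simplified])
  have "continuous_on UNIV d" unfolding d_def
    by (intro continuous_intros csnd)
  then have contd: "continuous_on P d" by (rule continuous_on_subset) simp
  have dpos: "0 < d p" if p: "p \<in> P" for p
  proof (rule ccontr)
    assume "\<not> 0 < d p"
    then have "d p \<le> 0" by simp
    have "fst p i = snd p i" if "i < n" for i
    proof (rule ccontr)
      assume ne: "fst p i \<noteq> snd p i"
      then have "max_norm n (\<lambda>i. fst p i - snd p i) < \<bar>fst p i - snd p i\<bar>" using \<open>d p \<le> 0\<close> by (simp add: d_def)
      then show False using max_norm_less_iff[of "\<bar>fst p i - snd p i\<bar>" n "\<lambda>i. fst p i - snd p i"] ne \<open>i < n\<close> by auto
    qed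
    then have "g (fst p) = g (snd p)" by (intro dep_onD[OF cube_mapD(2)[OF g]]) auto
    then show False using p V by (auto simp: P_def)
  qed
  obtain \<delta> where \<delta>: "0 < \<delta>" "\<And>p. p \<in> P \<Longrightarrow> \<delta> \<le> d p"
  proof (cases "P = {}")
    case True then show ?thesis using that[of 1] by simp
  next
    case False
    obtain p where "p \<in> P" "\<And>q. q \<in> P \<Longrightarrow> d p \<le> d q"
      using continuous_attains_inf[OF P False contd] by blast
    then show ?thesis using that[of "d p"] dpos by blast
  qed
  obtain N :: nat where N: "N > 0" "1 / real N < \<delta>"
    using \<delta>(1) reals_Archimedean[OF \<delta>(1)] by (metis inverse_eq_divide zero_less_Suc)
  have "g y \<noteq> b" if xV: "g x \<notin> V" and xy: "\<And>i. i < n \<Longrightarrow> \<bar>x i - y i\<bar> \<le> 1 / real N" for x y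
  proof
    assume gy: "g y = b"
    define r where "r w = (\<lambda>i. if i < n then w i else 0)" for w :: "nat \<Rightarrow> real"
    have gr: "g (r w) = g w" for w by (rule dep_onD[OF cube_mapD(2)[OF g]]) (simp add: r_def)
    have "g x \<noteq> b" using xV V by auto
    then have x01: "x i \<in> {0<..<1}" if "i < n" for i using cube_mapD(3)[OF g _ that] by blast
    have "1 / real N \<le> 1" using N(1) by simp
    then have "y i \<in> {-1..2}" if "i < n" for i
      using x01[OF that] xy[OF that] unfolding atLeastAtMost_iff greaterThanLessThan_iff by linarith
    then have "r y \<in> Q" by (simp add: Q_def r_def)
    moreover have "x i \<in> {-1..2}" if "i < n" for i
      using x01[OF that] by simp
    then have "r x \<in> Q" by (simp add: Q_def r_def)
    ultimately have "(r x, r y) \<in> P" using xV gy by (simp add: P_def gr)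
    from \<delta>(2)[OF this] have "\<delta> \<le> max_norm n (\<lambda>i. r x i - r y i)" by (simp add: d_def)
    also have "\<dots> = max_norm n (\<lambda>i. x i - y i)" by (rule max_norm_cong) (simp add: r_def)
    also have "\<dots> < \<delta>"
      using max_norm_less_iff[of \<delta> n "\<lambda>i. x i - y i"] \<delta>(1) xy N(2) by (meson le_less_trans)
    finally show False by simp
  qed
  then show ?thesis using N(1) by (intro that[of N]) blast+
qed

definition contractible_base :: "'a topology \<Rightarrow> 'a \<Rightarrow> bool" where
  "contractible_base X b \<longleftrightarrow> (\<exists>D V. continuous_map (prod_topology X euclideanreal) X D \<and>
     (\<forall>x\<in>topspace X. D (x, 0) = x) \<and> (\<forall>t. D (b, t) = b) \<and> openin X V \<and> b \<in> V \<and> (\<forall>x\<in>V. D (x, 1) = b))"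

text \<open>After the deformation the map is trivial wherever \<open>g\<close> was in
  \<open>V\<close>, so everything within one mesh width of a remaining point belongs to the support
  of \<open>g\<close>. Clearing the walls spreads the support only within closed cells, which have
  exactly this width; hence the last clause, on which the disjointness of the boxes rests.\<close>

lemma cube_map_cellular:
  assumes X: "Hausdorff_space X" "b \<in> topspace X" "contractible_base X b"
    and conn: "\<And>k. k < n \<Longrightarrow> is_singleton (homotopy_group k X b)"
    and g: "cube_map n X b g"
  obtains \<Phi> and N :: nat where "N > 0" "cube_homotopy n X b \<Phi>" "\<And>x. \<Phi> (x, 0) = g x"
    "\<And>x t. \<Phi> (x, t) \<noteq> b \<Longrightarrow> g x \<noteq> b"
    "\<And>x i. i < n \<Longrightarrow> real N * x i \<in> \<int> \<Longrightarrow> \<Phi> (x, 1) = b"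
    "\<And>x y. \<Phi> (x, 1) \<noteq> b \<Longrightarrow> (\<And>i. i < n \<Longrightarrow> of_int \<lfloor>real N * x i\<rfloor> \<le> real N * y i \<and> real N * y i \<le> of_int \<lceil>real N * x i\<rceil>) \<Longrightarrow> g y \<noteq> b"
proof -
  obtain D V where D: "continuous_map (prod_topology X euclideanreal) X D"
    "\<And>x. x \<in> topspace X \<Longrightarrow> D (x, 0) = x" "\<And>t. D (b, t) = b"
    and V: "openin X V" "b \<in> V" and DV: "\<And>x. x \<in> V \<Longrightarrow> D (x, 1) = b"
    using X(3) unfolding contractible_base_def by blast
  obtain N :: nat where N: "N > 0"
    and mesh: "\<forall>x y. g x \<notin> V \<longrightarrow> (\<forall>i<n. \<bar>x i - y i\<bar> \<le> 1 / real N) \<longrightarrow> g y \<noteq> b"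
    by (rule cube_map_mesh[OF X(1) g V])
  define \<Phi>1 where "\<Phi>1 = (\<lambda>p :: (nat \<Rightarrow> real) \<times> real. D (g (fst p), snd p))"
  have csnd: "continuous_on UNIV (snd :: (nat \<Rightarrow> real) \<times> real \<Rightarrow> real)"
    using continuous_on_snd[OF continuous_on_id] by simp
  have "continuous_map euclidean (prod_topology X euclideanreal) (\<lambda>p :: (nat \<Rightarrow> real) \<times> real. (g (fst p), snd p))"
    unfolding continuous_map_pairwise
    using continuous_map_euclidean_compose[OF cube_mapD(1)[OF g] continuous_on_fst_UNIV] csnd
    by (simp add: o_def)
  from continuous_map_compose[OF this D(1)]
  have cont1: "continuous_map euclidean X \<Phi>1" by (simp add: \<Phi>1_def o_def)
  have gX: "g x \<in> topspace X" for x using cube_mapD(1)[OF g] by (auto simp: continuous_map_def)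
  \<comment> \<open>The deformed map, rescaled so that the grid of mesh 1 / N becomes the integer
    grid.\<close>
  define f where "f x = D (g (\<lambda>i. x i / real N), 1)" for x
  have cdiv: "continuous_on UNIV (\<lambda>x :: nat \<Rightarrow> real. \<lambda>i. x i / real N)"
    using N by (intro continuous_on_coordinatewise_then_product continuous_intros) auto
  have fcont: "continuous_map euclidean X f"
    using continuous_map_euclidean_compose[OF continuous_map_slice[OF cont1, of 1] cdiv]
    by (simp add: \<Phi>1_def f_def [abs_def])
  have fdep: "dep_on {..<n} f"
  proof -
    have "g (\<lambda>i. x i / real N) = g (\<lambda>i. y i / real N)" if "\<forall>i\<in>{..<n}. x i = y i" for x y
      by (rule dep_onD[OF cube_mapD(2)[OF g]]) (use that in simp)
    then show ?thesis unfolding dep_on_def f_def by metis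
  qed
  have fg: "g y \<noteq> b" if fx: "f x \<noteq> b" and near: "\<And>i. i < n \<Longrightarrow> \<bar>x i - real N * y i\<bar> \<le> 1" for x y
  proof -
    have "g (\<lambda>i. x i / real N) \<notin> V" using fx DV by (auto simp: f_def)
    moreover have "\<bar>x i / real N - y i\<bar> \<le> 1 / real N" if i: "i < n" for i
    proof -
      have "x i / real N - y i = (x i - real N * y i) / real N" using N by (simp add: field_simps)
      then have "\<bar>x i / real N - y i\<bar> = \<bar>x i - real N * y i\<bar> / real N" using N by (simp add: abs_divide)
      also have "\<dots> \<le> 1 / real N" using near[OF i] by (intro divide_right_mono) auto
      finally show ?thesis .
    qed
    ultimately show ?thesis using mesh by blast
  qed
  obtain f' where f': "grid_homotopic X b {..<n} f f'" and f'_skel: "\<forall>x. \<forall>i<n. x i \<in> \<int> \<longrightarrow> f' x = b"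
    by (rule grid_homotopic_full_skeleton[OF conn X(2) fcont fdep])
  then obtain \<Psi> where \<Psi>: "grid_homotopy X b {..<n} \<Psi>" "\<And>x. \<Psi> (x, 0) = f x" "\<And>x. \<Psi> (x, 1) = f' x"
    unfolding grid_homotopic_def by blast
  define \<Phi>2 where "\<Phi>2 = (\<lambda>p :: (nat \<Rightarrow> real) \<times> real. \<Psi> (\<lambda>i. real N * fst p i, snd p))"
  have cont2: "continuous_map euclidean X \<Phi>2"
    unfolding \<Phi>2_def
  proof (rule continuous_map_euclidean_compose)
    show "continuous_map euclidean X \<Psi>" using \<Psi>(1) by (simp add: grid_homotopy_def)
    show "continuous_on UNIV (\<lambda>p :: (nat \<Rightarrow> real) \<times> real. (\<lambda>i. real N * fst p i, snd p))"
      by (intro continuous_on_Pair continuous_on_coordinatewise_then_product continuous_intros)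
  qed
  define \<Phi> where "\<Phi> = (\<lambda>p. if snd p \<le> 1/2 then \<Phi>1 (fst p, 2 * snd p) else \<Phi>2 (fst p, 2 * snd p - 1))"
  have cont: "continuous_map euclidean X \<Phi>"
    unfolding \<Phi>_def
  proof (rule continuous_map_concat[OF cont1 cont2])
    show "\<Phi>1 (x, 1) = \<Phi>2 (x, 0)" for x using \<Psi>(2) N by (simp add: \<Phi>1_def \<Phi>2_def f_def)
  qed
  have cell: "\<exists>y\<in>carrier_cell {..<n} (\<lambda>i. real N * x i). f y \<noteq> b" if nb: "\<Phi>2 (x, t) \<noteq> b" for x t
  proof (rule ccontr)
    assume "\<not> ?thesis"
    then have "\<forall>y\<in>carrier_cell {..<n} (\<lambda>i. real N * x i). \<Psi> (y, 0) = b" using \<Psi>(2) by simp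
    then have "\<Psi> (\<lambda>i. real N * x i, t) = b" using \<Psi>(1) unfolding grid_homotopy_def by blast
    then show False using nb by (simp add: \<Phi>2_def)
  qed
  have cell2: "g y \<noteq> b" if nb: "\<Phi>2 (x, t) \<noteq> b"
    and y: "\<And>i. i < n \<Longrightarrow> of_int \<lfloor>real N * x i\<rfloor> \<le> real N * y i \<and> real N * y i \<le> of_int \<lceil>real N * x i\<rceil>" for x y t
  proof -
    obtain w where w: "w \<in> carrier_cell {..<n} (\<lambda>i. real N * x i)" "f w \<noteq> b" using cell[OF nb] by blast
    show ?thesis
    proof (rule fg[OF w(2)])
      fix i assume i: "i < n"
      have "of_int \<lfloor>real N * x i\<rfloor> \<le> w i" "w i \<le> of_int \<lceil>real N * x i\<rceil>"
        using w(1) i by (auto simp: carrier_cell_def)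
      moreover have "of_int \<lceil>real N * x i\<rceil> \<le> (of_int \<lfloor>real N * x i\<rfloor> + 1 :: real)"
        using ceiling_diff_floor_le_1[of "real N * x i"] by linarith
      ultimately show "\<bar>w i - real N * y i\<bar> \<le> 1" using y[OF i] by linarith
    qed
  qed
  have supp: "g x \<noteq> b" if nb: "\<Phi> (x, t) \<noteq> b" for x t
  proof (cases "t \<le> 1/2")
    case True
    then show ?thesis using nb D(3) by (auto simp: \<Phi>_def \<Phi>1_def)
  next
    case False
    then have "\<Phi>2 (x, 2 * t - 1) \<noteq> b" using nb by (simp add: \<Phi>_def)
    then show ?thesis by (rule cell2) linarith
  qed
  have "cube_map n X b (\<lambda>x. \<Phi> (x, t))" for t
    unfolding cube_map_def
  proof (intro conjI allI impI continuous_map_slice cont)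
    have "dep_on {..<n} (\<lambda>x. \<Phi>1 (x, s))" for s
      using cube_mapD(2)[OF g] unfolding dep_on_def \<Phi>1_def fst_conv snd_conv by metis
    moreover have "dep_on {..<n} (\<lambda>x. \<Phi>2 (x, s))" for s
      using \<Psi>(1) unfolding grid_homotopy_def dep_on_def \<Phi>2_def by simp
    ultimately show "dep_on {..<n} (\<lambda>x. \<Phi> (x, t))" by (cases "t \<le> 1/2") (simp_all add: \<Phi>_def)
    show "\<Phi> (x, t) = b" if ex: "\<exists>i<n. x i \<notin> {0<..<1}" for x
      using ex supp[of x t] cube_mapD(3)[OF g, of x] by blast
  qed
  then have "cube_homotopy n X b \<Phi>" using cont by (simp add: cube_homotopy_def)
  moreover have "\<Phi> (x, 0) = g x" for x using D(2) gX by (simp add: \<Phi>_def \<Phi>1_def)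
  moreover have \<Phi>1': "\<Phi> (x, 1) = \<Phi>2 (x, 1)" for x by (simp add: \<Phi>_def)
  have "\<Phi> (x, 1) = b" if "i < n" "real N * x i \<in> \<int>" for x i
    using f'_skel[rule_format, OF that(1), of "\<lambda>i. real N * x i"] that(2) \<Psi>(3) by (simp add: \<Phi>1' \<Phi>2_def)
  moreover have "g y \<noteq> b" if "\<Phi> (x, 1) \<noteq> b"
    "\<And>i. i < n \<Longrightarrow> of_int \<lfloor>real N * x i\<rfloor> \<le> real N * y i \<and> real N * y i \<le> of_int \<lceil>real N * x i\<rceil>" for x y
    using that unfolding \<Phi>1' by (rule cell2)
  ultimately show ?thesis using N supp that by blast
qed

text \<open>Lying to the left is only a partial order on intervals. Comparing midpoints, with ties
  broken by an enumeration, refines it to a linear order, and a countable linear order is realised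
  by disjoint intervals of lengths 1/2, 1/4, 1/8 and so on.\<close>

lemma spread_intervals:
  fixes l r :: "'i \<Rightarrow> real"
  assumes A: "countable A" and lr: "\<And>a. a \<in> A \<Longrightarrow> l a < r a"
  shows "\<exists>l' r' :: 'i \<Rightarrow> real. (\<forall>a\<in>A. 0 \<le> l' a \<and> l' a < r' a \<and> r' a \<le> 1) \<and>
    (\<forall>a\<in>A. \<forall>c\<in>A. r a \<le> l c \<longrightarrow> r' a \<le> l' c) \<and>
    (\<forall>a\<in>A. \<forall>c\<in>A. a \<noteq> c \<longrightarrow> r' a \<le> l' c \<or> r' c \<le> l' a)"
proof -
  define code where "code = to_nat_on A"
  have inj: "code a = code c \<longleftrightarrow> a = c" if "a \<in> A" "c \<in> A" for a c
    using that A by (simp add: code_def)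
  define prec where "prec a c \<longleftrightarrow> l a + r a < l c + r c \<or> l a + r a = l c + r c \<and> code a < code c" for a c
  define B where "B a = {code c | c. c \<in> A \<and> prec c a}" for a
  define w where "w m = (1/2 :: real) ^ Suc m" for m
  \<comment> \<open>\<open>l' a\<close> is the total weight of the indices that precede \<open>a\<close> in the order of midpoints.\<close>
  define l' where "l' a = (\<Sum>m. if m \<in> B a then w m else 0)" for a
  define r' where "r' a = l' a + w (code a)" for a
  have w0: "0 < w m" for m by (simp add: w_def)
  have "w = (\<lambda>m. (1/2 :: real) ^ Suc m)" by (simp add: w_def fun_eq_iff)
  then have "w sums 1" using power_half_series by (simp only:)
  then have sw: "summable w" "suminf w = 1" by (auto simp: sums_iff)
  have s: "summable (\<lambda>m. if m \<in> M then w m else 0)" for M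
    by (rule summable_comparison_test[OF _ sw(1)]) (use w0 in \<open>auto simp: less_imp_le intro!: exI[of _ 0]\<close>)
  have r'_eq: "r' a = (\<Sum>m. if m \<in> insert (code a) (B a) then w m else 0)" if a: "a \<in> A" for a
  proof -
    have "code a \<notin> B a" using a inj by (auto simp: B_def prec_def)
    then have "(\<lambda>m. if m \<in> insert (code a) (B a) then w m else 0)
        = (\<lambda>m. (if m \<in> B a then w m else 0) + (if m = code a then w m else 0))"
      by (auto simp: fun_eq_iff)
    moreover have "(\<lambda>m. if m = code a then w m else 0) sums w (code a)" by (rule sums_single)
    ultimately show ?thesis
      using suminf_add[OF s[of "B a"] sums_summable[OF \<open>_ sums w (code a)\<close>]] sums_unique[OF \<open>_ sums w (code a)\<close>]
      by (simp add: r'_def l'_def)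
  qed
  have mono: "r' a \<le> l' c" if a: "a \<in> A" "c \<in> A" "prec a c" for a c
  proof -
    have "insert (code a) (B a) \<subseteq> B c" using a by (auto simp: B_def prec_def)
    then show ?thesis unfolding r'_eq[OF a(1)] l'_def
      by (intro suminf_le s) (use w0 in \<open>auto simp: less_imp_le\<close>)
  qed
  show ?thesis
  proof (rule exI[of _ l'], rule exI[of _ r'], intro conjI ballI impI)
    fix a assume a: "a \<in> A"
    show "0 \<le> l' a" unfolding l'_def by (intro suminf_nonneg s) (use w0 in \<open>auto simp: less_imp_le\<close>)
    show "l' a < r' a" using w0 by (simp add: r'_def)
    have "r' a \<le> suminf w" unfolding r'_eq[OF a]
      by (intro suminf_le s sw) (use w0 in \<open>auto simp: less_imp_le\<close>)
    then show "r' a \<le> 1" using sw by simp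
  next
    fix a c assume a: "a \<in> A" and c: "c \<in> A" and le: "r a \<le> l c"
    have "prec a c" using le lr[OF a] lr[OF c] by (simp add: prec_def)
    then show "r' a \<le> l' c" by (rule mono[OF a c])
  next
    fix a c assume a: "a \<in> A" and c: "c \<in> A" and ne: "a \<noteq> c"
    have "prec a c \<or> prec c a" using ne inj[OF a c] by (auto simp: prec_def)
    then show "r' a \<le> l' c \<or> r' c \<le> l' a" using mono a c by blast
  qed
qed

section \<open>Families of cube maps with disjoint supports\<close>

definition cube_family ::
  "nat \<Rightarrow> (nat \<Rightarrow> 'a topology) \<Rightarrow> (nat \<Rightarrow> 'a) \<Rightarrow> (nat \<Rightarrow> (nat \<Rightarrow> real) \<Rightarrow> 'a) \<Rightarrow> bool" where
  "cube_family n Xs b g \<longleftrightarrow> (\<forall>j. cube_map n (Xs j) (b j) (g j)) \<and>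
     (\<forall>x j k. g j x \<noteq> b j \<longrightarrow> g k x \<noteq> b k \<longrightarrow> j = k)"

definition family_homotopy ::
  "nat \<Rightarrow> (nat \<Rightarrow> 'a topology) \<Rightarrow> (nat \<Rightarrow> 'a) \<Rightarrow> (nat \<Rightarrow> (nat \<Rightarrow> real) \<times> real \<Rightarrow> 'a) \<Rightarrow> bool" where
  "family_homotopy n Xs b \<Phi> \<longleftrightarrow> (\<forall>j. cube_homotopy n (Xs j) (b j) (\<Phi> j)) \<and>
     (\<forall>p j k. \<Phi> j p \<noteq> b j \<longrightarrow> \<Phi> k p \<noteq> b k \<longrightarrow> j = k)"

definition family_homotopic ::
  "nat \<Rightarrow> (nat \<Rightarrow> 'a topology) \<Rightarrow> (nat \<Rightarrow> 'a) \<Rightarrow>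
    (nat \<Rightarrow> (nat \<Rightarrow> real) \<Rightarrow> 'a) \<Rightarrow> (nat \<Rightarrow> (nat \<Rightarrow> real) \<Rightarrow> 'a) \<Rightarrow> bool" where
  "family_homotopic n Xs b f g \<longleftrightarrow>
     (\<exists>\<Phi>. family_homotopy n Xs b \<Phi> \<and> (\<forall>j x. \<Phi> j (x, 0) = f j x) \<and> (\<forall>j x. \<Phi> j (x, 1) = g j x))"

lemma cube_homotopy_reverse:
  assumes "cube_homotopy n Z z \<Phi>"
  shows "cube_homotopy n Z z (\<lambda>p. \<Phi> (fst p, 1 - snd p))"
proof -
  have "continuous_map euclidean Z \<Phi>" using assms by (simp add: cube_homotopy_def)
  then have "continuous_map euclidean Z (\<lambda>p. \<Phi> (fst p, 1 - snd p))"
    by (rule continuous_map_euclidean_compose) (intro continuous_intros)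
  then show ?thesis using assms by (simp add: cube_homotopy_def)
qed

lemma cube_homotopy_concat:
  assumes "cube_homotopy n Z z \<Phi>" "cube_homotopy n Z z \<Psi>" "\<And>x. \<Phi> (x, 1) = \<Psi> (x, 0)"
  shows "cube_homotopy n Z z (\<lambda>p. if snd p \<le> 1/2 then \<Phi> (fst p, 2 * snd p) else \<Psi> (fst p, 2 * snd p - 1))"
  unfolding cube_homotopy_def
proof (intro conjI allI)
  show "continuous_map euclidean Z (\<lambda>p. if snd p \<le> 1/2 then \<Phi> (fst p, 2 * snd p) else \<Psi> (fst p, 2 * snd p - 1))"
    using assms by (intro continuous_map_concat) (auto simp: cube_homotopy_def)
  show "cube_map n Z z (\<lambda>x. if snd (x, t) \<le> 1/2 then \<Phi> (fst (x, t), 2 * snd (x, t))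
      else \<Psi> (fst (x, t), 2 * snd (x, t) - 1))" for t
    using assms by (cases "t \<le> 1/2") (simp_all add: cube_homotopy_def)
qed

lemma cube_homotopic_sym: "cube_homotopic n Z z f g \<Longrightarrow> cube_homotopic n Z z g f"
proof -
  assume "cube_homotopic n Z z f g"
  then obtain \<Phi> where \<Phi>: "cube_homotopy n Z z \<Phi>" "\<forall>x. \<Phi> (x, 0) = f x" "\<forall>x. \<Phi> (x, 1) = g x"
    unfolding cube_homotopic_def by blast
  then show ?thesis unfolding cube_homotopic_def
    by (intro exI[of _ "\<lambda>p. \<Phi> (fst p, 1 - snd p)"]) (simp add: cube_homotopy_reverse)
qed

lemma family_homotopic_sym:
  assumes "family_homotopic n Xs b f g"
  shows "family_homotopic n Xs b g f"
proof -
  obtain \<Phi> where \<Phi>: "family_homotopy n Xs b \<Phi>" "\<forall>j x. \<Phi> j (x, 0) = f j x" "\<forall>j x. \<Phi> j (x, 1) = g j x"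
    using assms unfolding family_homotopic_def by blast
  have "family_homotopy n Xs b (\<lambda>j p. \<Phi> j (fst p, 1 - snd p))"
    using \<Phi>(1) by (simp add: family_homotopy_def cube_homotopy_reverse)
  then show ?thesis unfolding family_homotopic_def
    by (intro exI[of _ "\<lambda>j p. \<Phi> j (fst p, 1 - snd p)"]) (simp add: \<Phi>)
qed

lemma family_homotopic_trans:
  assumes "family_homotopic n Xs b f g" "family_homotopic n Xs b g h"
  shows "family_homotopic n Xs b f h"
proof -
  obtain \<Phi> where \<Phi>: "family_homotopy n Xs b \<Phi>" "\<forall>j x. \<Phi> j (x, 0) = f j x" "\<forall>j x. \<Phi> j (x, 1) = g j x"
    using assms(1) unfolding family_homotopic_def by blast
  obtain \<Psi> where \<Psi>: "family_homotopy n Xs b \<Psi>" "\<forall>j x. \<Psi> j (x, 0) = g j x" "\<forall>j x. \<Psi> j (x, 1) = h j x"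
    using assms(2) unfolding family_homotopic_def by blast
  define \<Theta> where "\<Theta> j = (\<lambda>p. if snd p \<le> 1/2 then \<Phi> j (fst p, 2 * snd p) else \<Psi> j (fst p, 2 * snd p - 1))" for j
  have "cube_homotopy n (Xs j) (b j) (\<Theta> j)" for j
    using \<Phi> \<Psi> unfolding \<Theta>_def by (intro cube_homotopy_concat) (auto simp: family_homotopy_def)
  moreover have "j = k" if "\<Theta> j p \<noteq> b j" "\<Theta> k p \<noteq> b k" for p j k
  proof (cases "snd p \<le> 1/2")
    case True
    then show ?thesis using that \<Phi>(1) unfolding family_homotopy_def \<Theta>_def by (simp only: if_True) blast
  next
    case False
    then show ?thesis using that \<Psi>(1) unfolding family_homotopy_def \<Theta>_def by (simp only: if_False) blast
  qed
  ultimately have "family_homotopy n Xs b \<Theta>" unfolding family_homotopy_def by blast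
  then show ?thesis unfolding family_homotopic_def
    by (intro exI[of _ \<Theta>]) (simp add: \<Phi> \<Psi> \<Theta>_def)
qed

lemma family_homotopic_component:
  assumes "family_homotopic n Xs b f g"
  shows "cube_homotopic n (Xs j) (b j) (f j) (g j)"
proof -
  obtain \<Phi> where "family_homotopy n Xs b \<Phi>" "\<forall>j x. \<Phi> j (x, 0) = f j x" "\<forall>j x. \<Phi> j (x, 1) = g j x"
    using assms unfolding family_homotopic_def by blast
  then show ?thesis unfolding cube_homotopic_def family_homotopy_def
    by (intro exI[of _ "\<Phi> j"]) simp
qed

section \<open>Separation along the first axis\<close>

lemma countable_int_lattice: "countable {z :: nat \<Rightarrow> int. \<forall>i\<ge>n. z i = 0}"
proof (rule countable_subset)
  show "{z :: nat \<Rightarrow> int. \<forall>i\<ge>n. z i = 0} \<subseteq> range (\<lambda>xs i. if i < n then xs ! i else 0)"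
  proof
    fix z :: "nat \<Rightarrow> int" assume "z \<in> {z. \<forall>i\<ge>n. z i = 0}"
    then have "z = (\<lambda>i. if i < n then map z [0..<n] ! i else 0)" by (auto simp: fun_eq_iff)
    then show "z \<in> range (\<lambda>xs i. if i < n then xs ! i else 0)" by blast
  qed
qed auto

text \<open>This liberates the other directions: supports stay disjoint under every motion that
  leaves coordinate \<open>i\<close> alone.\<close>

definition separated_along :: "nat \<Rightarrow> (nat \<Rightarrow> 'a) \<Rightarrow> (nat \<Rightarrow> (nat \<Rightarrow> real) \<Rightarrow> 'a) \<Rightarrow> bool" where
  "separated_along i b h \<longleftrightarrow> (\<forall>x y j k. x i = y i \<longrightarrow> h j x \<noteq> b j \<longrightarrow> h k y \<noteq> b k \<longrightarrow> j = k)"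

text \<open>The family lives on pairwise disjoint boxes. Moving the first edge of every box linearly to
  a family of pairwise disjoint intervals that respects the partial order of the edges keeps the
  boxes disjoint: two boxes separated in another coordinate stay so, and those separated in the
  first one keep their order.\<close>
lemma cellular_family_separate:
  assumes n: "0 < n" and base: "\<And>j. b j \<in> topspace (Xs j)" and g: "cube_family n Xs b g"
    and N: "\<And>j. 0 < N j" and f: "\<And>j. cube_map n (Xs j) (b j) (f j)"
    and skel: "\<And>j x i. i < n \<Longrightarrow> real (N j) * x i \<in> \<int> \<Longrightarrow> f j x = b j"
    and cell: "\<And>j x y. f j x \<noteq> b j \<Longrightarrow>
      (\<And>i. i < n \<Longrightarrow> of_int \<lfloor>real (N j) * x i\<rfloor> \<le> real (N j) * y i \<and> real (N j) * y i \<le> of_int \<lceil>real (N j) * x i\<rceil>) \<Longrightarrow>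
      g j y \<noteq> b j"
  shows "\<exists>h. family_homotopic n Xs b f h \<and> separated_along 0 b h"
proof -
  \<comment> \<open>A box is indexed by a = (j, z), where z is its lower corner in the grid of
    member j, whose mesh is 1 / N j.\<close>
  define lo hi where "lo a i = of_int (snd a i) / real (N (fst a))"
    and "hi a i = (of_int (snd a i) + 1) / real (N (fst a))" for a :: "nat \<times> (nat \<Rightarrow> int)" and i
  have lohi: "lo a i < hi a i" for a i using N by (simp add: lo_def hi_def divide_strict_right_mono)
  \<comment> \<open>Since \<open>f\<close> is trivial on the walls, \<open>f\<close> after this
    retraction is its restriction to the box, extended by the base point.\<close>
  define clamp where "clamp a x = (\<lambda>i. if i < n then max (lo a i) (min (hi a i) (x i)) else x i)" for a x
  define A where "A = {a. (\<forall>i\<ge>n. snd a i = 0) \<and> (\<exists>x. f (fst a) (clamp a x) \<noteq> b (fst a))}"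
  have Nlo: "real (N (fst a)) * lo a i = of_int (snd a i)" "real (N (fst a)) * hi a i = of_int (snd a i + 1)" for a i
    using N[of "fst a"] by (simp_all add: lo_def hi_def)
  have inside: "lo a i < x i \<and> x i < hi a i" if "f (fst a) (clamp a x) \<noteq> b (fst a)" "i < n" for a x i
  proof (rule ccontr)
    assume "\<not> ?thesis"
    then have "clamp a x i = lo a i \<or> clamp a x i = hi a i"
      using that(2) lohi[of a i] by (auto simp: clamp_def)
    then have "real (N (fst a)) * clamp a x i \<in> \<int>" using Nlo[of a i] by (metis Ints_of_int)
    then show False using skel that by blast
  qed
  \<comment> \<open>The closed box lies in the support of \<open>g\<close>, not only its interior;
    so boxes of different members do not even touch.\<close>
  have in_box: "g (fst a) y \<noteq> b (fst a)" if a: "a \<in> A" and y: "\<And>i. i < n \<Longrightarrow> lo a i \<le> y i \<and> y i \<le> hi a i" for a y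
  proof -
    obtain x where x: "f (fst a) (clamp a x) \<noteq> b (fst a)" using a unfolding A_def by blast
    show ?thesis
    proof (rule cell[OF x])
      fix i assume i: "i < n"
      let ?N = "real (N (fst a))"
      have Np: "0 < ?N" using N by simp
      have c: "lo a i < clamp a x i" "clamp a x i < hi a i"
        using inside[OF x i] i by (auto simp: clamp_def)
      then have "?N * lo a i < ?N * clamp a x i" "?N * clamp a x i < ?N * hi a i" using Np by simp_all
      then have c2: "of_int (snd a i) < ?N * clamp a x i" "?N * clamp a x i < of_int (snd a i + 1)" unfolding Nlo .
      then have "\<lfloor>?N * clamp a x i\<rfloor> = snd a i" by (intro floor_unique) auto
      moreover have "\<lceil>?N * clamp a x i\<rceil> = snd a i + 1" using c2 by (intro ceiling_unique) auto
      moreover have "?N * lo a i \<le> ?N * y i" "?N * y i \<le> ?N * hi a i" using y[OF i] Np by simp_all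
      ultimately show "of_int \<lfloor>?N * clamp a x i\<rfloor> \<le> ?N * y i \<and> ?N * y i \<le> of_int \<lceil>?N * clamp a x i\<rceil>"
        unfolding Nlo by simp
    qed
  qed
  have g_cube: "x i \<in> {0<..<1}" if "g j x \<noteq> b j" "i < n" for j x i
  proof -
    have "cube_map n (Xs j) (b j) (g j)" using g unfolding cube_family_def by blast
    then show ?thesis using that by (rule cube_mapD(3))
  qed
  \<comment> \<open>Both extreme corners of the closed box belong to the support of \<open>g\<close>
    and hence to the open unit cube.\<close>
  have lohi01: "0 < lo a i" "hi a i < 1" if "a \<in> A" "i < n" for a i
  proof -
    have le: "lo a k \<le> hi a k" for k using lohi by (rule less_imp_le)
    have "g (fst a) (lo a) \<noteq> b (fst a)" by (rule in_box[OF that(1)]) (simp add: le)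
    then show "0 < lo a i" using g_cube[of "fst a" "lo a" i] that(2) by simp
    have "g (fst a) (hi a) \<noteq> b (fst a)" by (rule in_box[OF that(1)]) (simp add: le)
    then show "hi a i < 1" using g_cube[of "fst a" "hi a" i] that(2) by simp
  qed
  have "countable A"
  proof (rule countable_subset)
    show "A \<subseteq> UNIV \<times> {z. \<forall>i\<ge>n. z i = 0}" by (auto simp: A_def)
  qed (intro countable_SIGMA countable_int_lattice, auto)
  \<comment> \<open>Finiteness for each single \<open>j\<close> is what the continuity of that
    member asks for. The boxes of all members together may accumulate.\<close>
  have finA: "finite {z. (j, z) \<in> A}" for j
  proof (rule finite_subset)
    show "finite {z. \<forall>i. (i \<in> {..<n} \<longrightarrow> z i \<in> {0..int (N j)}) \<and> (i \<notin> {..<n} \<longrightarrow> z i = 0)}"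
      by (intro finite_set_of_finite_funs) auto
    show "{z. (j, z) \<in> A} \<subseteq> {z. \<forall>i. (i \<in> {..<n} \<longrightarrow> z i \<in> {0..int (N j)}) \<and> (i \<notin> {..<n} \<longrightarrow> z i = 0)}"
    proof (intro subsetI CollectI allI conjI impI)
      fix z i assume z: "z \<in> {z. (j, z) \<in> A}"
      show "z i = 0" if "i \<notin> {..<n}" using z that by (simp add: A_def)
      show "z i \<in> {0..int (N j)}" if i: "i \<in> {..<n}"
      proof -
        have "0 < lo (j, z) i" "hi (j, z) i < 1" using lohi01[of "(j, z)" i] z i by simp_all
        then have "0 < real_of_int (z i)" "real_of_int (z i) + 1 < real (N j)"
          using N[of j] by (simp_all add: lo_def hi_def zero_less_divide_iff)
        then show ?thesis by simp
      qed
    qed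
  qed
  have disjoint_boxes: "\<exists>i<n. hi a i \<le> lo c i \<or> hi c i \<le> lo a i" if a: "a \<in> A" "c \<in> A" "a \<noteq> c" for a c
  proof (rule ccontr)
    assume "\<not> ?thesis"
    then have ov: "lo c i < hi a i" "lo a i < hi c i" if "i < n" for i using that by auto
    \<comment> \<open>The larger of the two lower corners in each coordinate: a common point of the
      overlapping closed boxes. It forces equal members, hence equal grids and equal cells.\<close>
    define y where "y i = max (lo a i) (lo c i)" for i
    have "g (fst a) y \<noteq> b (fst a)" using ov lohi[of a] by (intro in_box[OF a(1)]) (auto simp: y_def less_imp_le)
    moreover have "g (fst c) y \<noteq> b (fst c)" using ov lohi[of c] by (intro in_box[OF a(2)]) (auto simp: y_def less_imp_le)
    ultimately have j: "fst a = fst c" using g unfolding cube_family_def by blast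
    have "snd a i = snd c i" for i
    proof (cases "i < n")
      case True
      have "real (N (fst a)) * lo c i < real (N (fst a)) * hi a i" "real (N (fst a)) * lo a i < real (N (fst a)) * hi c i"
        using ov[OF True] N by simp_all
      then have "of_int (snd c i) < real_of_int (snd a i + 1)" "of_int (snd a i) < real_of_int (snd c i + 1)"
        using Nlo[of a i] Nlo[of c i] j by simp_all
      then show ?thesis by linarith
    next
      case False
      then show ?thesis using a by (simp add: A_def)
    qed
    then show False using a(3) j by (auto simp: prod_eq_iff)
  qed
  have "\<exists>l' r' :: nat \<times> (nat \<Rightarrow> int) \<Rightarrow> real. (\<forall>a\<in>A. 0 \<le> l' a \<and> l' a < r' a \<and> r' a \<le> 1) \<and>
      (\<forall>a\<in>A. \<forall>c\<in>A. hi a 0 \<le> lo c 0 \<longrightarrow> r' a \<le> l' c) \<and>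
      (\<forall>a\<in>A. \<forall>c\<in>A. a \<noteq> c \<longrightarrow> r' a \<le> l' c \<or> r' c \<le> l' a)"
    using spread_intervals[OF \<open>countable A\<close>, of "\<lambda>a. lo a 0" "\<lambda>a. hi a 0"] lohi by simp
  then obtain l' r' :: "nat \<times> (nat \<Rightarrow> int) \<Rightarrow> real" where I: "(\<forall>a\<in>A. 0 \<le> l' a \<and> l' a < r' a \<and> r' a \<le> 1) \<and>
      (\<forall>a\<in>A. \<forall>c\<in>A. hi a 0 \<le> lo c 0 \<longrightarrow> r' a \<le> l' c) \<and>
      (\<forall>a\<in>A. \<forall>c\<in>A. a \<noteq> c \<longrightarrow> r' a \<le> l' c \<or> r' c \<le> l' a)"
    by (elim exE) (rule that)
  note I = I[THEN conjunct1, rule_format] I[THEN conjunct2, THEN conjunct1, rule_format]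
    I[THEN conjunct2, THEN conjunct2, rule_format]
  define cl where "cl t = max 0 (min 1 t)" for t :: real
  have cl: "0 \<le> cl t" "cl t \<le> 1" for t by (auto simp: cl_def)
  have ccl: "continuous_on UNIV (\<lambda>p :: (nat \<Rightarrow> real) \<times> real. cl (snd p))"
    unfolding cl_def by (intro continuous_intros)
  define L R where "L a t = (1 - t) * lo a 0 + t * l' a" and "R a t = (1 - t) * hi a 0 + t * r' a" for a t
  have mix: "(1 - t) * u + t * v \<le> (1 - t) * u' + t * v'" if "0 \<le> t" "t \<le> 1" "u \<le> u'" "v \<le> v'" for t u u' v v' :: real
    using that by (intro add_mono mult_left_mono) auto
  have LR: "L a t < R a t" if "a \<in> A" "0 \<le> t" "t \<le> 1" for a t
  proof (cases "t = 0")
    case True then show ?thesis using lohi by (simp add: L_def R_def)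
  next
    case False
    then have "t * l' a < t * r' a" using I(1)[OF that(1)] that by (intro mult_strict_left_mono) auto
    moreover have "(1 - t) * lo a 0 \<le> (1 - t) * hi a 0" using lohi[of a 0] that by (intro mult_left_mono) auto
    ultimately show ?thesis by (simp add: L_def R_def)
  qed
  have LR01: "0 \<le> L a t" "R a t \<le> 1" if "a \<in> A" "0 \<le> t" "t \<le> 1" for a t
  proof -
    show "0 \<le> L a t" using mix[of t 0 "lo a 0" 0 "l' a"] that lohi01[OF that(1) n] I(1)[OF that(1)] by (simp add: L_def)
    show "R a t \<le> 1" using mix[of t "hi a 0" 1 "r' a" 1] that lohi01[OF that(1) n] I(1)[OF that(1)] by (simp add: R_def)
  qed
  \<comment> \<open>The inverse of the motion: the current first edge is taken back affinely to the
    original one, and the result is clamped to the original box.\<close>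
  define mv where "mv a p = clamp a ((fst p)(0 := lo a 0 + (hi a 0 - lo a 0) *
      ((fst p 0 - L a (cl (snd p))) / (R a (cl (snd p)) - L a (cl (snd p))))))" for a and p :: "(nat \<Rightarrow> real) \<times> real"
  define F where "F a p = f (fst a) (mv a p)" for a p
  have contF: "continuous_map euclidean (Xs (fst a)) (F a)" if "a \<in> A" for a
    unfolding F_def
  proof (rule continuous_map_euclidean_compose[OF cube_mapD(1)[OF f]])
    show "continuous_on UNIV (mv a)"
    proof (rule continuous_on_coordinatewise_then_product)
      fix i
      have nz: "R a (cl t) - L a (cl t) \<noteq> 0" for t using LR[OF that cl] by (metis less_irrefl right_minus_eq)
      have "continuous_on UNIV (\<lambda>p :: (nat \<Rightarrow> real) \<times> real. lo a 0 + (hi a 0 - lo a 0) *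
        ((fst p 0 - L a (cl (snd p))) / (R a (cl (snd p)) - L a (cl (snd p)))))"
        using nz unfolding L_def R_def by (intro continuous_intros ccl) auto
      then show "continuous_on UNIV (\<lambda>p. mv a p i)"
        by (cases "i = 0"; cases "i < n") (auto simp: mv_def clamp_def intro!: continuous_intros)
    qed
  qed
  have F_in: "(i \<noteq> 0 \<longrightarrow> lo a i < x i \<and> x i < hi a i) \<and> (i = 0 \<longrightarrow> L a (cl t) < x i \<and> x i < R a (cl t))"
    if a: "a \<in> A" and nb: "F a (x, t) \<noteq> b (fst a)" and i: "i < n" for a x t i
  proof -
    define D where "D = R a (cl t) - L a (cl t)"
    have D: "0 < D" using LR[OF a cl] by (simp add: D_def)
    define y where "y = x(0 := lo a 0 + (hi a 0 - lo a 0) * ((x 0 - L a (cl t)) / D))"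
    have "f (fst a) (clamp a y) \<noteq> b (fst a)" using nb by (simp add: F_def mv_def y_def D_def)
    then have y: "lo a i < y i \<and> y i < hi a i" using i by (rule inside)
    show ?thesis
    proof (cases "i = 0")
      case True
      define q where "q = (x 0 - L a (cl t)) / D"
      have "0 < (hi a 0 - lo a 0) * q" using y True by (simp add: y_def q_def)
      then have "0 < q" using lohi[of a 0] by (simp add: zero_less_mult_iff)
      have "(hi a 0 - lo a 0) * q < (hi a 0 - lo a 0) * 1" using y True by (simp add: y_def q_def)
      then have "q < 1" using lohi[of a 0] by simp
      have "x 0 - L a (cl t) = q * D" using D by (simp add: q_def)
      moreover have "0 < q * D" "q * D < 1 * D" using \<open>0 < q\<close> \<open>q < 1\<close> D by simp_all
      ultimately have "0 < x 0 - L a (cl t)" "x 0 - L a (cl t) < R a (cl t) - L a (cl t)" by (simp_all add: D_def)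
      then show ?thesis using True by simp
    next
      case False
      then show ?thesis using y by (simp add: y_def)
    qed
  qed
  have F_disj: "a = c" if ac: "a \<in> A" "c \<in> A" and nb: "F a p \<noteq> b (fst a)" "F c p \<noteq> b (fst c)" for a c p
  proof (rule ccontr)
    assume "a \<noteq> c"
    obtain x t where p: "p = (x, t)" by (cases p)
    obtain i where i: "i < n" "hi a i \<le> lo c i \<or> hi c i \<le> lo a i" using disjoint_boxes[OF ac \<open>a \<noteq> c\<close>] by blast
    note xa = F_in[OF ac(1) nb(1)[unfolded p] i(1)] and xc = F_in[OF ac(2) nb(2)[unfolded p] i(1)]
    show False
    proof (cases "i = 0")
      case True
      have "R a (cl t) \<le> L c (cl t) \<or> R c (cl t) \<le> L a (cl t)"
        using i(2) unfolding True R_def L_def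
        by (meson mix[OF cl] I(2)[OF ac] I(2)[OF ac(2,1)])
      then show False using xa xc True by auto
    next
      case False
      then show False using xa xc i(2) by auto
    qed
  qed
  define \<Phi> where "\<Phi> j = assemble {z. (j, z) \<in> A} (b j) (\<lambda>z. F (j, z))" for j
  have \<Phi>_nb: "\<exists>z. (j, z) \<in> A \<and> F (j, z) p \<noteq> b j \<and> \<Phi> j p = F (j, z) p" if "\<Phi> j p \<noteq> b j" for j p
    using assemble_cases[of "{z. (j, z) \<in> A}" "b j" "\<lambda>z. F (j, z)" p] that unfolding \<Phi>_def by blast
  have "continuous_map euclidean (Xs j) (\<Phi> j)" for j
    unfolding \<Phi>_def
  proof (rule continuous_map_assemble)
    show "continuous_map euclidean (Xs j) (F (j, z))" if "z \<in> {z. (j, z) \<in> A}" for z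
      using contF[of "(j, z)"] that by simp
    show "z = z'" if "z \<in> {z. (j, z) \<in> A}" "z' \<in> {z. (j, z) \<in> A}" "F (j, z) w \<noteq> b j" "F (j, z') w \<noteq> b j" for w z z'
      using F_disj[of "(j, z)" "(j, z')" w] that by simp
    show "\<exists>T. openin euclidean T \<and> w \<in> T \<and> finite {a \<in> {z. (j, z) \<in> A}. \<exists>v\<in>T. F (j, a) v \<noteq> b j}" for w
      using finA[of j] by (intro exI[of _ UNIV]) auto
  qed (rule base)
  moreover have "cube_map n (Xs j) (b j) (\<lambda>x. \<Phi> j (x, t))" if cont: "continuous_map euclidean (Xs j) (\<Phi> j)" for j t
    unfolding cube_map_def
  proof (intro conjI allI impI continuous_map_slice cont)
    have "F a (x, t) = F a (y, t)" if xy: "\<forall>i\<in>{..<n}. x i = y i" for a x y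
      unfolding F_def by (rule dep_onD[OF cube_mapD(2)[OF f]]) (use xy n in \<open>auto simp: mv_def clamp_def\<close>)
    then show "dep_on {..<n} (\<lambda>x. \<Phi> j (x, t))"
      unfolding dep_on_def \<Phi>_def by (intro allI impI assemble_cong) blast
    show "\<Phi> j (x, t) = b j" if ex: "\<exists>i<n. x i \<notin> {0<..<1}" for x
    proof (rule ccontr)
      assume "\<Phi> j (x, t) \<noteq> b j"
      then obtain z where z: "(j, z) \<in> A" "F (j, z) (x, t) \<noteq> b j" using \<Phi>_nb by blast
      obtain i where i: "i < n" "x i \<notin> {0<..<1}" using ex by blast
      have "x i \<in> {0<..<1}"
        using F_in[OF z(1) _ i(1), of x t] z(2) LR01[OF z(1) cl[of t]] lohi01[OF z(1) i(1)]
        by (cases "i = 0") auto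
      then show False using i(2) by simp
    qed
  qed
  moreover have "j = k" if nb: "\<Phi> j p \<noteq> b j" "\<Phi> k p \<noteq> b k" for p j k
  proof -
    obtain z z' where "(j, z) \<in> A" "F (j, z) p \<noteq> b j" "(k, z') \<in> A" "F (k, z') p \<noteq> b k"
      using \<Phi>_nb[OF nb(1)] \<Phi>_nb[OF nb(2)] by blast
    then show ?thesis using F_disj[of "(j, z)" "(k, z')" p] by simp
  qed
  ultimately have "family_homotopy n Xs b \<Phi>" unfolding family_homotopy_def cube_homotopy_def by blast
  moreover have "\<Phi> j (x, 0) = f j x" for j x
  proof -
    have F0: "F a (x, 0) = f (fst a) (clamp a x)" for a
    proof -
      have "cl 0 = 0" by (simp add: cl_def)
      moreover have "x(0 := lo a 0 + (hi a 0 - lo a 0) * ((x 0 - lo a 0) / (hi a 0 - lo a 0))) = x"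
        using lohi[of a 0] by (auto simp: fun_eq_iff)
      ultimately show ?thesis by (simp add: F_def mv_def L_def R_def)
    qed
    have clf: "f (fst a) (clamp a x) = f (fst a) x" if "\<And>i. i < n \<Longrightarrow> lo a i \<le> x i \<and> x i \<le> hi a i" for a
      by (rule dep_onD[OF cube_mapD(2)[OF f]]) (use that in \<open>force simp: clamp_def\<close>)
    show ?thesis
    proof (cases "\<Phi> j (x, 0) = b j")
      case False
      then obtain z where z: "(j, z) \<in> A" "F (j, z) (x, 0) \<noteq> b j" "\<Phi> j (x, 0) = F (j, z) (x, 0)" using \<Phi>_nb by blast
      have "lo (j, z) i \<le> x i \<and> x i \<le> hi (j, z) i" if "i < n" for i
        using inside[OF _ that, of "(j, z)" x] z(2) F0[of "(j, z)"] by (simp add: less_imp_le)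
      from clf[of "(j, z)", OF this] show ?thesis using z(3) F0[of "(j, z)"] by simp
    next
      case True
      show ?thesis
      proof (rule ccontr)
        assume nb: "\<Phi> j (x, 0) \<noteq> f j x"
        define z where "z i = (if i < n then \<lfloor>real (N j) * x i\<rfloor> else 0)" for i
        have "lo (j, z) i \<le> x i \<and> x i \<le> hi (j, z) i" if i: "i < n" for i
        proof -
          have "of_int \<lfloor>real (N j) * x i\<rfloor> \<le> real (N j) * x i" "real (N j) * x i \<le> of_int \<lfloor>real (N j) * x i\<rfloor> + 1"
            by linarith+
          then show ?thesis using N[of j] i by (simp add: lo_def hi_def z_def field_simps)
        qed
        from clf[of "(j, z)", OF this] have fx: "f j (clamp (j, z) x) = f j x" by simp
        then have "\<exists>x. f j (clamp (j, z) x) \<noteq> b j" using nb True by metis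
        then have "(j, z) \<in> A" by (simp add: A_def z_def)
        moreover have "F (j, z) (x, 0) \<noteq> b j" using fx nb True F0[of "(j, z)"] by simp
        ultimately have "\<Phi> j (x, 0) \<noteq> b j"
          unfolding \<Phi>_def by (intro assemble_neq_base[of z]) auto
        then show False using True by simp
      qed
    qed
  qed
  moreover have "separated_along 0 b (\<lambda>j x. \<Phi> j (x, 1))"
    unfolding separated_along_def
  proof (intro allI impI)
    fix x y :: "nat \<Rightarrow> real" and j k assume xy: "x 0 = y 0" and nb: "\<Phi> j (x, 1) \<noteq> b j" "\<Phi> k (y, 1) \<noteq> b k"
    obtain z z' where z: "(j, z) \<in> A" "F (j, z) (x, 1) \<noteq> b j" "(k, z') \<in> A" "F (k, z') (y, 1) \<noteq> b k"
      using \<Phi>_nb[OF nb(1)] \<Phi>_nb[OF nb(2)] by blast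
    have cl1: "cl 1 = 1" by (simp add: cl_def)
    have "l' (j, z) < x 0 \<and> x 0 < r' (j, z)"
      using F_in[OF z(1) _ n, of x 1] z(2) by (simp add: cl1 L_def R_def)
    moreover have "l' (k, z') < y 0 \<and> y 0 < r' (k, z')"
      using F_in[OF z(3) _ n, of y 1] z(4) by (simp add: cl1 L_def R_def)
    ultimately have "(j, z) = (k, z')" using I(3)[OF z(1,3)] xy by force
    then show "j = k" by simp
  qed
  ultimately show ?thesis unfolding family_homotopic_def
    by (intro exI[of _ "\<lambda>j x. \<Phi> j (x, 1)"]) blast
qed

section \<open>Squeezing along the second axis\<close>

definition slot_lo :: "nat \<Rightarrow> real" where "slot_lo j = 1 / (real j + 2)"
text \<open>Consecutive slots share an end point, \<open>slot_hi (Suc j) = slot_lo j\<close>, so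
  infinitely many members find room in the unit interval.\<close>

definition slot_hi :: "nat \<Rightarrow> real" where "slot_hi j = 1 / (real j + 1)"

lemma slot: "0 < slot_lo j" "slot_lo j < slot_hi j" "slot_hi j \<le> 1"
  by (simp_all add: slot_lo_def slot_hi_def frac_less2)

lemma slot_unique:
  assumes "slot_lo j < y" "y < slot_hi j" "slot_lo k < y" "y < slot_hi k"
  shows "j = k"
proof -
  have le: "slot_hi m \<le> slot_lo l" if "l < m" for l m
    using that by (simp add: slot_hi_def slot_lo_def frac_le)
  show ?thesis using le[of j k] le[of k j] assms by (cases j k rule: linorder_cases) auto
qed

text \<open>Index 1 is the second coordinate. The substitution takes the slot of \<open>j\<close>
  onto the unit interval, so the support of the new map lies over the slot.\<close>

definition squeeze :: "nat \<Rightarrow> ((nat \<Rightarrow> real) \<Rightarrow> 'a) \<Rightarrow> (nat \<Rightarrow> real) \<Rightarrow> 'a" where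
  "squeeze j f x = f (x(1 := (x 1 - slot_lo j) / (slot_hi j - slot_lo j)))"

lemma affine_unit_iff:
  fixes l d y :: real assumes "0 < d"
  shows "(y - l) / d \<in> {0<..<1} \<longleftrightarrow> l < y \<and> y < l + d"
  using assms by (auto simp: field_simps)

text \<open>The unit interval, as an edge of the support, is moved linearly onto the slot of \<open>j\<close>.\<close>
definition squeeze_path :: "nat \<Rightarrow> ((nat \<Rightarrow> real) \<Rightarrow> 'a) \<Rightarrow> (nat \<Rightarrow> real) \<times> real \<Rightarrow> 'a" where
  "squeeze_path j f p = (let t = max 0 (min 1 (snd p)) in
     f ((fst p)(1 := (fst p 1 - t * slot_lo j) / (1 - t + t * (slot_hi j - slot_lo j)))))"

lemma squeeze_path_endpoints: "squeeze_path j f (x, 0) = f x" "squeeze_path j f (x, 1) = squeeze j f x"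
  by (simp_all add: squeeze_path_def squeeze_def)

text \<open>The second claim records that a point of the moving support keeps all coordinates except
  the second. Members separated along axis 0 therefore remain disjoint throughout.\<close>

lemma cube_homotopy_squeeze_path:
  assumes f: "cube_map n X b f" and n: "1 < n"
  shows "cube_homotopy n X b (squeeze_path j f)"
    and "\<And>x t i. squeeze_path j f (x, t) \<noteq> b \<Longrightarrow> i \<noteq> 1 \<Longrightarrow> \<exists>y. f y \<noteq> b \<and> y i = x i"
proof -
  define cl where "cl t = max 0 (min 1 t)" for t :: real
  have cl: "0 \<le> cl t" "cl t \<le> 1" for t by (auto simp: cl_def)
  have ccl: "continuous_on UNIV (\<lambda>p :: (nat \<Rightarrow> real) \<times> real. cl (snd p))"
    unfolding cl_def by (intro continuous_intros)
  \<comment> \<open>The length of the moving edge, between 1 and the width of the slot; its lower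
    end is at \<open>cl t * slot_lo j\<close>.\<close>
  define d where "d t = 1 - cl t + cl t * (slot_hi j - slot_lo j)" for t
  have d: "0 < d t" for t
  proof (cases "cl t = 0")
    case False
    then have "0 < cl t * (slot_hi j - slot_lo j)" using cl[of t] slot(2)[of j] by simp
    then show ?thesis using cl[of t] by (simp add: d_def)
  qed (simp add: d_def)
  define w where "w p = (fst p)(1 := (fst p 1 - cl (snd p) * slot_lo j) / d (snd p))" for p :: "(nat \<Rightarrow> real) \<times> real"
  have sq: "squeeze_path j f = (\<lambda>p. f (w p))"
    by (simp add: squeeze_path_def w_def d_def cl_def Let_def fun_eq_iff)
  have nz: "1 - cl t + cl t * (slot_hi j - slot_lo j) \<noteq> 0" for t using d[of t] by (simp add: d_def)
  have "continuous_on UNIV w" unfolding w_def d_def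
    by (intro continuous_on_fun_upd continuous_on_fst_UNIV continuous_intros ccl) (use nz in auto)
  with cube_mapD(1)[OF f] have cont: "continuous_map euclidean X (\<lambda>p. f (w p))"
    by (rule continuous_map_euclidean_compose)
  have "cube_map n X b (\<lambda>x. f (w (x, t)))" for t
    unfolding cube_map_def
  proof (intro conjI allI impI continuous_map_slice[OF cont])
    have "f (w (x, t)) = f (w (y, t))" if "\<forall>i\<in>{..<n}. x i = y i" for x y
      by (rule dep_onD[OF cube_mapD(2)[OF f]]) (use that n in \<open>simp add: w_def\<close>)
    then show "dep_on {..<n} (\<lambda>x. f (w (x, t)))" unfolding dep_on_def by blast
    show "f (w (x, t)) = b" if ex: "\<exists>i<n. x i \<notin> {0<..<1}" for x
    proof (rule ccontr)
      assume nb: "f (w (x, t)) \<noteq> b"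
      obtain i where i: "i < n" "x i \<notin> {0<..<1}" using ex by blast
      have wi: "w (x, t) i \<in> {0<..<1}" by (rule cube_mapD(3)[OF f nb i(1)])
      show False
      proof (cases "i = 1")
        case True
        then have "(x 1 - cl t * slot_lo j) / d t \<in> {0<..<1}" using wi by (simp add: w_def)
        then have "cl t * slot_lo j < x 1" "x 1 < cl t * slot_lo j + d t" using affine_unit_iff[OF d] by blast+
        moreover have "0 \<le> cl t * slot_lo j" using cl slot(1)[of j] by simp
        moreover have "cl t * slot_lo j + d t \<le> 1"
        proof -
          have "cl t * slot_hi j \<le> cl t * 1" using cl slot(3) by (intro mult_left_mono) auto
          then show ?thesis by (simp add: d_def algebra_simps)
        qed
        ultimately show False using i True by simp
      next
        case False
        then show False using wi i by (simp add: w_def)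
      qed
    qed
  qed
  then show "cube_homotopy n X b (squeeze_path j f)" using cont unfolding sq cube_homotopy_def by blast
  show "\<exists>y. f y \<noteq> b \<and> y i = x i" if "squeeze_path j f (x, t) \<noteq> b" "i \<noteq> 1" for x t i
    using that unfolding sq by (intro exI[of _ "w (x, t)"]) (simp add: w_def)
qed

lemma squeeze_support:
  assumes f: "cube_map n X b f" and n: "1 < n" and nb: "squeeze j f x \<noteq> b"
  shows "slot_lo j < x 1 \<and> x 1 < slot_hi j"
proof -
  let ?y = "x(1 := (x 1 - slot_lo j) / (slot_hi j - slot_lo j))"
  have "?y 1 \<in> {0<..<1}"
    using cube_mapD(3)[OF f, of ?y 1] nb n unfolding squeeze_def by blast
  then have "slot_lo j < x 1 \<and> x 1 < slot_lo j + (slot_hi j - slot_lo j)"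
    using affine_unit_iff[of "slot_hi j - slot_lo j" "x 1" "slot_lo j"] slot(2)[of j] by simp
  then show ?thesis by simp
qed

lemma cube_map_squeeze:
  assumes "cube_map n X b f" "1 < n"
  shows "cube_map n X b (squeeze j f)" "cube_homotopic n X b f (squeeze j f)"
proof -
  have "cube_map n X b (\<lambda>x. squeeze_path j f (x, 1))"
    using cube_homotopy_squeeze_path(1)[OF assms] by (simp add: cube_homotopy_def)
  then show "cube_map n X b (squeeze j f)" by (simp add: squeeze_path_endpoints)
  show "cube_homotopic n X b f (squeeze j f)"
    unfolding cube_homotopic_def
    by (intro exI[of _ "squeeze_path j f"]) (simp add: squeeze_path_endpoints cube_homotopy_squeeze_path(1)[OF assms])
qed

lemma cube_family_squeeze:
  assumes "\<And>j. cube_map n (Xs j) (b j) (f j)" "1 < n"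
  shows "cube_family n Xs b (\<lambda>j. squeeze j (f j))"
  unfolding cube_family_def
proof (intro conjI allI impI cube_map_squeeze assms)
  show "j = k" if "squeeze j (f j) x \<noteq> b j" "squeeze k (f k) x \<noteq> b k" for x j k
    using squeeze_support[OF assms(1,2) that(1)] squeeze_support[OF assms(1,2) that(2)]
      slot_unique[of j "x 1" k] by simp
qed

lemma family_homotopic_squeeze:
  assumes f: "\<And>j. cube_map n (Xs j) (b j) (f j)" and n: "1 < n" and sep: "separated_along 0 b f"
  shows "family_homotopic n Xs b f (\<lambda>j. squeeze j (f j))"
proof -
  have disj: "j = k" if nb: "squeeze_path j (f j) p \<noteq> b j" "squeeze_path k (f k) p \<noteq> b k" for p j k
  proof -
    obtain x t where p: "p = (x, t)" by (cases p)
    obtain y where y: "f j y \<noteq> b j" "y 0 = x 0"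
      using cube_homotopy_squeeze_path(2)[OF f n, of j j x t 0] nb(1) p by auto
    obtain z where z: "f k z \<noteq> b k" "z 0 = x 0"
      using cube_homotopy_squeeze_path(2)[OF f n, of k k x t 0] nb(2) p by auto
    show ?thesis using sep y z unfolding separated_along_def by metis
  qed
  have "family_homotopy n Xs b (\<lambda>j. squeeze_path j (f j))"
    unfolding family_homotopy_def
    by (intro conjI allI impI cube_homotopy_squeeze_path(1)[OF f n]) (rule disj)
  then show ?thesis unfolding family_homotopic_def
    by (intro exI[of _ "\<lambda>j. squeeze_path j (f j)"]) (simp add: squeeze_path_endpoints)
qed

text \<open>Squeezing a homotopy slice by slice keeps it over the slot of its member, and distinct
  slots are disjoint. So arbitrary homotopies of the members may run simultaneously.\<close>

lemma family_homotopic_squeeze_mono: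
  assumes hom: "\<And>j. cube_homotopic n (Xs j) (b j) (f j) (g j)" and n: "1 < n"
  shows "family_homotopic n Xs b (\<lambda>j. squeeze j (f j)) (\<lambda>j. squeeze j (g j))"
proof -
  have "\<forall>j. \<exists>\<Phi>. cube_homotopy n (Xs j) (b j) \<Phi> \<and> (\<forall>x. \<Phi> (x, 0) = f j x) \<and> (\<forall>x. \<Phi> (x, 1) = g j x)"
    using hom by (simp add: cube_homotopic_def)
  from choice[OF this] obtain \<Phi> where
    \<Phi>: "\<forall>j. cube_homotopy n (Xs j) (b j) (\<Phi> j) \<and> (\<forall>x. \<Phi> j (x, 0) = f j x) \<and> (\<forall>x. \<Phi> j (x, 1) = g j x)" ..
  define \<Psi> where "\<Psi> j p = squeeze j (\<lambda>x. \<Phi> j (x, snd p)) (fst p)" for j and p :: "(nat \<Rightarrow> real) \<times> real"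
  have slice: "cube_map n (Xs j) (b j) (\<lambda>x. \<Phi> j (x, t))" for j t using \<Phi> by (simp add: cube_homotopy_def)
  have \<Psi>hom: "cube_homotopy n (Xs j) (b j) (\<Psi> j)" for j
    unfolding cube_homotopy_def
  proof (intro conjI allI)
    have "continuous_map euclidean (Xs j) (\<Phi> j)" using \<Phi> by (simp add: cube_homotopy_def)
    moreover have "continuous_on UNIV (\<lambda>p :: (nat \<Rightarrow> real) \<times> real.
        ((fst p)(1 := (fst p 1 - slot_lo j) / (slot_hi j - slot_lo j)), snd p))"
      using slot(2)[of j] by (intro continuous_on_Pair continuous_on_fun_upd continuous_on_fst_UNIV continuous_intros) auto
    ultimately show "continuous_map euclidean (Xs j) (\<Psi> j)"
      unfolding \<Psi>_def [abs_def] squeeze_def by (rule continuous_map_euclidean_compose)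
    show "cube_map n (Xs j) (b j) (\<lambda>x. \<Psi> j (x, t))" for t
      using cube_map_squeeze(1)[OF slice n] by (simp add: \<Psi>_def)
  qed
  have disj: "j = k" if "\<Psi> j p \<noteq> b j" "\<Psi> k p \<noteq> b k" for p j k
    using squeeze_support[OF slice n that(1)[unfolded \<Psi>_def]] squeeze_support[OF slice n that(2)[unfolded \<Psi>_def]]
      slot_unique[of j "fst p 1" k] by simp
  have "family_homotopy n Xs b \<Psi>"
    unfolding family_homotopy_def by (intro conjI allI impI \<Psi>hom) (rule disj)
  moreover have "\<Phi> j (x, 0) = f j x" "\<Phi> j (x, 1) = g j x" for j x
    using \<Phi>[rule_format, of j] by simp_all
  then have "\<Psi> j (x, 0) = squeeze j (f j) x" "\<Psi> j (x, 1) = squeeze j (g j) x" for j x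
    by (simp_all add: \<Psi>_def squeeze_def)
  ultimately show ?thesis unfolding family_homotopic_def by (intro exI[of _ \<Psi>]) simp
qed

section \<open>Comparison of families member by member\<close>

locale hawaiian_family =
  fixes n :: nat and Xs :: "nat \<Rightarrow> 'a topology" and b :: "nat \<Rightarrow> 'a"
  assumes two_le: "2 \<le> n" and base: "\<And>j. b j \<in> topspace (Xs j)"
    and hausdorff: "\<And>j. Hausdorff_space (Xs j)"
    and contractible: "\<And>j. contractible_base (Xs j) (b j)"
    and conn: "\<And>j k. k < n \<Longrightarrow> is_singleton (homotopy_group k (Xs j) (b j))"
begin

lemma one_less: "1 < n"
  using two_le by simp

text \<open>The members are made cellular independently, each with its own mesh \<open>N j\<close>.
  They cannot collide because each stays inside its own original support.\<close>

lemma family_homotopic_separated: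
  assumes g: "cube_family n Xs b g"
  shows "\<exists>h. family_homotopic n Xs b g h \<and> separated_along 0 b h"
proof -
  have gm: "cube_map n (Xs j) (b j) (g j)" for j using g by (simp add: cube_family_def)
  define P where "P j \<Phi> N \<longleftrightarrow> 0 < N \<and> cube_homotopy n (Xs j) (b j) \<Phi> \<and> (\<forall>x. \<Phi> (x, 0) = g j x) \<and>
    (\<forall>x t. \<Phi> (x, t) \<noteq> b j \<longrightarrow> g j x \<noteq> b j) \<and> (\<forall>x i. i < n \<longrightarrow> real N * x i \<in> \<int> \<longrightarrow> \<Phi> (x, 1) = b j) \<and>
    (\<forall>x y. \<Phi> (x, 1) \<noteq> b j \<longrightarrow>
      (\<forall>i<n. of_int \<lfloor>real N * x i\<rfloor> \<le> real N * y i \<and> real N * y i \<le> of_int \<lceil>real N * x i\<rceil>) \<longrightarrow> g j y \<noteq> b j)"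
    for j N and \<Phi> :: "(nat \<Rightarrow> real) \<times> real \<Rightarrow> 'a"
  have "\<exists>\<Phi> N. P j \<Phi> N" for j
  proof (rule cube_map_cellular[OF hausdorff base contractible conn gm, of j])
    fix N :: nat and \<Phi> :: "(nat \<Rightarrow> real) \<times> real \<Rightarrow> 'a"
    assume *: "0 < N" "cube_homotopy n (Xs j) (b j) \<Phi>" "\<And>x. \<Phi> (x, 0) = g j x"
      "\<And>x t. \<Phi> (x, t) \<noteq> b j \<Longrightarrow> g j x \<noteq> b j"
      "\<And>x i. i < n \<Longrightarrow> real N * x i \<in> \<int> \<Longrightarrow> \<Phi> (x, 1) = b j"
      "\<And>x y. \<Phi> (x, 1) \<noteq> b j \<Longrightarrow> (\<And>i. i < n \<Longrightarrow> of_int \<lfloor>real N * x i\<rfloor> \<le> real N * y i \<and> real N * y i \<le> of_int \<lceil>real N * x i\<rceil>) \<Longrightarrow> g j y \<noteq> b j"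
    have "g j y \<noteq> b j" if nb: "\<Phi> (x, 1) \<noteq> b j" and c: "\<forall>i<n. of_int \<lfloor>real N * x i\<rfloor> \<le> real N * y i \<and> real N * y i \<le> of_int \<lceil>real N * x i\<rceil>" for x y
      by (rule *(6)[OF nb c[rule_format]])
    note cell = this
    have "P j \<Phi> N" unfolding P_def
    proof (intro conjI allI impI)
      show "g j x \<noteq> b j" if "\<Phi> (x, t) \<noteq> b j" for x t using that by (rule *(4))
      show "\<Phi> (x, 1) = b j" if "i < n" "real N * x i \<in> \<int>" for x i using that by (rule *(5))
      show "g j y \<noteq> b j" if "\<Phi> (x, 1) \<noteq> b j"
        "\<forall>i<n. of_int \<lfloor>real N * x i\<rfloor> \<le> real N * y i \<and> real N * y i \<le> of_int \<lceil>real N * x i\<rceil>" for x y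
        using that by (rule cell)
    qed (rule *)+
    then show ?thesis by blast
  qed
  then have "\<forall>j. \<exists>\<Phi>N. P j (fst \<Phi>N) (snd \<Phi>N)" by simp
  from choice[OF this] obtain \<Phi>N where \<Phi>N: "\<forall>j. P j (fst (\<Phi>N j)) (snd (\<Phi>N j))" ..
  define \<Phi> N where "\<Phi> j = fst (\<Phi>N j)" and "N j = snd (\<Phi>N j)" for j
  have P: "P j (\<Phi> j) (N j)" for j using \<Phi>N by (simp add: \<Phi>_def N_def)
  note P1 = P[unfolded P_def, THEN conjunct1]
  note P' = P[unfolded P_def, THEN conjunct2]
  note P2 = P'[THEN conjunct1]
  note P3 = P'[THEN conjunct2, THEN conjunct1, rule_format]
  note P4 = P'[THEN conjunct2, THEN conjunct2, THEN conjunct1, rule_format]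
  note P5 = P'[THEN conjunct2, THEN conjunct2, THEN conjunct2, THEN conjunct1, rule_format]
  note P6 = P'[THEN conjunct2, THEN conjunct2, THEN conjunct2, THEN conjunct2, rule_format]
  define f where "f j x = \<Phi> j (x, 1)" for j x
  have "j = k" if nb: "\<Phi> j p \<noteq> b j" "\<Phi> k p \<noteq> b k" for p j k
  proof -
    obtain x t where p: "p = (x, t)" by (cases p)
    have "g j x \<noteq> b j" "g k x \<noteq> b k" using P4 nb unfolding p by auto
    then show ?thesis using g[unfolded cube_family_def, THEN conjunct2, rule_format] by simp
  qed
  then have fh: "family_homotopy n Xs b \<Phi>"
    using P2 by (simp add: family_homotopy_def)
  then have gf: "family_homotopic n Xs b g f"
    unfolding family_homotopic_def by (intro exI[of _ \<Phi>]) (simp add: f_def P3)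
  have "\<exists>h. family_homotopic n Xs b f h \<and> separated_along 0 b h"
  proof (rule cellular_family_separate[OF _ base g, of N])
    show "0 < n" using two_le by simp
    show "0 < N j" for j by (rule P1)
    show "cube_map n (Xs j) (b j) (f j)" for j
      using fh by (simp add: family_homotopy_def cube_homotopy_def f_def [abs_def])
    show "f j x = b j" if "i < n" "real (N j) * x i \<in> \<int>" for j x i
      using P5[where i = i and j = j and x = x] that by (simp add: f_def)
    show "g j y \<noteq> b j" if "f j x \<noteq> b j"
      "\<And>i. i < n \<Longrightarrow> of_int \<lfloor>real (N j) * x i\<rfloor> \<le> real (N j) * y i \<and> real (N j) * y i \<le> of_int \<lceil>real (N j) * x i\<rceil>" for j x y
      by (rule P6[OF that(1)[unfolded f_def] that(2)])
  qed
  then show ?thesis using family_homotopic_trans[OF gf] by blast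
qed

text \<open>The normal form of a family. The separated family \<open>h\<close> depends on choices,
  but once it is squeezed its members can be deformed back to those of \<open>g\<close> inside their
  slots, which removes \<open>h\<close> from the result.\<close>

lemma cube_family_homotopic_squeeze:
  assumes g: "cube_family n Xs b g"
  shows "family_homotopic n Xs b g (\<lambda>j. squeeze j (g j))"
proof -
  obtain h where h: "family_homotopic n Xs b g h" "separated_along 0 b h"
    using family_homotopic_separated[OF g] by blast
  then obtain \<Phi> where \<Phi>: "family_homotopy n Xs b \<Phi>" "\<forall>j x. \<Phi> j (x, 1) = h j x"
    unfolding family_homotopic_def by blast
  have "cube_map n (Xs j) (b j) (\<lambda>x. \<Phi> j (x, 1))" for j
    using \<Phi>(1) by (simp add: family_homotopy_def cube_homotopy_def)
  then have hm: "cube_map n (Xs j) (b j) (h j)" for j using \<Phi>(2) by simp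
  have "family_homotopic n Xs b g (\<lambda>j. squeeze j (h j))"
    by (rule family_homotopic_trans[OF h(1) family_homotopic_squeeze[OF hm one_less h(2)]])
  moreover have "family_homotopic n Xs b (\<lambda>j. squeeze j (h j)) (\<lambda>j. squeeze j (g j))"
    by (rule family_homotopic_squeeze_mono[OF cube_homotopic_sym[OF family_homotopic_component[OF h(1)]] one_less])
  ultimately show ?thesis by (rule family_homotopic_trans)
qed

lemma family_homotopic_if_components:
  assumes "cube_family n Xs b f" "cube_family n Xs b g" "\<And>j. cube_homotopic n (Xs j) (b j) (f j) (g j)"
  shows "family_homotopic n Xs b f g"
  by (rule family_homotopic_trans[OF cube_family_homotopic_squeeze[OF assms(1)]
        family_homotopic_trans[OF family_homotopic_squeeze_mono[OF assms(3) one_less]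
          family_homotopic_sym[OF cube_family_homotopic_squeeze[OF assms(2)]]]])

end

section \<open>The inverse limit of the wedges\<close>

abbreviation based_homotopic ::
  "nat \<Rightarrow> 'a topology \<Rightarrow> 'a \<Rightarrow> ((nat \<Rightarrow> real) \<Rightarrow> 'a) \<Rightarrow> ((nat \<Rightarrow> real) \<Rightarrow> 'a) \<Rightarrow> bool" where
  "based_homotopic n Z z \<equiv> homotopic_with (\<lambda>h. h sphere_base = z) (nsphere n) Z"

lemma hclass_self: "f \<in> based_maps n Z z \<Longrightarrow> f \<in> hclass n Z z f"
  by (simp add: hclass_def based_maps_def)

lemma hclass_eq_iff:
  assumes "f \<in> based_maps n Z z" "g \<in> based_maps n Z z"
  shows "hclass n Z z f = hclass n Z z g \<longleftrightarrow> based_homotopic n Z z f g"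
proof
  assume "hclass n Z z f = hclass n Z z g"
  then have "g \<in> hclass n Z z f" using hclass_self[OF assms(2)] by simp
  then show "based_homotopic n Z z f g" by (simp add: hclass_def)
next
  assume fg: "based_homotopic n Z z f g"
  have "based_homotopic n Z z f h \<longleftrightarrow> based_homotopic n Z z g h" for h
    using fg homotopic_with_trans homotopic_with_symD by blast
  then show "hclass n Z z f = hclass n Z z g" by (simp add: hclass_def)
qed

lemma based_maps_compose:
  assumes "f \<in> based_maps n Z z" "continuous_map Z Y \<phi>" "\<phi> z = y"
  shows "\<phi> \<circ> f \<in> based_maps n Y y"
  using assms continuous_map_compose[of "nsphere n" Z f Y \<phi>] by (simp add: based_maps_def)

lemma based_homotopic_compose:
  assumes "based_homotopic n Z z f g" "continuous_map Z Y \<phi>" "\<phi> z = y"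
  shows "based_homotopic n Y y (\<phi> \<circ> f) (\<phi> \<circ> g)"
  using assms(1,2) by (rule homotopic_with_compose_continuous_map_left) (simp add: assms(3))

lemma based_homotopic_equal:
  assumes "f \<in> based_maps n Z z" "g \<in> based_maps n Z z" "\<And>u. u \<in> topspace (nsphere n) \<Longrightarrow> f u = g u"
  shows "based_homotopic n Z z f g"
  using assms by (intro homotopic_with_equal) (auto simp: based_maps_def)

lemma homotopy_groupE:
  assumes "C \<in> homotopy_group n Z z"
  obtains f where "f \<in> based_maps n Z z" "C = hclass n Z z f"
  using assms by (auto simp: homotopy_group_def)

text \<open>Composition respects based homotopy, so the representative picked by \<open>SOME\<close>
  in \<open>induced\<close> does not matter.\<close>

lemma induced_hclass:
  assumes f: "f \<in> based_maps n Z z" and \<phi>: "continuous_map Z Y \<phi>" "\<phi> z = y"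
  shows "induced n Y y \<phi> (hclass n Z z f) = hclass n Y y (\<phi> \<circ> f)"
proof -
  define g where "g = (SOME g. g \<in> hclass n Z z f)"
  have "g \<in> hclass n Z z f" unfolding g_def
    by (rule someI[of "\<lambda>g. g \<in> hclass n Z z f", OF hclass_self[OF f]])
  then have g: "g \<in> based_maps n Z z" "based_homotopic n Z z f g" by (auto simp: hclass_def)
  have "based_homotopic n Y y (\<phi> \<circ> f) (\<phi> \<circ> g)" by (rule based_homotopic_compose[OF g(2) \<phi>])
  then have "hclass n Y y (\<phi> \<circ> f) = hclass n Y y (\<phi> \<circ> g)"
    using hclass_eq_iff[OF based_maps_compose[OF f \<phi>] based_maps_compose[OF g(1) \<phi>]] by blast
  then show ?thesis by (simp add: induced_def g_def)
qed

section \<open>Finite wedges and their projections\<close>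

lemma openin_wedge:
  "openin (wedge Xs b i) U \<longleftrightarrow> U \<subseteq> wedge_set Xs b i \<and>
    (\<forall>j\<le>i. openin (Xs j) {p \<in> topspace (Xs j). wedge_incl b j p \<in> U})"
proof -
  have "istopology (\<lambda>U. U \<subseteq> wedge_set Xs b i \<and>
      (\<forall>j\<le>i. openin (Xs j) {p \<in> topspace (Xs j). wedge_incl b j p \<in> U}))" (is "istopology ?L")
    unfolding istopology_def
  proof (intro conjI allI impI)
    fix S T assume ST: "?L S" "?L T"
    then show "S \<inter> T \<subseteq> wedge_set Xs b i" by blast
    show "openin (Xs j) {p \<in> topspace (Xs j). wedge_incl b j p \<in> S \<inter> T}" if "j \<le> i" for j
    proof -
      have "{p \<in> topspace (Xs j). wedge_incl b j p \<in> S \<inter> T}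
        = {p \<in> topspace (Xs j). wedge_incl b j p \<in> S} \<inter> {p \<in> topspace (Xs j). wedge_incl b j p \<in> T}" by blast
      then show ?thesis using ST that by (simp add: openin_Int)
    qed
  next
    fix K assume K: "\<forall>S\<in>K. ?L S"
    then show "\<Union>K \<subseteq> wedge_set Xs b i" by blast
    show "openin (Xs j) {p \<in> topspace (Xs j). wedge_incl b j p \<in> \<Union>K}" if "j \<le> i" for j
    proof -
      have "{p \<in> topspace (Xs j). wedge_incl b j p \<in> \<Union>K}
        = (\<Union>S\<in>K. {p \<in> topspace (Xs j). wedge_incl b j p \<in> S})" by blast
      then show ?thesis using K that by (auto intro!: openin_Union)
    qed
  qed
  then show ?thesis by (simp add: wedge_def)
qed

lemma topspace_wedge: "topspace (wedge Xs b i) = wedge_set Xs b i"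
proof (rule antisym)
  show "topspace (wedge Xs b i) \<subseteq> wedge_set Xs b i"
    using openin_topspace[of "wedge Xs b i"] unfolding openin_wedge by blast
  have "{p \<in> topspace (Xs j). wedge_incl b j p \<in> wedge_set Xs b i} = topspace (Xs j)" if "j \<le> i" for j
    using that by (auto simp: wedge_set_def)
  then have "openin (wedge Xs b i) (wedge_set Xs b i)" by (simp add: openin_wedge)
  then show "wedge_set Xs b i \<subseteq> topspace (wedge Xs b i)" by (rule openin_subset)
qed

lemma continuous_map_wedge_incl:
  assumes "j \<le> i"
  shows "continuous_map (Xs j) (wedge Xs b i) (wedge_incl b j)"
  unfolding continuous_map_def topspace_wedge openin_wedge
  using assms by (auto simp: wedge_set_def)

lemma wedge_set_cases:
  assumes "q \<in> wedge_set Xs b i"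
  obtains "q = None" | j p where "j \<le> i" "p \<in> topspace (Xs j)" "p \<noteq> b j" "q = Some (j, p)"
  using assms by (auto simp: wedge_set_def wedge_incl_def split: if_splits)

text \<open>The universal property of the quotient of the disjoint union.\<close>

lemma continuous_map_from_wedge:
  assumes base: "\<And>j. b j \<in> topspace (Xs j)"
    and f: "\<And>j. j \<le> i \<Longrightarrow> continuous_map (Xs j) Y (\<lambda>p. f (wedge_incl b j p))"
  shows "continuous_map (wedge Xs b i) Y f"
  unfolding continuous_map_def topspace_wedge
proof (intro conjI allI impI funcsetI)
  have incl: "f (wedge_incl b j p) \<in> topspace Y" if "j \<le> i" "p \<in> topspace (Xs j)" for j p
    using f[OF that(1)] that(2) by (auto simp: continuous_map_def)
  show "f q \<in> topspace Y" if "q \<in> wedge_set Xs b i" for q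
    using that
  proof (cases rule: wedge_set_cases)
    case 1
    then show ?thesis using incl[of 0 "b 0"] base by (simp add: wedge_incl_def)
  next
    case (2 j p)
    then show ?thesis using incl[of j p] by (simp add: wedge_incl_def)
  qed
  fix U assume U: "openin Y U"
  have "{p \<in> topspace (Xs j). wedge_incl b j p \<in> {q \<in> wedge_set Xs b i. f q \<in> U}}
      = {p \<in> topspace (Xs j). f (wedge_incl b j p) \<in> U}" if "j \<le> i" for j
    using that by (auto simp: wedge_set_def)
  moreover have "openin (Xs j) {p \<in> topspace (Xs j). f (wedge_incl b j p) \<in> U}" if "j \<le> i" for j
    by (rule openin_continuous_map_preimage[OF f[OF that] U])
  ultimately show "openin (wedge Xs b i) {q \<in> wedge_set Xs b i. f q \<in> U}"
    by (simp add: openin_wedge)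
qed

text \<open>The retraction onto one summand, with values in that summand rather than in a smaller
  wedge. It is total in \<open>j\<close>; on the wedge up to \<open>i\<close> it is constant for j >
  i.\<close>

definition wedge_proj :: "(nat \<Rightarrow> 'a) \<Rightarrow> nat \<Rightarrow> (nat \<times> 'a) option \<Rightarrow> 'a" where
  "wedge_proj b j q = (case q of None \<Rightarrow> b j | Some (k, p) \<Rightarrow> if k = j then p else b j)"

lemma wedge_proj_None [simp]: "wedge_proj b j None = b j"
  by (simp add: wedge_proj_def)

lemma wedge_proj_incl: "wedge_proj b j (wedge_incl b k p) = (if k = j then p else b j)"
  by (simp add: wedge_proj_def wedge_incl_def)

lemma wedge_proj_unique: "wedge_proj b j q \<noteq> b j \<Longrightarrow> wedge_proj b k q \<noteq> b k \<Longrightarrow> j = k"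
  by (auto simp: wedge_proj_def split: option.splits if_splits)

text \<open>A point of the wedge is thus the same as a tuple of points of the summands with at most
  one entry off the base point.\<close>

lemma wedge_proj_eqI:
  assumes "q \<in> wedge_set Xs b i" "q' \<in> wedge_set Xs b i" "\<And>j. j \<le> i \<Longrightarrow> wedge_proj b j q = wedge_proj b j q'"
  shows "q = q'"
proof -
  have *: "q = q'" if q: "q = Some (j, p)" "j \<le> i" "p \<noteq> b j" and eq: "wedge_proj b j q = wedge_proj b j q'" for q q' :: "(nat \<times> 'a) option" and j p
    using q eq by (auto simp: wedge_proj_def split: option.splits if_splits)
  from assms(1) show ?thesis
  proof (cases rule: wedge_set_cases)
    case (2 j p)
    then show ?thesis using *[of q j p q'] assms(3) by blast
  next
    case 1
    from assms(2) show ?thesis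
    proof (cases rule: wedge_set_cases)
      case (2 j p)
      then show ?thesis using *[of q' j p q] assms(3)[of j] by simp
    qed (use 1 in simp)
  qed
qed

lemma continuous_map_wedge_proj:
  assumes "\<And>j. b j \<in> topspace (Xs j)"
  shows "continuous_map (wedge Xs b i) (Xs j) (wedge_proj b j)"
proof (rule continuous_map_from_wedge[where Xs = Xs and b = b, OF assms])
  show "continuous_map (Xs k) (Xs j) (\<lambda>p. wedge_proj b j (wedge_incl b k p))" for k
    unfolding wedge_proj_incl using assms by (cases "k = j") auto
qed

lemma collapse_None [simp]: "collapse k i None = None"
  by (simp add: collapse_def)

lemma wedge_proj_collapse: "j \<le> k \<Longrightarrow> wedge_proj b j (collapse k i q) = wedge_proj b j q"
  by (auto simp: wedge_proj_def collapse_def split: option.splits)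

lemma continuous_map_collapse:
  assumes "\<And>j. b j \<in> topspace (Xs j)"
  shows "continuous_map (wedge Xs b i) (wedge Xs b k) (collapse k i)"
proof (rule continuous_map_from_wedge[where Xs = Xs and b = b, OF assms])
  show "continuous_map (Xs j) (wedge Xs b k) (\<lambda>p. collapse k i (wedge_incl b j p))" for j
  proof (cases "j \<le> k")
    case True
    then have "(\<lambda>p. collapse k i (wedge_incl b j p)) = wedge_incl b j"
      by (auto simp: wedge_incl_def collapse_def)
    then show ?thesis using continuous_map_wedge_incl[OF True] by simp
  next
    case False
    then have "(\<lambda>p. collapse k i (wedge_incl b j p)) = (\<lambda>p. None)"
      by (auto simp: wedge_incl_def collapse_def)
    then show ?thesis by (simp add: topspace_wedge wedge_set_def)
  qed
qed

section \<open>Families of maps as maps into the limit\<close>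

definition disjoint_supports :: "(nat \<Rightarrow> 'a) \<Rightarrow> (nat \<Rightarrow> 'w \<Rightarrow> 'a) \<Rightarrow> bool" where
  "disjoint_supports b g \<longleftrightarrow> (\<forall>w j k. g j w \<noteq> b j \<longrightarrow> g k w \<noteq> b k \<longrightarrow> j = k)"

text \<open>The way back from a family to a map into a wedge, inverse to taking projections when the
  supports are disjoint.\<close>

definition wedge_map :: "(nat \<Rightarrow> 'a) \<Rightarrow> nat \<Rightarrow> (nat \<Rightarrow> 'w \<Rightarrow> 'a) \<Rightarrow> 'w \<Rightarrow> (nat \<times> 'a) option" where
  "wedge_map b i g = assemble {..i} None (\<lambda>j w. wedge_incl b j (g j w))"

definition limit_map :: "(nat \<Rightarrow> 'a) \<Rightarrow> (nat \<Rightarrow> 'w \<Rightarrow> 'a) \<Rightarrow> 'w \<Rightarrow> nat \<Rightarrow> (nat \<times> 'a) option" where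
  "limit_map b g w = (\<lambda>i. wedge_map b i g w)"

lemma wedge_incl_eq_None: "wedge_incl b j p = None \<longleftrightarrow> p = b j"
  by (simp add: wedge_incl_def)

lemma wedge_map_eq:
  assumes "disjoint_supports b g" "j \<le> i" "g j w \<noteq> b j"
  shows "wedge_map b i g w = Some (j, g j w)"
proof -
  have "wedge_map b i g w = wedge_incl b j (g j w)"
    unfolding wedge_map_def
    by (rule assemble_eq) (use assms in \<open>auto simp: wedge_incl_eq_None disjoint_supports_def\<close>)
  then show ?thesis using assms by (simp add: wedge_incl_def)
qed

lemma wedge_map_None: "(\<And>j. j \<le> i \<Longrightarrow> g j w = b j) \<Longrightarrow> wedge_map b i g w = None"
  unfolding wedge_map_def by (rule assemble_base) (simp add: wedge_incl_def)

lemma wedge_proj_wedge_map: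
  assumes g: "disjoint_supports b g" and "j \<le> i"
  shows "wedge_proj b j (wedge_map b i g w) = g j w"
proof (cases "\<exists>k\<le>i. g k w \<noteq> b k")
  case True
  then obtain k where k: "k \<le> i" "g k w \<noteq> b k" by blast
  then have *: "wedge_map b i g w = Some (k, g k w)" by (intro wedge_map_eq g)
  show ?thesis
  proof (cases "k = j")
    case False
    then have "g j w = b j" using g k unfolding disjoint_supports_def by blast
    then show ?thesis using False by (simp add: * wedge_proj_def)
  qed (simp add: * wedge_proj_def)
next
  case False
  then show ?thesis using assms(2) by (subst wedge_map_None) auto
qed

lemma collapse_wedge_map:
  assumes g: "disjoint_supports b g" and "k \<le> i"
  shows "collapse k i (wedge_map b i g w) = wedge_map b k g w"
proof (cases "\<exists>j\<le>i. g j w \<noteq> b j")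
  case True
  then obtain j where j: "j \<le> i" "g j w \<noteq> b j" by blast
  then have *: "wedge_map b i g w = Some (j, g j w)" by (intro wedge_map_eq g)
  show ?thesis
  proof (cases "j \<le> k")
    case True
    then show ?thesis using wedge_map_eq[OF g True j(2)] by (simp add: * collapse_def)
  next
    case False
    have "g l w = b l" if "l \<le> k" for l
      using g j False that unfolding disjoint_supports_def by blast
    then show ?thesis using False by (subst wedge_map_None) (auto simp: * collapse_def)
  qed
next
  case False
  then have "wedge_map b i g w = None" "wedge_map b k g w = None"
    using assms(2) by (auto intro!: wedge_map_None)
  then show ?thesis by simp
qed

text \<open>Only the finitely many indices up to \<open>i\<close> enter, so local finiteness is
  automatic. As the limit carries the topology of its components, infinite families need no further
  condition.\<close>

lemma continuous_map_wedge_map: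
  assumes g: "disjoint_supports b g" and cont: "\<And>j. continuous_map W (Xs j) (g j)"
  shows "continuous_map W (wedge Xs b i) (wedge_map b i g)"
  unfolding wedge_map_def
proof (rule continuous_map_assemble)
  show "continuous_map W (wedge Xs b i) (\<lambda>w. wedge_incl b j (g j w))" if "j \<in> {..i}" for j
    using continuous_map_compose[OF cont continuous_map_wedge_incl[of j i Xs b]] that by (simp add: o_def)
  show "None \<in> topspace (wedge Xs b i)" by (simp add: topspace_wedge wedge_set_def)
  show "j = k" if "wedge_incl b j (g j w) \<noteq> None" "wedge_incl b k (g k w) \<noteq> None" for w j k
    using that g unfolding wedge_incl_eq_None disjoint_supports_def by blast
  show "\<exists>T. openin W T \<and> w \<in> T \<and> finite {a \<in> {..i}. \<exists>v\<in>T. wedge_incl b a (g a v) \<noteq> None}"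
    if "w \<in> topspace W" for w
    using that by (intro exI[of _ "topspace W"]) simp
qed

lemma topspace_hawaiian_limit:
  "y \<in> topspace (hawaiian_limit Xs b) \<longleftrightarrow>
    (\<forall>i. y i \<in> wedge_set Xs b i) \<and> (\<forall>k i. k \<le> i \<longrightarrow> y k = collapse k i (y i))"
  by (simp add: hawaiian_limit_def topspace_wedge PiE_iff)

lemma continuous_map_limit_map:
  assumes g: "disjoint_supports b g" and cont: "\<And>j. continuous_map W (Xs j) (g j)"
  shows "continuous_map W (hawaiian_limit Xs b) (limit_map b g)"
  unfolding hawaiian_limit_def continuous_map_in_subtopology
proof (intro conjI funcsetI CollectI allI impI)
  show "continuous_map W (product_topology (wedge Xs b) UNIV) (limit_map b g)"
    unfolding continuous_map_componentwise_UNIV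
    using continuous_map_wedge_map[OF g cont] by (simp add: limit_map_def)
  show "limit_map b g w k = collapse k i (limit_map b g w i)" if "k \<le> i" for w k i
    using collapse_wedge_map[OF g that, of w] by (simp add: limit_map_def)
qed

definition limit_proj :: "(nat \<Rightarrow> 'a) \<Rightarrow> nat \<Rightarrow> (nat \<Rightarrow> (nat \<times> 'a) option) \<Rightarrow> 'a" where
  "limit_proj b j y = wedge_proj b j (y j)"

lemma limit_proj_limit_map: "disjoint_supports b g \<Longrightarrow> limit_proj b j (limit_map b g w) = g j w"
  by (simp add: limit_proj_def limit_map_def wedge_proj_wedge_map)

lemma continuous_map_limit_component: "continuous_map (hawaiian_limit Xs b) (wedge Xs b i) (\<lambda>y. y i)"
  unfolding hawaiian_limit_def
  by (intro continuous_map_from_subtopology continuous_map_product_projection) simp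

lemma continuous_map_limit_proj:
  assumes "\<And>j. b j \<in> topspace (Xs j)"
  shows "continuous_map (hawaiian_limit Xs b) (Xs j) (limit_proj b j)"
  using continuous_map_compose[OF continuous_map_limit_component continuous_map_wedge_proj[where Xs = Xs and b = b, OF assms]]
  by (simp add: limit_proj_def [abs_def] o_def)

lemma wedge_proj_component:
  assumes "y \<in> topspace (hawaiian_limit Xs b)" "j \<le> i"
  shows "wedge_proj b j (y i) = limit_proj b j y"
proof -
  have "y j = collapse j i (y i)" using assms by (simp add: topspace_hawaiian_limit)
  then show ?thesis using wedge_proj_collapse[of j j b i "y i"] by (simp add: limit_proj_def)
qed

lemma limit_proj_unique:
  assumes y: "y \<in> topspace (hawaiian_limit Xs b)" and "limit_proj b j y \<noteq> b j" "limit_proj b k y \<noteq> b k"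
  shows "j = k"
  using assms(2,3) wedge_proj_component[OF y, of j "max j k"] wedge_proj_component[OF y, of k "max j k"]
    wedge_proj_unique[of b j "y (max j k)" k] by simp

lemma limit_proj_eqI:
  assumes y: "y \<in> topspace (hawaiian_limit Xs b)" and y': "y' \<in> topspace (hawaiian_limit Xs b)"
    and eq: "\<And>j. limit_proj b j y = limit_proj b j y'"
  shows "y = y'"
proof
  fix i
  show "y i = y' i"
    by (rule wedge_proj_eqI[of _ Xs b i])
      (use y y' eq in \<open>simp_all add: topspace_hawaiian_limit wedge_proj_component[OF y] wedge_proj_component[OF y']\<close>)
qed

definition limit_base :: "nat \<Rightarrow> (nat \<times> 'a) option" where
  "limit_base = (\<lambda>i. None)"

lemma limit_base_in: "limit_base \<in> topspace (hawaiian_limit Xs b)"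
  by (simp add: limit_base_def topspace_hawaiian_limit wedge_set_def)

lemma limit_proj_base: "limit_proj b j limit_base = b j"
  by (simp add: limit_proj_def limit_base_def)

lemma limit_map_base: "(\<And>j. g j w = b j) \<Longrightarrow> limit_map b g w = limit_base"
  by (auto simp: limit_map_def limit_base_def intro!: wedge_map_None)

lemma dep_on_limit_map: "(\<And>j. dep_on S (g j)) \<Longrightarrow> dep_on S (limit_map b g)"
  unfolding dep_on_def limit_map_def wedge_map_def
  by (intro allI impI ext assemble_cong) metis

text \<open>The inclusion of a finite wedge in the limit, built as a section of the projection
  \<open>R\<^sub>i\<close>. It transfers statements about the limit to finite wedges.\<close>

definition wedge_section :: "(nat \<Rightarrow> 'a) \<Rightarrow> nat \<Rightarrow> (nat \<times> 'a) option \<Rightarrow> nat \<Rightarrow> (nat \<times> 'a) option" where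
  "wedge_section b i = limit_map b (\<lambda>j q. if j \<le> i then wedge_proj b j q else b j)"

lemma disjoint_supports_wedge_section: "disjoint_supports b (\<lambda>j q. if j \<le> i then wedge_proj b j q else b j)"
  unfolding disjoint_supports_def using wedge_proj_unique by (metis (full_types))

lemma continuous_map_wedge_section:
  assumes base: "\<And>j. b j \<in> topspace (Xs j)"
  shows "continuous_map (wedge Xs b i) (hawaiian_limit Xs b) (wedge_section b i)"
  unfolding wedge_section_def
proof (rule continuous_map_limit_map[OF disjoint_supports_wedge_section])
  show "continuous_map (wedge Xs b i) (Xs j) (\<lambda>q. if j \<le> i then wedge_proj b j q else b j)" for j
    using continuous_map_wedge_proj[where Xs = Xs and b = b, OF base] base by (cases "j \<le> i") auto
qed

lemma limit_proj_wedge_section: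
  "limit_proj b j (wedge_section b i q) = (if j \<le> i then wedge_proj b j q else b j)"
  unfolding wedge_section_def by (rule limit_proj_limit_map[OF disjoint_supports_wedge_section])

lemma wedge_section_None: "wedge_section b i None = limit_base"
  unfolding wedge_section_def by (rule limit_map_base) simp

lemma wedge_section_component:
  assumes base: "\<And>j. b j \<in> topspace (Xs j)" and q: "q \<in> wedge_set Xs b i"
  shows "wedge_section b i q i = q"
proof (rule wedge_proj_eqI[OF _ q])
  have s: "wedge_section b i q \<in> topspace (hawaiian_limit Xs b)"
    using continuous_map_wedge_section[where Xs = Xs and b = b and i = i, OF base] q
    by (auto simp: continuous_map_def topspace_wedge)
  then show "wedge_section b i q i \<in> wedge_set Xs b i" by (simp add: topspace_hawaiian_limit)
  show "wedge_proj b j (wedge_section b i q i) = wedge_proj b j q" if "j \<le> i" for j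
    using that by (simp add: wedge_proj_component[OF s] limit_proj_wedge_section)
qed

section \<open>Bijectivity of the comparison map\<close>

context hawaiian_family
begin

abbreviation "Z \<equiv> hawaiian_limit Xs b"

lemma cube_family_limit_proj:
  assumes F: "cube_map n Z limit_base F"
  shows "cube_family n Xs b (\<lambda>j x. limit_proj b j (F x))"
  unfolding cube_family_def
proof (intro conjI allI impI)
  have FZ: "F x \<in> topspace Z" for x using cube_mapD(1)[OF F] by (auto simp: continuous_map_def)
  show "j = k" if "limit_proj b j (F x) \<noteq> b j" "limit_proj b k (F x) \<noteq> b k" for x j k
    using FZ that by (rule limit_proj_unique)
  show "cube_map n (Xs j) (b j) (\<lambda>x. limit_proj b j (F x))" for j
    unfolding cube_map_def
  proof (intro conjI allI impI)
    show "continuous_map euclidean (Xs j) (\<lambda>x. limit_proj b j (F x))"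
      using continuous_map_compose[OF cube_mapD(1)[OF F] continuous_map_limit_proj[where Xs = Xs and b = b, OF base]]
      by (simp add: o_def)
    show "dep_on {..<n} (\<lambda>x. limit_proj b j (F x))"
      using cube_mapD(2)[OF F] unfolding dep_on_def by metis
    show "limit_proj b j (F x) = b j" if "\<exists>i<n. x i \<notin> {0<..<1}" for x
    proof -
      have "F x = limit_base" using F that unfolding cube_map_def by blast
      then show ?thesis by (simp add: limit_proj_base)
    qed
  qed
qed

lemma cube_map_limit_map:
  assumes "cube_family n Xs b g"
  shows "cube_map n Z limit_base (limit_map b g)"
proof -
  have g: "cube_map n (Xs j) (b j) (g j)" for j using assms by (simp add: cube_family_def)
  have d: "disjoint_supports b g" using assms by (simp add: cube_family_def disjoint_supports_def)
  show ?thesis unfolding cube_map_def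
  proof (intro conjI allI impI)
    show "continuous_map euclidean Z (limit_map b g)"
      by (rule continuous_map_limit_map[OF d cube_mapD(1)[OF g]])
    show "dep_on {..<n} (limit_map b g)" by (rule dep_on_limit_map[OF cube_mapD(2)[OF g]])
    show "limit_map b g x = limit_base" if "\<exists>i<n. x i \<notin> {0<..<1}" for x
    proof (rule limit_map_base)
      show "g j x = b j" for j using g[of j] that unfolding cube_map_def by blast
    qed
  qed
qed

text \<open>A family homotopy is itself a family over the product with the time axis, so it defines
  a map into the limit. Its ends are recognised by their projections, which separate the points of
  the limit.\<close>

lemma cube_homotopic_limit:
  assumes F: "cube_map n Z limit_base F" and G: "cube_map n Z limit_base G"
    and hom: "family_homotopic n Xs b (\<lambda>j x. limit_proj b j (F x)) (\<lambda>j x. limit_proj b j (G x))"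
  shows "cube_homotopic n Z limit_base F G"
proof -
  obtain \<Phi> where \<Phi>: "family_homotopy n Xs b \<Phi>" and \<Phi>0: "\<forall>j x. \<Phi> j (x, 0) = limit_proj b j (F x)"
    and \<Phi>1: "\<forall>j x. \<Phi> j (x, 1) = limit_proj b j (G x)"
    using hom unfolding family_homotopic_def by blast
  have d: "disjoint_supports b \<Phi>" using \<Phi> unfolding family_homotopy_def disjoint_supports_def by (rule conjunct2)
  have ch: "cube_homotopy n (Xs j) (b j) (\<Phi> j)" for j using \<Phi> by (simp add: family_homotopy_def)
  have cont: "continuous_map euclidean Z (limit_map b \<Phi>)"
    by (rule continuous_map_limit_map[OF d]) (use ch in \<open>simp add: cube_homotopy_def\<close>)
  have fam: "cube_family n Xs b (\<lambda>j x. \<Phi> j (x, t))" for t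
    unfolding cube_family_def
  proof (intro conjI allI impI)
    show "cube_map n (Xs j) (b j) (\<lambda>x. \<Phi> j (x, t))" for j using ch by (simp add: cube_homotopy_def)
    show "j = k" if "\<Phi> j (x, t) \<noteq> b j" "\<Phi> k (x, t) \<noteq> b k" for x j k
      using d that unfolding disjoint_supports_def by blast
  qed
  have slice: "limit_map b \<Phi> (x, t) = limit_map b (\<lambda>j x. \<Phi> j (x, t)) x" for x t
    unfolding limit_map_def wedge_map_def by (intro ext assemble_cong) simp
  have "cube_homotopy n Z limit_base (limit_map b \<Phi>)"
    unfolding cube_homotopy_def slice using cont cube_map_limit_map[OF fam] by simp
  moreover have in_Z: "H x \<in> topspace Z" if "cube_map n Z limit_base H" for H and x :: "nat \<Rightarrow> real"
    using cube_mapD(1)[OF that] by (auto simp: continuous_map_def)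
  have LZ: "limit_map b \<Phi> p \<in> topspace Z" for p using cont by (auto simp: continuous_map_def)
  have "limit_map b \<Phi> (x, 0) = F x" for x
    by (rule limit_proj_eqI[OF LZ in_Z[OF F]]) (simp add: limit_proj_limit_map[OF d] \<Phi>0)
  moreover have "limit_map b \<Phi> (x, 1) = G x" for x
    by (rule limit_proj_eqI[OF LZ in_Z[OF G]]) (simp add: limit_proj_limit_map[OF d] \<Phi>1)
  ultimately show ?thesis unfolding cube_homotopic_def by (intro exI[of _ "limit_map b \<Phi>"]) simp
qed

text \<open>Injectivity in substance: translated to cubes, the hypothesis says that two families are
  homotopic one by one, and \<open>family_homotopic_if_components\<close> applies.\<close>

lemma based_homotopic_limit_if_components:
  assumes F: "F \<in> based_maps n Z limit_base" and G: "G \<in> based_maps n Z limit_base"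
    and hom: "\<And>j. based_homotopic n (Xs j) (b j) (limit_proj b j \<circ> F) (limit_proj b j \<circ> G)"
  shows "based_homotopic n Z limit_base F G"
proof (rule cube_homotopic_imp_homotopic)
  note F' = cube_map_based_map[OF F] and G' = cube_map_based_map[OF G]
  show "cube_homotopic n Z limit_base (\<lambda>x. F (cube_to_sphere n x)) (\<lambda>x. G (cube_to_sphere n x))"
  proof (rule cube_homotopic_limit[OF F' G'])
    have "cube_homotopic n (Xs j) (b j) (\<lambda>x. limit_proj b j (F (cube_to_sphere n x)))
        (\<lambda>x. limit_proj b j (G (cube_to_sphere n x)))" for j
      using homotopic_imp_cube_homotopic[OF hom[of j]] by simp
    then show "family_homotopic n Xs b (\<lambda>j x. limit_proj b j (F (cube_to_sphere n x)))
        (\<lambda>j x. limit_proj b j (G (cube_to_sphere n x)))"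
      by (intro family_homotopic_if_components cube_family_limit_proj F' G')
  qed
  show "F sphere_base = limit_base" "G sphere_base = limit_base" using F G by (simp_all add: based_maps_def)
  show "limit_base \<in> topspace Z" by (rule limit_base_in)
qed

text \<open>Both maps are pushed into the limit by the section, compared there, and projected back.
  The summands beyond \<open>i\<close> contribute constant maps.\<close>

lemma based_homotopic_wedge_if_components:
  assumes F: "F \<in> based_maps n (wedge Xs b i) None" and G: "G \<in> based_maps n (wedge Xs b i) None"
    and hom: "\<And>j. j \<le> i \<Longrightarrow> based_homotopic n (Xs j) (b j) (wedge_proj b j \<circ> F) (wedge_proj b j \<circ> G)"
  shows "based_homotopic n (wedge Xs b i) None F G"
proof -
  let ?s = "wedge_section b i" and ?r = "\<lambda>y :: nat \<Rightarrow> (nat \<times> 'a) option. y i"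
  note cs = continuous_map_wedge_section[where Xs = Xs and b = b and i = i, OF base]
  note cr = continuous_map_limit_component[of Xs b i]
  have sF: "?s \<circ> F \<in> based_maps n Z limit_base" by (rule based_maps_compose[OF F cs wedge_section_None])
  have sG: "?s \<circ> G \<in> based_maps n Z limit_base" by (rule based_maps_compose[OF G cs wedge_section_None])
  have "based_homotopic n (Xs j) (b j) (limit_proj b j \<circ> (?s \<circ> F)) (limit_proj b j \<circ> (?s \<circ> G))" for j
  proof (cases "j \<le> i")
    case True
    then have "limit_proj b j \<circ> (?s \<circ> H) = wedge_proj b j \<circ> H" for H :: "(nat \<Rightarrow> real) \<Rightarrow> (nat \<times> 'a) option"
      by (auto simp: limit_proj_wedge_section)
    then show ?thesis using hom[OF True] by simp
  next
    case False
    then have "limit_proj b j \<circ> (?s \<circ> H) = (\<lambda>_. b j)" for H :: "(nat \<Rightarrow> real) \<Rightarrow> (nat \<times> 'a) option"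
      by (auto simp: limit_proj_wedge_section)
    then show ?thesis using base by simp
  qed
  then have "based_homotopic n Z limit_base (?s \<circ> F) (?s \<circ> G)"
    by (rule based_homotopic_limit_if_components[OF sF sG])
  then have rs: "based_homotopic n (wedge Xs b i) None (?r \<circ> (?s \<circ> F)) (?r \<circ> (?s \<circ> G))"
    by (rule based_homotopic_compose[OF _ cr]) (simp add: limit_base_def)
  have eq: "based_homotopic n (wedge Xs b i) None (?r \<circ> (?s \<circ> H)) H"
    if H: "H \<in> based_maps n (wedge Xs b i) None" for H
  proof (rule based_homotopic_equal)
    show "?r \<circ> (?s \<circ> H) \<in> based_maps n (wedge Xs b i) None"
      by (intro based_maps_compose[OF based_maps_compose[OF H cs wedge_section_None] cr])
        (simp add: limit_base_def)
    show "(?r \<circ> (?s \<circ> H)) u = H u" if "u \<in> topspace (nsphere n)" for u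
    proof -
      have "H u \<in> wedge_set Xs b i"
        using H that by (auto simp: based_maps_def continuous_map_def topspace_wedge)
      then show ?thesis using wedge_section_component[where Xs = Xs and b = b, OF base] by simp
    qed
  qed (rule H)
  show ?thesis
    using homotopic_with_trans[OF homotopic_with_trans[OF homotopic_with_symD[OF eq[OF F]] rs] eq[OF G]] .
qed

lemma beta_hclass:
  assumes "F \<in> based_maps n Z limit_base"
  shows "beta n Xs b (hclass n Z limit_base F) = (\<lambda>i. hclass n (wedge Xs b i) None ((\<lambda>y. y i) \<circ> F))"
  unfolding beta_def
  by (intro ext induced_hclass[OF assms continuous_map_limit_component]) (simp add: limit_base_def)

lemma component_based_map:
  assumes "F \<in> based_maps n Z limit_base"
  shows "(\<lambda>y. y i) \<circ> F \<in> based_maps n (wedge Xs b i) None"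
  by (rule based_maps_compose[OF assms continuous_map_limit_component]) (simp add: limit_base_def)

lemma limit_proj_eq_wedge_proj: "limit_proj b j \<circ> F = wedge_proj b j \<circ> ((\<lambda>y. y j) \<circ> F)"
  by (auto simp: limit_proj_def)

lemma beta_in_limit:
  assumes F: "F \<in> based_maps n Z limit_base"
  shows "beta n Xs b (hclass n Z limit_base F) \<in> limit_homotopy_groups n Xs b"
  unfolding limit_homotopy_groups_def beta_hclass[OF F]
proof (intro CollectI conjI allI impI)
  show "hclass n (wedge Xs b i) None ((\<lambda>y. y i) \<circ> F) \<in> homotopy_group n (wedge Xs b i) None" for i
    using component_based_map[OF F] by (simp add: homotopy_group_def)
  fix k i :: nat assume ki: "k \<le> i"
  note cc = continuous_map_collapse[where Xs = Xs and b = b and i = i and k = k, OF base]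
  have b: "collapse k i \<circ> ((\<lambda>y. y i) \<circ> F) \<in> based_maps n (wedge Xs b k) None"
    by (rule based_maps_compose[OF component_based_map[OF F] cc]) simp
  have "induced n (wedge Xs b k) None (collapse k i) (hclass n (wedge Xs b i) None ((\<lambda>y. y i) \<circ> F))
      = hclass n (wedge Xs b k) None (collapse k i \<circ> ((\<lambda>y. y i) \<circ> F))"
    by (rule induced_hclass[OF component_based_map[OF F] cc]) simp
  also have "\<dots> = hclass n (wedge Xs b k) None ((\<lambda>y. y k) \<circ> F)"
    unfolding hclass_eq_iff[OF b component_based_map[OF F]]
  proof (rule based_homotopic_equal[OF b component_based_map[OF F]])
    fix u assume "u \<in> topspace (nsphere n)"
    then have "F u \<in> topspace Z" using F by (auto simp: based_maps_def continuous_map_def)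
    then have "F u k = collapse k i (F u i)" using ki by (simp add: topspace_hawaiian_limit)
    then show "(collapse k i \<circ> ((\<lambda>y. y i) \<circ> F)) u = ((\<lambda>y. y k) \<circ> F) u" by simp
  qed
  finally show "induced n (wedge Xs b k) None (collapse k i) (hclass n (wedge Xs b i) None ((\<lambda>y. y i) \<circ> F))
      = hclass n (wedge Xs b k) None ((\<lambda>y. y k) \<circ> F)" .
qed

text \<open>Only the diagonal is needed: the class of component \<open>j\<close> determines the
  class of the projection to \<open>Xs j\<close>.\<close>

lemma beta_injective:
  assumes F: "F \<in> based_maps n Z limit_base" and G: "G \<in> based_maps n Z limit_base"
    and eq: "beta n Xs b (hclass n Z limit_base F) = beta n Xs b (hclass n Z limit_base G)"
  shows "hclass n Z limit_base F = hclass n Z limit_base G"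
  unfolding hclass_eq_iff[OF F G]
proof (rule based_homotopic_limit_if_components[OF F G])
  fix j
  have "hclass n (wedge Xs b j) None ((\<lambda>y. y j) \<circ> F) = hclass n (wedge Xs b j) None ((\<lambda>y. y j) \<circ> G)"
    using fun_cong[OF eq, of j] unfolding beta_hclass[OF F] beta_hclass[OF G] .
  then have "based_homotopic n (wedge Xs b j) None ((\<lambda>y. y j) \<circ> F) ((\<lambda>y. y j) \<circ> G)"
    unfolding hclass_eq_iff[OF component_based_map[OF F] component_based_map[OF G]] .
  then show "based_homotopic n (Xs j) (b j) (limit_proj b j \<circ> F) (limit_proj b j \<circ> G)"
    unfolding limit_proj_eq_wedge_proj
    by (rule based_homotopic_compose[OF _ continuous_map_wedge_proj[where Xs = Xs and b = b, OF base]]) simp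
qed

lemma beta_surjective:
  assumes c: "c \<in> limit_homotopy_groups n Xs b"
  obtains F where "F \<in> based_maps n Z limit_base" "beta n Xs b (hclass n Z limit_base F) = c"
proof -
  have cg: "c i \<in> homotopy_group n (wedge Xs b i) None" for i using c by (simp add: limit_homotopy_groups_def)
  have compat: "induced n (wedge Xs b k) None (collapse k i) (c i) = c k" if "k \<le> i" for k i
    using c that by (simp add: limit_homotopy_groups_def)
  have "\<forall>i. \<exists>f. f \<in> based_maps n (wedge Xs b i) None \<and> c i = hclass n (wedge Xs b i) None f"
    using cg unfolding homotopy_group_def by blast
  from choice[OF this] obtain f where
    f: "\<And>i. f i \<in> based_maps n (wedge Xs b i) None" and cf: "\<And>i. c i = hclass n (wedge Xs b i) None (f i)"
    by auto
  note cp = continuous_map_wedge_proj[where Xs = Xs and b = b, OF base]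
  note cc = continuous_map_collapse[where Xs = Xs and b = b, OF base]
  \<comment> \<open>From the representative of \<open>c j\<close> only the last summand is kept. By
    compatibility, the projection of \<open>c i\<close> to \<open>Xs j\<close> gives the same class
    for every i \<ge> j.\<close>
  define a where "a j = wedge_proj b j \<circ> f j" for j
  have a: "a j \<in> based_maps n (Xs j) (b j)" for j
    unfolding a_def by (rule based_maps_compose[OF f cp]) simp
  note a' = cube_map_based_map[OF a]
  define g where "g j = squeeze j (\<lambda>x. a j (cube_to_sphere n x))" for j
  have g: "cube_family n Xs b g"
    using cube_family_squeeze[of n Xs b "\<lambda>j x. a j (cube_to_sphere n x)"] a' one_less unfolding g_def [abs_def] by blast
  then have dg: "disjoint_supports b g" by (simp add: cube_family_def disjoint_supports_def)
  obtain F where F: "F \<in> based_maps n Z limit_base" and FG: "\<And>x. F (cube_to_sphere n x) = limit_map b g x"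
    using cube_map_imp_based_map[OF cube_map_limit_map[OF g] limit_base_in] by auto
  have Fa: "based_homotopic n (Xs j) (b j) (limit_proj b j \<circ> F) (a j)" for j
  proof (rule cube_homotopic_imp_homotopic)
    have "cube_homotopic n (Xs j) (b j) (g j) (\<lambda>x. a j (cube_to_sphere n x))"
      unfolding g_def by (rule cube_homotopic_sym[OF cube_map_squeeze(2)[OF a' one_less]])
    then show "cube_homotopic n (Xs j) (b j) (\<lambda>x. (limit_proj b j \<circ> F) (cube_to_sphere n x)) (\<lambda>x. a j (cube_to_sphere n x))"
      by (simp add: FG limit_proj_limit_map[OF dg])
    show "(limit_proj b j \<circ> F) sphere_base = b j" "a j sphere_base = b j"
      using F a[of j] by (simp_all add: based_maps_def limit_proj_base)
  qed (rule base)
  have "based_homotopic n (wedge Xs b i) None ((\<lambda>y. y i) \<circ> F) (f i)" for i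
  proof (rule based_homotopic_wedge_if_components[OF component_based_map[OF F] f])
    fix j assume j: "j \<le> i"
    have "wedge_proj b j \<circ> ((\<lambda>y. y i) \<circ> F) \<in> based_maps n (Xs j) (b j)"
      by (rule based_maps_compose[OF component_based_map[OF F] cp]) simp
    moreover have "limit_proj b j \<circ> F \<in> based_maps n (Xs j) (b j)"
      by (rule based_maps_compose[OF F continuous_map_limit_proj[where Xs = Xs and b = b, OF base]])
        (rule limit_proj_base)
    moreover have "(wedge_proj b j \<circ> ((\<lambda>y. y i) \<circ> F)) u = (limit_proj b j \<circ> F) u" if "u \<in> topspace (nsphere n)" for u
    proof -
      have "F u \<in> topspace Z" using F that by (auto simp: based_maps_def continuous_map_def)
      then show ?thesis using wedge_proj_component j by simp
    qed
    ultimately have 1: "based_homotopic n (Xs j) (b j) (wedge_proj b j \<circ> ((\<lambda>y. y i) \<circ> F)) (limit_proj b j \<circ> F)"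
      by (rule based_homotopic_equal)
    have cb: "collapse j i \<circ> f i \<in> based_maps n (wedge Xs b j) None"
      by (rule based_maps_compose[OF f cc]) simp
    \<comment> \<open>Compatibility of \<open>c\<close> compares the representatives at levels
      \<open>i\<close> and \<open>j\<close>. Collapsing to level \<open>j\<close> does not change
      the projection to \<open>Xs j\<close>, so \<open>f i\<close> and \<open>f j\<close> have
      homotopic projections there.\<close>
    have "hclass n (wedge Xs b j) None (collapse j i \<circ> f i) = hclass n (wedge Xs b j) None (f j)"
      using compat[OF j] induced_hclass[OF f cc, of j i] by (simp add: cf)
    then have "based_homotopic n (wedge Xs b j) None (collapse j i \<circ> f i) (f j)"
      unfolding hclass_eq_iff[OF cb f] .
    then have "based_homotopic n (Xs j) (b j) (wedge_proj b j \<circ> (collapse j i \<circ> f i)) (wedge_proj b j \<circ> f j)"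
      by (rule based_homotopic_compose[OF _ cp]) simp
    moreover have "wedge_proj b j \<circ> (collapse j i \<circ> f i) = wedge_proj b j \<circ> f i"
      by (auto simp: wedge_proj_collapse)
    ultimately have 2: "based_homotopic n (Xs j) (b j) (wedge_proj b j \<circ> f i) (a j)"
      by (simp add: a_def)
    show "based_homotopic n (Xs j) (b j) (wedge_proj b j \<circ> ((\<lambda>y. y i) \<circ> F)) (wedge_proj b j \<circ> f i)"
      using homotopic_with_trans[OF homotopic_with_trans[OF 1 Fa] homotopic_with_symD[OF 2]] .
  qed
  then have "hclass n (wedge Xs b i) None ((\<lambda>y. y i) \<circ> F) = c i" for i
    unfolding cf using hclass_eq_iff[OF component_based_map[OF F] f] by blast
  then have "beta n Xs b (hclass n Z limit_base F) = c" unfolding beta_hclass[OF F] by blast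
  with F show ?thesis by (rule that)
qed

lemma bij_betw_beta:
  "bij_betw (beta n Xs b) (homotopy_group n Z limit_base) (limit_homotopy_groups n Xs b)"
  unfolding bij_betw_def
proof
  show "inj_on (beta n Xs b) (homotopy_group n Z limit_base)"
    by (auto intro!: inj_onI elim!: homotopy_groupE dest: beta_injective)
  show "beta n Xs b ` homotopy_group n Z limit_base = limit_homotopy_groups n Xs b"
  proof (intro antisym subsetI)
    fix c assume "c \<in> beta n Xs b ` homotopy_group n Z limit_base"
    then show "c \<in> limit_homotopy_groups n Xs b"
      by (auto elim!: homotopy_groupE intro: beta_in_limit)
  next
    fix c assume "c \<in> limit_homotopy_groups n Xs b"
    then obtain F where F: "F \<in> based_maps n Z limit_base" "beta n Xs b (hclass n Z limit_base F) = c"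
      by (rule beta_surjective)
    then have "hclass n Z limit_base F \<in> homotopy_group n Z limit_base" by (simp add: homotopy_group_def)
    then show "c \<in> beta n Xs b ` homotopy_group n Z limit_base" using F(2) by blast
  qed
qed

end

theorem theorem1p1:
  fixes n :: nat and Xs :: "nat \<Rightarrow> 'a topology" and b :: "nat \<Rightarrow> 'a"
  assumes "n \<ge> 2"
    and "\<And>j. b j \<in> topspace (Xs j)"
    and "\<And>j. finite_CW_complex (Xs j)"
    and "\<And>j. connected_upto (n - 1) (Xs j)"
    and "\<And>j. locally_connected_upto (n - 1) (Xs j)"
    and "\<And>j. semilocally_n_simply_connected n (Xs j)"
  shows "bij_betw (beta n Xs b)
           (homotopy_group n (hawaiian_limit Xs b) (\<lambda>i. None))
           (limit_homotopy_groups n Xs b)"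
proof -
  have "hawaiian_family n Xs b"
  proof
    show "2 \<le> n" by (rule assms(1))
    show "b j \<in> topspace (Xs j)" for j by (rule assms(2))
    show "Hausdorff_space (Xs j)" for j using assms(3)[of j] unfolding finite_CW_complex_def by (rule conjunct1)
    show "contractible_base (Xs j) (b j)" for j
      by (rule finite_CW_local_contraction[OF assms(3,2), of j]) (unfold contractible_base_def, blast)
    show "is_singleton (homotopy_group k (Xs j) (b j))" if "k < n" for j k
      using assms(2)[of j] assms(4)[of j] that by (auto simp: connected_upto_def)
  qed
  from hawaiian_family.bij_betw_beta[OF this] show ?thesis unfolding limit_base_def .
qed

end
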